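(* The Polish groups $\mathrm{Isom}(\mathbf{H})$ and $\mathrm{Isom}(\mathcal{H})$ have automatic continuity: for $G$ equal to either of these groups, every group homomorphism $G\to H$, where $H$ is any separable Hausdorff topological group, is continuous.
   Context: $\mathcal{H}$ is an infinite-dimensional separable real Hilbert space with Hilbert basis $(e_i)_{i\in\mathbb{N}}$, and $\mathrm{Isom}(\mathcal{H})$ is the group of all isometries of $\mathcal{H}$ for the norm metric. Let $Q(x)=x_0^2-\sum_{i\ge1}x_i^2$ with polarized symmetric bilinear form $(\cdot,\cdot)$. The infinite-dimensional separable hyperbolic space is $\mathbf{H}=\{x\in\mathcal{H}: Q(x)=1,\ x_0>0\}$ with metric $\cosh d(x,y)=(x,y)$, and $\mathrm{Isom}(\mathbf{H})$ is its isometry group. Both isometry groups carry the topology of pointwise convergence (the coarsest group topology making all orbit maps $g\mapsto gx$ continuous), which is Polish. *)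

theory Defs
  imports "HOL-Analysis.Analysis" "HOL-Algebra.Bij"
begin

section \<open>Topological groups and automatic continuity\<close>

definition topological_group :: "('g, 'm) monoid_scheme \<Rightarrow> 'g topology \<Rightarrow> bool" where
  "topological_group G T \<longleftrightarrow>
     group G \<and> topspace T = carrier G \<and>
     continuous_map (prod_topology T T) T (\<lambda>(g, h). g \<otimes>\<^bsub>G\<^esub> h) \<and>
     continuous_map T T (\<lambda>g. inv\<^bsub>G\<^esub> g)"

definition polish_group :: "('g, 'm) monoid_scheme \<Rightarrow> 'g topology \<Rightarrow> bool" where
  "polish_group G T \<longleftrightarrow>
     topological_group G T \<and> separable_space T \<and> completely_metrizable_space T"

text \<open>
  A HOL formula cannot quantify over types, so the type of the elements of the target group
  is a parameter. A theorem about \<open>automatic_continuity TYPE('h) G T\<close> with a free type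
  variable \<open>'h\<close> covers every separable Hausdorff target group.
\<close>

definition automatic_continuity ::
    "'h itself \<Rightarrow> ('g, 'm) monoid_scheme \<Rightarrow> 'g topology \<Rightarrow> bool" where
  "automatic_continuity (_ :: 'h itself) G T \<longleftrightarrow>
     (\<forall>(H :: 'h monoid) S f.
        topological_group H S \<and> separable_space S \<and> Hausdorff_space S \<and> f \<in> hom G H
        \<longrightarrow> continuous_map T S f)"


section \<open>Isometry groups with the topology of pointwise convergence\<close>

text \<open>
  Isometries of \<open>(X, d)\<close> are the distance-preserving bijections of \<open>X\<close>. As in
  \<^const>\<open>BijGroup\<close> they are taken extensional, so that each isometry of the set \<open>X\<close> is
  represented by exactly one function.
\<close>

definition isom_group :: "'a set \<Rightarrow> ('a \<Rightarrow> 'a \<Rightarrow> real) \<Rightarrow> ('a \<Rightarrow> 'a) monoid" where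
  "isom_group X d = (BijGroup X)
     \<lparr>carrier := {g \<in> Bij X. \<forall>x\<in>X. \<forall>y\<in>X. d (g x) (g y) = d x y}\<rparr>"

definition pointwise_topology :: "'a set \<Rightarrow> ('a \<Rightarrow> 'a \<Rightarrow> real) \<Rightarrow> ('a \<Rightarrow> 'a) topology" where
  "pointwise_topology X d =
     subtopology (product_topology (\<lambda>_. Metric_space.mtopology X d) X)
       (carrier (isom_group X d))"

lemma isom_group_group: "group (isom_group X d)"
proof -
  let ?I = "{g \<in> Bij X. \<forall>x\<in>X. \<forall>y\<in>X. d (g x) (g y) = d x y}"
  interpret group "BijGroup X" by (rule group_BijGroup)
  have "subgroup ?I (BijGroup X)"
  proof (rule subgroupI)
    show "?I \<subseteq> carrier (BijGroup X)" by (auto simp: BijGroup_def)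
    show "?I \<noteq> {}" using id_Bij[of X] by force
  next
    fix g assume g: "g \<in> ?I"
    then have inv: "inv\<^bsub>BijGroup X\<^esub> g = (\<lambda>x\<in>X. inv_into X g x)"
      by (simp add: inv_BijGroup)
    have "d (inv_into X g x) (inv_into X g y) = d x y" if "x \<in> X" "y \<in> X" for x y
    proof -
      have "g ` X = X" using g by (auto simp: Bij_def bij_betw_def)
      then have "inv_into X g x \<in> X" "inv_into X g y \<in> X"
          "g (inv_into X g x) = x" "g (inv_into X g y) = y"
        using that by (auto simp: inv_into_into f_inv_into_f)
      then show ?thesis using g by force
    qed
    then show "inv\<^bsub>BijGroup X\<^esub> g \<in> ?I"
      using g restrict_inv_into_Bij[of g X] by (simp add: inv)
  next
    fix g h assume gh: "g \<in> ?I" "h \<in> ?I"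
    then have "\<And>x. x \<in> X \<Longrightarrow> h x \<in> X" using Bij_imp_funcset by blast
    then show "g \<otimes>\<^bsub>BijGroup X\<^esub> h \<in> ?I"
      using gh compose_Bij[of g X h] by (simp add: BijGroup_def compose_def)
  qed
  from subgroup_imp_group[OF this] show ?thesis by (simp add: isom_group_def)
qed

lemma topspace_pointwise_topology:
  assumes "Metric_space X d"
  shows "topspace (pointwise_topology X d) = carrier (isom_group X d)"
proof -
  have "Bij X \<subseteq> X \<rightarrow>\<^sub>E X"
    unfolding Bij_def PiE_def by (auto dest: bij_betw_imp_funcset)
  then show ?thesis
    using Metric_space.topspace_mtopology[OF assms]
    by (auto simp: pointwise_topology_def isom_group_def)
qed

lemma continuous_map_orbit:
  assumes "Metric_space X d" "x \<in> X"
  shows "continuous_map (pointwise_topology X d) (Metric_space.mtopology X d) (\<lambda>g. g x)"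
  unfolding pointwise_topology_def
  by (intro continuous_map_from_subtopology continuous_map_product_projection assms)

lemma pointwise_topology_coarsest:
  assumes "Metric_space X d" "topspace T = carrier (isom_group X d)"
    and "\<And>x. x \<in> X \<Longrightarrow> continuous_map T (Metric_space.mtopology X d) (\<lambda>g. g x)"
    and "openin (pointwise_topology X d) U"
  shows "openin T U"
proof -
  have "continuous_map T (pointwise_topology X d) (\<lambda>g. g)"
    unfolding pointwise_topology_def continuous_map_in_subtopology
      continuous_map_componentwise
    using assms(2,3) by (auto simp: isom_group_def Bij_def)
  moreover have "U \<subseteq> topspace T"
    using openin_subset[OF assms(4)] assms(1,2) topspace_pointwise_topology by blast
  moreover from this have "{g \<in> topspace T. g \<in> U} = U" by blast
  ultimately show ?thesis
    using openin_continuous_map_preimage[OF _ assms(4), of T "\<lambda>g. g"] by simp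
qed


section \<open>Hilbert bases and infinite-dimensional hyperbolic space\<close>

text \<open>
  A complete real inner product space with a Hilbert basis indexed by \<^typ>\<open>nat\<close> is exactly
  an infinite-dimensional separable real Hilbert space.
\<close>

definition hilbert_basis :: "(nat \<Rightarrow> 'a::{real_inner, complete_space}) \<Rightarrow> bool" where
  "hilbert_basis e \<longleftrightarrow>
     (\<forall>i j. e i \<bullet> e j = (if i = j then 1 else 0)) \<and> closure (span (range e)) = UNIV"

definition hyp_quad :: "(nat \<Rightarrow> 'a::{real_inner, complete_space}) \<Rightarrow> 'a \<Rightarrow> real" where
  "hyp_quad e x = (x \<bullet> e 0)\<^sup>2 - (\<Sum>i. (x \<bullet> e (Suc i))\<^sup>2)"

definition hyp_form :: "(nat \<Rightarrow> 'a::{real_inner, complete_space}) \<Rightarrow> 'a \<Rightarrow> 'a \<Rightarrow> real" where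
  "hyp_form e x y = (hyp_quad e (x + y) - hyp_quad e x - hyp_quad e y) / 2"

definition hyp_space :: "(nat \<Rightarrow> 'a::{real_inner, complete_space}) \<Rightarrow> 'a set" where
  "hyp_space e = {x. hyp_quad e x = 1 \<and> x \<bullet> e 0 > 0}"

text \<open>
  The distance is the \<open>d \<ge> 0\<close> with \<open>cosh d\<close> equal to the form (lemma \<open>cosh_hyp_dist\<close> below).
  The value \<open>0\<close> outside hyperbolic space is a dummy: the locale \<^locale>\<open>Metric_space\<close>
  asks for a nonnegative function on the whole type.
\<close>

definition hyp_dist :: "(nat \<Rightarrow> 'a::{real_inner, complete_space}) \<Rightarrow> 'a \<Rightarrow> 'a \<Rightarrow> real" where
  "hyp_dist e x y =
     (if x \<in> hyp_space e \<and> y \<in> hyp_space e then arcosh (hyp_form e x y) else 0)"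

lemma hilbert_basis_parseval:
  assumes "hilbert_basis e"
  shows "(\<lambda>i. (x \<bullet> e i)\<^sup>2) sums (x \<bullet> x)"
proof -
  have on: "e i \<bullet> e j = (if i = j then 1 else 0)" for i j
    using assms by (simp add: hilbert_basis_def)
  have inj: "inj e" by (metis injI on zero_neq_one)
  define s where "s n = (\<Sum>i<n. (x \<bullet> e i) *\<^sub>R e i)" for n
  have se: "s n \<bullet> e j = (if j < n then x \<bullet> e j else 0)" for n j
    by (simp add: s_def inner_sum_left on if_distrib cong: if_cong)
  have xs: "(x - s n) \<bullet> e j = 0" if "j < n" for n j
    using that by (simp add: inner_diff_left se)
  have ss: "s n \<bullet> s n = (\<Sum>i<n. (x \<bullet> e i)\<^sup>2)" "x \<bullet> s n = (\<Sum>i<n. (x \<bullet> e i)\<^sup>2)" for n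
    unfolding s_def[of n] inner_sum_right
    by (simp_all add: s_def[symmetric] se power2_eq_square inner_sum_right)
  have res: "(norm (x - s n))\<^sup>2 = x \<bullet> x - (\<Sum>i<n. (x \<bullet> e i)\<^sup>2)" for n
    using ss[of n] by (simp add: power2_norm_eq_inner inner_diff inner_commute)
  have "(\<lambda>n. \<Sum>i<n. (x \<bullet> e i)\<^sup>2) \<longlonglongrightarrow> x \<bullet> x"
  proof (rule LIMSEQ_I)
    fix r :: real assume r: "0 < r"
    have "x \<in> closure (span (range e))" using assms by (simp add: hilbert_basis_def)
    then obtain y where y: "y \<in> span (range e)" "dist y x < sqrt r"
      using r by (metis closure_approachable real_sqrt_gt_zero)
    from y(1) obtain F c where F: "finite F" "F \<subseteq> range e" "y = (\<Sum>v\<in>F. c v *\<^sub>R v)"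
      unfolding span_explicit by blast
    obtain A where A: "finite A" "F = e ` A" using F finite_subset_image by metis
    obtain N where N: "A \<subseteq> {..<N}" using A(1) by (metis finite_nat_iff_bounded)
    show "\<exists>no. \<forall>n\<ge>no. norm ((\<Sum>i<n. (x \<bullet> e i)\<^sup>2) - x \<bullet> x) < r"
    proof (intro exI allI impI)
      fix n assume n: "N \<le> n"
      have "(x - s n) \<bullet> y = 0"
        using A N n xs[of _ n] unfolding F(3) inner_sum_right
        by (intro sum.neutral) (auto simp del: inner_diff_left)
      moreover have "(x - s n) \<bullet> s n = 0"
        using ss[of n] by (simp add: inner_diff_left)
      ultimately have orth: "(x - s n) \<bullet> (s n - y) = 0" by (simp add: inner_diff_right)
      have "(norm (x - y))\<^sup>2 = (norm ((x - s n) + (s n - y)))\<^sup>2" by simp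
      also have "\<dots> = (norm (x - s n))\<^sup>2 + (norm (s n - y))\<^sup>2"
        unfolding power2_norm_eq_inner using orth
        by (simp only: inner_add_left inner_add_right inner_commute[of "s n - y" "x - s n"])
      finally have "(norm (x - s n))\<^sup>2 \<le> (norm (x - y))\<^sup>2" by simp
      also have "\<dots> < (sqrt r)\<^sup>2"
        using y(2) by (intro power_strict_mono) (auto simp: dist_norm norm_minus_commute)
      finally have "(norm (x - s n))\<^sup>2 < r" using r by simp
      moreover have "0 \<le> (norm (x - s n))\<^sup>2" by simp
      ultimately show "norm ((\<Sum>i<n. (x \<bullet> e i)\<^sup>2) - x \<bullet> x) < r"
        using res[of n] by simp
    qed
  qed
  then show ?thesis by (simp add: sums_def)
qed

lemma hyp_quad_eq:
  assumes "hilbert_basis e"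
  shows "hyp_quad e x = 2 * (x \<bullet> e 0)\<^sup>2 - x \<bullet> x"
  using sums_unique[OF sums_split_initial_segment[OF hilbert_basis_parseval[OF assms, of x], of 1]]
  by (simp add: hyp_quad_def)

lemma hyp_form_eq:
  assumes "hilbert_basis e"
  shows "hyp_form e x y = 2 * (x \<bullet> e 0) * (y \<bullet> e 0) - x \<bullet> y"
proof -
  have "hyp_quad e (x + y) - hyp_quad e x - hyp_quad e y =
      2 * (2 * (x \<bullet> e 0) * (y \<bullet> e 0) - x \<bullet> y)"
    by (simp add: hyp_quad_eq[OF assms] inner_commute[of y x] power2_eq_square algebra_simps)
  then show ?thesis by (simp add: hyp_form_def)
qed

lemma hyp_form_self: 
  assumes "hilbert_basis e"
  shows "hyp_form e x x = hyp_quad e x"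
  by (simp add: hyp_form_eq[OF assms] hyp_quad_eq[OF assms] power2_eq_square)

lemma hyp_form_ge_1:
  assumes e: "hilbert_basis e" and x: "x \<in> hyp_space e" and y: "y \<in> hyp_space e"
  shows "hyp_form e x y \<ge> 1" "hyp_form e x y = 1 \<Longrightarrow> x = y"
proof -
  have e0: "e 0 \<bullet> e 0 = 1" using e by (simp add: hilbert_basis_def)
  define a where "a = x \<bullet> e 0"
  define b where "b = y \<bullet> e 0"
  define u where "u = x - a *\<^sub>R e 0"
  define v where "v = y - b *\<^sub>R e 0"
  have ab: "a > 0" "b > 0" using x y by (auto simp: hyp_space_def a_def b_def)
  have u: "u \<bullet> u = a\<^sup>2 - 1" and v: "v \<bullet> v = b\<^sup>2 - 1"
    using x y by (auto simp: hyp_space_def hyp_quad_eq[OF e] a_def b_def u_def v_def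
        inner_diff inner_commute e0 power2_eq_square algebra_simps)
  have B: "hyp_form e x y = a * b - u \<bullet> v"
    by (simp add: hyp_form_eq[OF e] a_def b_def u_def v_def
        inner_diff inner_commute e0 algebra_simps)
  define w where "w = b *\<^sub>R u - a *\<^sub>R v"
  have "w \<bullet> w = b\<^sup>2 * (u \<bullet> u) + a\<^sup>2 * (v \<bullet> v) - 2 * a * b * (u \<bullet> v)"
    by (simp add: w_def inner_diff inner_commute power2_eq_square algebra_simps)
  then have w: "w \<bullet> w = 2 * a * b * hyp_form e x y - a\<^sup>2 - b\<^sup>2"
    by (simp add: u v B power2_eq_square algebra_simps)
  have key: "2 * a * b * (hyp_form e x y - 1) = w \<bullet> w + (a - b)\<^sup>2"
    by (simp add: w power2_eq_square algebra_simps)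
  then have "0 \<le> 2 * a * b * (hyp_form e x y - 1)" by simp
  moreover have "0 < 2 * a * b" using ab by simp
  ultimately show "hyp_form e x y \<ge> 1" by (metis diff_ge_0_iff_ge zero_le_mult_iff not_less)
  assume "hyp_form e x y = 1"
  then have "w \<bullet> w + (a - b)\<^sup>2 = 0" using key by simp
  moreover have "w \<bullet> w \<ge> 0" "(a - b)\<^sup>2 \<ge> 0" by simp_all
  ultimately have "w \<bullet> w = 0" "(a - b)\<^sup>2 = 0" by linarith+
  then have "w = 0" "a = b" by simp_all
  then have "u = v" using ab by (simp add: w_def)
  then show "x = y" using \<open>a = b\<close> by (simp add: u_def v_def)
qed

lemma cosh_hyp_dist:
  assumes "hilbert_basis e" "x \<in> hyp_space e" "y \<in> hyp_space e"
  shows "cosh (hyp_dist e x y) = hyp_form e x y"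
  using hyp_form_ge_1(1)[OF assms] assms(2,3) by (simp add: hyp_dist_def)

lemma hyp_form_nonpos:
  assumes e: "hilbert_basis e" and y: "y \<in> hyp_space e" and u: "hyp_form e u y = 0"
  shows "hyp_form e u u \<le> 0"
proof -
  have e0: "e 0 \<bullet> e 0 = 1" using e by (simp add: hilbert_basis_def)
  define b where "b = y \<bullet> e 0"
  define c where "c = u \<bullet> e 0"
  define u' where "u' = u - c *\<^sub>R e 0"
  define y' where "y' = y - b *\<^sub>R e 0"
  have b: "b > 0" using y by (auto simp: hyp_space_def b_def)
  have yy: "y' \<bullet> y' = b\<^sup>2 - 1"
    using y by (auto simp: hyp_space_def hyp_quad_eq[OF e] b_def y'_def
        inner_commute e0 power2_eq_square algebra_simps)
  have uu: "hyp_form e u u = c\<^sup>2 - u' \<bullet> u'"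
    by (simp add: hyp_form_eq[OF e] c_def u'_def inner_commute e0 power2_eq_square algebra_simps)
  have uy: "u' \<bullet> y' = c * b"
    using u by (simp add: hyp_form_eq[OF e] c_def b_def u'_def y'_def
        inner_commute e0 algebra_simps)
  have "c\<^sup>2 * b\<^sup>2 = (u' \<bullet> y')\<^sup>2" by (simp add: uy power_mult_distrib)
  also have "\<dots> \<le> (u' \<bullet> u') * (y' \<bullet> y')" by (rule Cauchy_Schwarz_ineq)
  also have "\<dots> \<le> (u' \<bullet> u') * b\<^sup>2" by (intro mult_left_mono) (simp_all add: yy)
  finally have "c\<^sup>2 \<le> u' \<bullet> u'" using b by simp
  then show ?thesis by (simp add: uu)
qed

lemma hyp_form_triangle:
  assumes e: "hilbert_basis e"
    and x: "x \<in> hyp_space e" and y: "y \<in> hyp_space e" and z: "z \<in> hyp_space e"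
  shows "hyp_form e x z \<le> hyp_form e x y * hyp_form e y z +
           sqrt ((hyp_form e x y)\<^sup>2 - 1) * sqrt ((hyp_form e y z)\<^sup>2 - 1)"
proof -
  let ?B = "hyp_form e"
  note B = hyp_form_eq[OF e]
  define a where "a = ?B x y"
  define b where "b = ?B y z"
  have add: "?B (p + q) r = ?B p r + ?B q r" and diff: "?B (p - q) r = ?B p r - ?B q r"
    and scale: "?B (k *\<^sub>R p) r = k * ?B p r"
    and add': "?B r (p + q) = ?B r p + ?B r q" and diff': "?B r (p - q) = ?B r p - ?B r q"
    and scale': "?B r (k *\<^sub>R p) = k * ?B r p" for p q r k
    by (simp_all add: B algebra_simps)
  have comm: "?B p r = ?B r p" for p r
    by (simp add: B inner_commute mult_ac)
  have one: "?B x x = 1" "?B y y = 1" "?B z z = 1"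
    using x y z by (auto simp: hyp_form_self[OF e] hyp_space_def)
  have ge: "a \<ge> 1" "b \<ge> 1"
    using hyp_form_ge_1(1)[OF e] x y z by (auto simp: a_def b_def)
  show ?thesis
  proof (cases "a = 1 \<or> b = 1")
    case True
    then have "x = y \<or> y = z"
      using hyp_form_ge_1(2)[OF e] x y z by (auto simp: a_def b_def)
    then show ?thesis using one by auto
  next
    case False
    define u where "u = x - a *\<^sub>R y"
    define v where "v = z - b *\<^sub>R y"
    define s where "s = sqrt (b\<^sup>2 - 1)"
    define t where "t = sqrt (a\<^sup>2 - 1)"
    have "a\<^sup>2 > 1" "b\<^sup>2 > 1" using False ge by (simp_all add: one_less_power)
    then have st: "s > 0" "t > 0" "s\<^sup>2 = b\<^sup>2 - 1" "t\<^sup>2 = a\<^sup>2 - 1"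
      by (simp_all add: s_def t_def)
    have yx: "?B y x = a" and xy: "?B x y = a" and yz: "?B y z = b" and zy: "?B z y = b"
      and zx: "?B z x = ?B x z"
      using comm[of y x] comm[of z y] comm[of z x] by (simp_all add: a_def b_def)
    note expand = add diff scale add' diff' scale' yx xy yz zy zx one
    have orth: "?B u y = 0" "?B v y = 0"
      by (simp_all add: u_def v_def expand)
    have uu: "?B u u = 1 - a\<^sup>2" and vv: "?B v v = 1 - b\<^sup>2" and uv: "?B x z = a * b + ?B u v"
      by (simp_all add: u_def v_def expand power2_eq_square algebra_simps)
    have "?B (s *\<^sub>R u + t *\<^sub>R v) y = 0" by (simp add: add scale orth)
    from hyp_form_nonpos[OF e y this]
    have "s * (s * ?B u u + t * ?B u v) + t * (s * ?B u v + t * ?B v v) \<le> 0"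
      by (simp add: add scale add' scale' comm[of v u] algebra_simps)
    then have "(2 * (s * t)) * ?B u v \<le> s\<^sup>2 * (a\<^sup>2 - 1) + t\<^sup>2 * (b\<^sup>2 - 1)"
      by (simp add: uu vv power2_eq_square algebra_simps)
    also have "\<dots> = (2 * (s * t)) * (s * t)"
      unfolding st(3,4)[symmetric] by (simp add: power2_eq_square algebra_simps)
    finally have "?B u v \<le> s * t" using st(1,2) by (simp add: mult_le_cancel_left)
    then show ?thesis using uv by (simp add: a_def b_def s_def t_def mult.commute)
  qed
qed

lemma Metric_space_hyp:
  assumes e: "hilbert_basis e"
  shows "Metric_space (hyp_space e) (hyp_dist e)"

proof
  fix x y z
  have ge: "hyp_form e p q \<ge> 1" if "p \<in> hyp_space e" "q \<in> hyp_space e" for p q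
    using hyp_form_ge_1(1)[OF e that] .
  show nonneg: "0 \<le> hyp_dist e p q" for p q
    using ge by (simp add: hyp_dist_def)
  show "hyp_dist e x y = hyp_dist e y x"
    by (simp add: hyp_dist_def hyp_form_eq[OF e] inner_commute mult_ac)
  assume x: "x \<in> hyp_space e" and y: "y \<in> hyp_space e"
  show "hyp_dist e x y = 0 \<longleftrightarrow> x = y"
  proof
    assume "hyp_dist e x y = 0"
    then have "hyp_form e x y = 1" using cosh_hyp_dist[OF e x y] by simp
    then show "x = y" by (rule hyp_form_ge_1(2)[OF e x y])
  next
    assume "x = y"
    then show "hyp_dist e x y = 0"
      using x by (simp add: hyp_dist_def hyp_form_self[OF e]) (simp add: hyp_space_def)
  qed
  assume z: "z \<in> hyp_space e"
  have "cosh (hyp_dist e x z) \<le> cosh (hyp_dist e x y + hyp_dist e y z)"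
    using hyp_form_triangle[OF e x y z] ge x y z
    by (simp add: cosh_add cosh_hyp_dist[OF e]) (simp add: hyp_dist_def sinh_arcosh_real)
  then show "hyp_dist e x z \<le> hyp_dist e x y + hyp_dist e y z"
    using nonneg by (simp add: cosh_real_nonneg_le_iff)
qed

end

theory Submission
  imports Defs
begin

text \<open>
  Let \<open>W\<close> be a symmetric set countably many translates of which cover the orthogonal group
  (such as the preimage of a small neighbourhood of \<open>1\<close>). Some fixed power of \<open>W\<close>, with
  an exponent not depending on \<open>W\<close>, contains a neighbourhood of \<open>1\<close>. A diagonal argument
  over a decomposition into infinitely many blocks makes \<open>W\<^sup>2\<close> restrict onto the full
  orthogonal group of one block, and a commutator with a shift found in \<open>W\<^sup>2\<close> by the
  pigeonhole principle turns this into operators supported on a smaller block \<open>B\<close>.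
  Conjugating by an element of \<open>W\<^sup>2\<close> built from almost disjoint sets gives a second block
  \<open>B'\<close> with \<open>B \<union> B'\<close> of finite codimension, and four factors supported on \<open>B\<close> and
  \<open>B'\<close> give every operator supported on \<open>B \<union> B'\<close>. Finally, if a power of \<open>W\<close> contains the
  pointwise stabilizer \<open>K\<close> of a finite-dimensional \<open>F\<close> and \<open>g \<in> W\<^sup>2\<close> rotates \<open>F\<close> by a
  nonzero angle into its complement, then \<open>K g K g\<inverse> K\<close> has nonempty interior, because up to
  \<open>K\<close> on both sides an operator is determined by a matrix of inner products and all
  matrices close to a multiple of the identity occur.

  So homomorphisms into separable groups are continuous on point stabilizers of both isometry
  groups. A stabilizer and a conjugate of it generate the isometry group in a controlled way,
  which transfers continuity to the whole group.
\<close>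

section \<open>Orthogonal operators of a Hilbert space\<close>

text \<open>The homomorphism is arbitrary, so the preimage W of a neighbourhood has no topological
  regularity and Baire category says nothing about it; only countability is available. It is used in
  two ways: a diagonal operator assembled from one counterexample per translate cannot escape all
  translates, and an uncountable family has two members in one translate. The geometric steps are
  therefore arranged as uncountable families in which the quotient of any two members does the job,
  whichever pair is returned: shifts, branches of a binary tree, rotations. The exponent must be
  known before W, since W comes from a V whose power of that order lies in the given neighbourhood.
  It is 168 = 44 + (40 + 44 + 40), where 40 = 8 + 12 + 8 + 12 pays for the operators fixing a finite
  set F of basis vectors and 44 = 2 + 40 + 2 for a conjugate of one of them. The passage to the
  isometry group works near an element that moves the base point, because the distance travelled can
  then be varied in both directions.\<close>

definition isometric :: "('a::real_inner \<Rightarrow> 'a) \<Rightarrow> bool" where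
  "isometric T \<longleftrightarrow> (\<forall>x y. T x \<bullet> T y = x \<bullet> y)"

lemma isometricD: "isometric T \<Longrightarrow> T x \<bullet> T y = x \<bullet> y"
  by (simp add: isometric_def)

text \<open>The squared norms of the defects of additivity and homogeneity expand into inner
  products that T preserves, and these cancel to 0.\<close>

lemma isometric_linear:
  assumes "isometric T" shows "linear T"
proof (rule linearI)
  note T = isometricD[OF assms]
  fix x y c
  have "(T (x + y) - (T x + T y)) \<bullet> (T (x + y) - (T x + T y)) = 0"
    by (simp add: inner_diff inner_add T algebra_simps)
  then show "T (x + y) = T x + T y" by simp
  have "(T (c *\<^sub>R x) - c *\<^sub>R T x) \<bullet> (T (c *\<^sub>R x) - c *\<^sub>R T x) = 0"
    by (simp add: inner_diff T algebra_simps)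
  then show "T (c *\<^sub>R x) = c *\<^sub>R T x" by simp
qed

lemma isometric_norm: "isometric T \<Longrightarrow> norm (T x) = norm x"
  by (simp add: norm_eq_sqrt_inner isometricD)

lemma isometric_diff: "isometric T \<Longrightarrow> T (x - y) = T x - T y"
  using isometric_linear linear_diff by blast

lemma isometric_inj: "isometric T \<Longrightarrow> inj T"
  by (rule linear_injective_0[THEN iffD2, OF isometric_linear, rule_format])
    (metis isometric_norm norm_eq_zero)+

text \<open>For the surjective isometric operators used here the inverse is the Hilbert space
  adjoint (\<open>orth_adjoint\<close>), hence the name.\<close>

abbreviation adj :: "('a \<Rightarrow> 'a) \<Rightarrow> 'a \<Rightarrow> 'a" where
  "adj T \<equiv> inv_into UNIV T"

definition orthonormal_on :: "'i set \<Rightarrow> ('i \<Rightarrow> 'a::real_inner) \<Rightarrow> bool" where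
  "orthonormal_on I u \<longleftrightarrow> (\<forall>i\<in>I. \<forall>j\<in>I. u i \<bullet> u j = (if i = j then 1 else 0))"

lemma orthonormal_onD:
  "orthonormal_on I u \<Longrightarrow> i \<in> I \<Longrightarrow> j \<in> I \<Longrightarrow> u i \<bullet> u j = (if i = j then 1 else 0)"
  by (simp add: orthonormal_on_def)

section \<open>Orthonormal series and Bessel's inequality\<close>

lemma norm_sum_orthonormal:
  assumes "orthonormal_on UNIV u" "finite F"
  shows "(norm (\<Sum>i\<in>F. c i *\<^sub>R u i))\<^sup>2 = (\<Sum>i\<in>F. (c i)\<^sup>2)"
proof -
  have u: "u i \<bullet> u j = (if i = j then 1 else 0)" for i j
    using orthonormal_onD[OF assms(1)] by blast
  have "(\<Sum>i\<in>F. c i *\<^sub>R u i) \<bullet> (\<Sum>i\<in>F. c i *\<^sub>R u i) = (\<Sum>i\<in>F. (c i)\<^sup>2)"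
    using assms(2)
    by (simp add: inner_sum_left inner_sum_right u if_distrib power2_eq_square cong: if_cong)
  then show ?thesis by (simp add: power2_norm_eq_inner)
qed

text \<open>By Pythagoras a block of the series has squared norm equal to the same block of the sum
  of squares, so the Cauchy criterion passes from the real series to the vectors.\<close>

lemma summable_orthonormal:
  fixes u :: "nat \<Rightarrow> 'a::{real_inner, complete_space}"
  assumes u: "orthonormal_on UNIV u" and c: "summable (\<lambda>i. (c i)\<^sup>2)"
  shows "summable (\<lambda>i. c i *\<^sub>R u i)"
proof -
  have "\<exists>N. \<forall>m\<ge>N. \<forall>n. norm (sum (\<lambda>i. c i *\<^sub>R u i) {m..<n}) < r" if r: "r > 0" for r
  proof -
    have "\<exists>N. \<forall>m\<ge>N. \<forall>n. norm (sum (\<lambda>i. (c i)\<^sup>2) {m..<n}) < r\<^sup>2"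
      using c r unfolding summable_Cauchy by simp
    then obtain N where N: "\<And>m n. m \<ge> N \<Longrightarrow> norm (sum (\<lambda>i. (c i)\<^sup>2) {m..<n}) < r\<^sup>2" by blast
    have "norm (sum (\<lambda>i. c i *\<^sub>R u i) {m..<n}) < r" if "m \<ge> N" for m n
    proof -
      have "(norm (sum (\<lambda>i. c i *\<^sub>R u i) {m..<n}))\<^sup>2 < r\<^sup>2"
        using N[OF that, of n] by (simp add: norm_sum_orthonormal[OF u])
      then show ?thesis using r by (simp add: power_less_imp_less_base)
    qed
    then show ?thesis by blast
  qed
  note * = this
  have **: "\<exists>N. \<forall>m\<ge>N. \<forall>n\<ge>m. norm ((\<Sum>i<n. c i *\<^sub>R u i) - (\<Sum>i<m. c i *\<^sub>R u i)) < r"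
    if "r > 0" for r
  proof -
    from * [OF that] obtain N where "\<forall>m\<ge>N. \<forall>n. norm (sum (\<lambda>i. c i *\<^sub>R u i) {m..<n}) < r" ..
    then have "\<forall>m\<ge>N. \<forall>n\<ge>m. norm ((\<Sum>i<n. c i *\<^sub>R u i) - (\<Sum>i<m. c i *\<^sub>R u i)) < r"
      using sum_diff_nat_ivl[of 0 _ _ "\<lambda>i. c i *\<^sub>R u i"] by (simp add: lessThan_atLeast0)
    then show ?thesis ..
  qed
  have "Cauchy (\<lambda>n. \<Sum>i<n. c i *\<^sub>R u i)"
  proof (rule CauchyI)
    fix r :: real assume "r > 0"
    then obtain N where N: "\<And>m n. m \<ge> N \<Longrightarrow> n \<ge> m \<Longrightarrow>
        norm ((\<Sum>i<n. c i *\<^sub>R u i) - (\<Sum>i<m. c i *\<^sub>R u i)) < r"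
      using **[of r] by blast
    have "norm ((\<Sum>i<m. c i *\<^sub>R u i) - (\<Sum>i<n. c i *\<^sub>R u i)) < r" if "m \<ge> N" "n \<ge> N" for m n
    proof (cases "m \<le> n")
      case True
      show ?thesis using N[OF that(1) True] by (simp add: norm_minus_commute)
    next
      case False
      then show ?thesis using N[OF that(2), of m] by simp
    qed
    then show "\<exists>M. \<forall>m\<ge>M. \<forall>n\<ge>M. norm ((\<Sum>i<m. c i *\<^sub>R u i) - (\<Sum>i<n. c i *\<^sub>R u i)) < r"
      by blast
  qed
  then show ?thesis
    by (simp add: Cauchy_convergent_iff summable_iff_convergent)
qed

lemma Bessel:
  fixes u :: "nat \<Rightarrow> 'a::real_inner"
  assumes u: "orthonormal_on UNIV u"
  shows "summable (\<lambda>i. (x \<bullet> u i)\<^sup>2)"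
proof (rule bounded_imp_summable)
  fix n
  define s where "s = (\<Sum>i\<le>n. (x \<bullet> u i) *\<^sub>R u i)"
  have ss: "s \<bullet> s = (\<Sum>i\<le>n. (x \<bullet> u i)\<^sup>2)"
    using norm_sum_orthonormal[OF u, of "{..n}" "\<lambda>i. x \<bullet> u i"]
    by (simp add: power2_norm_eq_inner s_def)
  have xs: "x \<bullet> s = (\<Sum>i\<le>n. (x \<bullet> u i)\<^sup>2)"
    by (simp add: s_def inner_sum_right power2_eq_square)
  have "0 \<le> (x - s) \<bullet> (x - s)" by simp
  also have "\<dots> = x \<bullet> x - (\<Sum>i\<le>n. (x \<bullet> u i)\<^sup>2)"
    using ss xs by (simp add: inner_diff inner_commute)
  finally show "(\<Sum>i\<le>n. (x \<bullet> u i)\<^sup>2) \<le> x \<bullet> x" by simp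
qed simp

section \<open>Coordinate subspaces and the orthogonal operators supported on them\<close>

locale hilbert =
  fixes e :: "nat \<Rightarrow> 'a::{real_inner, complete_space}"
  assumes basis: "hilbert_basis e"
begin

lemma e_inner: "e i \<bullet> e j = (if i = j then 1 else 0)"
  using basis by (simp add: hilbert_basis_def)

lemma orthonormal_e: "orthonormal_on I e"
  by (simp add: orthonormal_on_def e_inner)

text \<open>Polarization of Parseval's identity.\<close>

lemma inner_sums: "(\<lambda>i. (x \<bullet> e i) * (y \<bullet> e i)) sums (x \<bullet> y)"
proof -
  note p = hilbert_basis_parseval[OF basis]
  have "(\<lambda>i. (((x + y) \<bullet> e i)\<^sup>2 - (x \<bullet> e i)\<^sup>2 - (y \<bullet> e i)\<^sup>2) / 2) sums
      (((x + y) \<bullet> (x + y) - x \<bullet> x - y \<bullet> y) / 2)"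
    by (intro sums_divide sums_diff p)
  then show ?thesis
    by (simp add: inner_add inner_commute power2_eq_square algebra_simps)
qed

lemma eqI:
  assumes "\<And>i. x \<bullet> e i = y \<bullet> e i" shows "x = y"
proof -
  have "(\<lambda>i. ((x - y) \<bullet> e i)\<^sup>2) sums ((x - y) \<bullet> (x - y))"
    by (rule hilbert_basis_parseval[OF basis])
  moreover have "((x - y) \<bullet> e i)\<^sup>2 = 0" for i
    using assms[of i] by (simp add: inner_diff_left)
  ultimately have "(\<lambda>i. 0 :: real) sums ((x - y) \<bullet> (x - y))" by simp
  then have "(x - y) \<bullet> (x - y) = 0" using sums_unique2[OF _ sums_zero] by blast
  then show ?thesis by simp
qed

text \<open>The closed span of the \<open>e i\<close> with i in A, described through vanishing
  coordinates so that no closure has to be handled.\<close>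

definition sub :: "nat set \<Rightarrow> 'a set" where
  "sub A = {x. \<forall>i. i \<notin> A \<longrightarrow> x \<bullet> e i = 0}"

lemma subD: "x \<in> sub A \<Longrightarrow> i \<notin> A \<Longrightarrow> x \<bullet> e i = 0"
  by (simp add: sub_def)

lemma subspace_sub: "subspace (sub A)"
  by (auto simp: sub_def subspace_def inner_add)

lemmas sub_add = subspace_add[OF subspace_sub]
  and sub_diff = subspace_diff[OF subspace_sub]
  and sub_scale = subspace_scale[OF subspace_sub]

lemma e_in_sub: "i \<in> A \<Longrightarrow> e i \<in> sub A"
  by (auto simp: sub_def e_inner)

lemma sub_mono: "A \<subseteq> B \<Longrightarrow> sub A \<subseteq> sub B"
  by (auto simp: sub_def)

lemma inner_sub_disjoint:
  assumes "x \<in> sub A" "y \<in> sub B" "A \<inter> B = {}"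
  shows "x \<bullet> y = 0"
proof -
  have "(x \<bullet> e i) * (y \<bullet> e i) = 0" for i
    using assms subD[of x A i] subD[of y B i] by auto
  then have "(\<lambda>i. 0 :: real) sums (x \<bullet> y)" using inner_sums[of x y] by (simp only:)
  then show ?thesis using sums_unique2[OF _ sums_zero] by blast
qed

text \<open>Riesz-Fischer: the series along u with the coordinates of x converges, inner products
  are compared coordinatewise, and totality of u gives surjectivity. Direct sums, permutations of
  the basis and extensions of partial isometries below are instances.\<close>

lemma basis_map:
  assumes u: "orthonormal_on UNIV u" and total: "\<And>x. (\<And>i::nat. x \<bullet> u i = 0) \<Longrightarrow> x = 0"
  shows "\<exists>T. isometric T \<and> surj T \<and> (\<forall>i. T (e i) = u i)"
proof -
  define T where "T x = (\<Sum>i. (x \<bullet> e i) *\<^sub>R u i)" for x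
  have "summable (\<lambda>i. (x \<bullet> e i)\<^sup>2)" for x
    using hilbert_basis_parseval[OF basis] sums_summable by blast
  then have S: "(\<lambda>i. (x \<bullet> e i) *\<^sub>R u i) sums T x" for x
    unfolding T_def by (intro summable_sums summable_orthonormal[OF u])
  have SI: "(\<lambda>i. (x \<bullet> e i) * (u i \<bullet> z)) sums (T x \<bullet> z)" for x z
    using bounded_linear.sums[OF bounded_linear_inner_left[of z] S[of x]] by simp
  have Tu: "T x \<bullet> u j = x \<bullet> e j" for x j
  proof -
    have "(\<lambda>i. (x \<bullet> e i) * (u i \<bullet> u j)) sums (x \<bullet> e j)"
      using sums_single[of j "\<lambda>i. x \<bullet> e i"]
      by (simp add: orthonormal_onD[OF u] if_distrib cong: if_cong)
    then show ?thesis using SI sums_unique2 by blast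
  qed
  have iso: "isometric T" unfolding isometric_def
  proof (intro allI)
    fix x y
    have "u i \<bullet> T y = y \<bullet> e i" for i using Tu[of y i] by (simp add: inner_commute)
    then show "T x \<bullet> T y = x \<bullet> y" using SI[of x "T y"] inner_sums[of x y] sums_unique2 by simp
  qed
  have eq: "y = T x" if "\<And>j. y \<bullet> u j = x \<bullet> e j" for x y
    using total[of "y - T x"] that by (simp add: inner_diff Tu)
  have Te: "T (e i) = u i" for i
    by (rule eq[symmetric]) (simp add: orthonormal_onD[OF u] e_inner)
  have "y \<in> range T" for y
  proof -
    have "summable (\<lambda>i. (y \<bullet> u i) *\<^sub>R e i)"
      by (intro summable_orthonormal orthonormal_e Bessel u)
    then obtain x where x: "(\<lambda>i. (y \<bullet> u i) *\<^sub>R e i) sums x" unfolding summable_def by blast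
    have "x \<bullet> e j = y \<bullet> u j" for j
    proof -
      have "(\<lambda>i. (y \<bullet> u i) * (e i \<bullet> e j)) sums (x \<bullet> e j)"
        using bounded_linear.sums[OF bounded_linear_inner_left[of "e j"] x] by simp
      moreover have "(\<lambda>i. (y \<bullet> u i) * (e i \<bullet> e j)) sums (y \<bullet> u j)"
        using sums_single[of j "\<lambda>i. y \<bullet> u i"] by (simp add: e_inner if_distrib cong: if_cong)
      ultimately show ?thesis using sums_unique2 by blast
    qed
    then have "y = T x" by (intro eq) simp
    then show ?thesis by blast
  qed
  then show ?thesis using iso Te by blast
qed

text \<open>The orthogonal group of \<open>sub A\<close>, with each member extended by the identity
  on the complement; operators for different A can thus be composed.\<close>

definition orth :: "nat set \<Rightarrow> ('a \<Rightarrow> 'a) set" where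
  "orth A = {T. isometric T \<and> surj T \<and> (\<forall>i. i \<notin> A \<longrightarrow> T (e i) = e i)}"

lemma orth_isometric: "T \<in> orth A \<Longrightarrow> isometric T"
  by (simp add: orth_def)

lemma orth_inner: "T \<in> orth A \<Longrightarrow> T x \<bullet> T y = x \<bullet> y"
  by (simp add: orth_def isometricD)

lemma orth_bij: "T \<in> orth A \<Longrightarrow> bij T"
  by (simp add: orth_def bij_def isometric_inj)

lemma orth_inv_left: "T \<in> orth A \<Longrightarrow> adj T (T x) = x"
  using orth_bij by (metis bij_inv_eq_iff)

lemma orth_inv_right: "T \<in> orth A \<Longrightarrow> T (adj T x) = x"
  using orth_bij by (metis bij_inv_eq_iff)

lemma orth_mono: "A \<subseteq> B \<Longrightarrow> orth A \<subseteq> orth B"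
  by (auto simp: orth_def)

lemma orth_UNIV: "T \<in> orth A \<Longrightarrow> T \<in> orth UNIV"
  by (simp add: orth_def)

lemma orth_id: "id \<in> orth A"
  by (simp add: orth_def isometric_def)

lemma orth_comp:
  assumes "S \<in> orth A" "T \<in> orth A" shows "S \<circ> T \<in> orth A"
  using assms comp_surj[of T S] by (auto simp: orth_def isometric_def)

lemma orth_inv:
  assumes "T \<in> orth A" shows "adj T \<in> orth A"
proof -
  have "isometric (adj T)" unfolding isometric_def
    using orth_inner[OF assms, of "adj T _" "adj T _"] by (simp add: orth_inv_right[OF assms])
  moreover have "surj (adj T)" by (intro bij_is_surj bij_imp_bij_inv orth_bij[OF assms])
  moreover have "adj T (e i) = e i" if "i \<notin> A" for i
    using assms that orth_inv_left[OF assms, of "e i"] by (simp add: orth_def)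
  ultimately show ?thesis by (simp add: orth_def)
qed

lemma orth_inv_inv: "T \<in> orth A \<Longrightarrow> adj (adj T) = T"
  by (simp add: inv_inv_eq orth_bij)

lemma orth_adjoint: "T \<in> orth A \<Longrightarrow> T x \<bullet> y = x \<bullet> adj T y"
  using orth_inner[of T A x "adj T y"] by (simp add: orth_inv_right)

lemma orth_fixes_e: "T \<in> orth A \<Longrightarrow> i \<notin> A \<Longrightarrow> T (e i) = e i"
  by (simp add: orth_def)

lemma orth_coord: "T \<in> orth A \<Longrightarrow> i \<notin> A \<Longrightarrow> T x \<bullet> e i = x \<bullet> e i"
  using orth_inner[of T A x "e i"] by (simp add: orth_fixes_e)

lemma orth_sub:
  assumes "T \<in> orth A" "A \<subseteq> B" "x \<in> sub B" shows "T x \<in> sub B"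
proof -
  have "T x \<bullet> e i = 0" if "i \<notin> B" for i
    using assms that orth_coord[of T A i x] subD[of x B i] by auto
  then show ?thesis by (simp add: sub_def)
qed

lemma orth_diff_sub: "T \<in> orth A \<Longrightarrow> T x - x \<in> sub A"
  by (simp add: sub_def inner_diff orth_coord)

text \<open>Linearity alone would settle only finite combinations of basis vectors. Coordinates in A
  are handled through the adjoint instead: it maps \<open>e i\<close> into \<open>sub A\<close>,
  which is perpendicular to x, so no limits are taken.\<close>

lemma orth_fix:
  assumes T: "T \<in> orth A" and x: "x \<in> sub B" and "A \<inter> B = {}"
  shows "T x = x"
proof (rule eqI)
  fix i
  show "T x \<bullet> e i = x \<bullet> e i"
  proof (cases "i \<in> A")
    case True
    have "adj T (e i) \<in> sub A" using orth_sub[OF orth_inv[OF T] subset_refl e_in_sub[OF True]] .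
    then have "x \<bullet> adj T (e i) = 0" "x \<bullet> e i = 0"
      using inner_sub_disjoint[OF x _ ] subD[OF x, of i] True assms(3) by blast+
    then show ?thesis by (simp add: orth_adjoint[OF T])
  qed (simp add: orth_coord[OF T])
qed

text \<open>The quotient \<open>adj S \<circ> T\<close> fixes \<open>e i\<close> for i in I, hence
  is supported off I, and \<open>orth_fix\<close> passes to the closed span.\<close>

lemma orth_agree:
  assumes S: "S \<in> orth A" and T: "T \<in> orth B" and eq: "\<And>i. i \<in> I \<Longrightarrow> S (e i) = T (e i)"
    and x: "x \<in> sub I"
  shows "S x = T x"
proof -
  have "adj S \<circ> T \<in> orth UNIV" by (rule orth_comp[OF orth_inv[OF orth_UNIV[OF S]] orth_UNIV[OF T]])
  moreover have "(adj S \<circ> T) (e i) = e i" if "i \<in> I" for i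
    using eq[OF that, symmetric] by (simp add: orth_inv_left[OF S])
  ultimately have "adj S \<circ> T \<in> orth (- I)" by (auto simp: orth_def)
  then have "(adj S \<circ> T) x = x" by (rule orth_fix[OF _ x]) simp
  then have "S (adj S (T x)) = S x" by simp
  then show ?thesis by (simp add: orth_inv_right[OF S])
qed

lemma orth_eqI:
  assumes S: "S \<in> orth A" and T: "T \<in> orth B" and eq: "\<And>i. S (e i) = T (e i)"
  shows "S = T"
  using orth_agree[OF S T, of UNIV] eq by (auto simp: sub_def)

text \<open>The blocks are the fibres of the labelling b. Since T n preserves its own block, images
  of basis vectors from different blocks stay orthogonal.\<close>

lemma orth_direct_sum:
  fixes b :: "nat \<Rightarrow> 'i"
  assumes T: "\<And>n. T n \<in> orth {k. b k = n}"
  shows "\<exists>D\<in>orth UNIV. \<forall>k. D (e k) = T (b k) (e k)"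
proof -
  let ?u = "\<lambda>k. T (b k) (e k)"
  have s: "?u k \<in> sub {l. b l = b k}" for k
    by (rule orth_sub[OF T[of "b k"] subset_refl]) (simp add: e_in_sub)
  have "orthonormal_on UNIV ?u"
    unfolding orthonormal_on_def
  proof (intro ballI)
    fix i j
    show "?u i \<bullet> ?u j = (if i = j then 1 else 0)"
    proof (cases "b i = b j")
      case True
      then show ?thesis by (simp add: orth_inner[OF T[of "b j"]] e_inner)
    next
      case False
      then have "{l. b l = b i} \<inter> {l. b l = b j} = {}" by auto
      then have "?u i \<bullet> ?u j = 0" by (rule inner_sub_disjoint[OF s s])
      then show ?thesis using False by auto
    qed
  qed
  moreover have "x = 0" if x: "\<And>k. x \<bullet> ?u k = 0" for x
  proof (rule eqI)
    fix k
    have zero: "adj (T (b k)) x \<bullet> e l = 0" if "b l = b k" for l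
      using x[of l] that orth_adjoint[OF orth_inv[OF T], of "b k" x "e l"] orth_inv_inv[OF T]
      by simp
    \<comment> \<open>A vector without coordinates in the block is fixed by T (b k), so x equals its
      own preimage and has no coordinates there either.\<close>
    then have "adj (T (b k)) x \<in> sub (- {l. b l = b k})" by (auto simp: sub_def)
    then have "T (b k) (adj (T (b k)) x) = adj (T (b k)) x"
      by (rule orth_fix[OF T]) simp
    then have "x = adj (T (b k)) x" by (simp add: orth_inv_right[OF T])
    then show "x \<bullet> e k = 0 \<bullet> e k"
      using zero[of k] by simp
  qed
  ultimately have "\<exists>D. isometric D \<and> surj D \<and> (\<forall>i. D (e i) = ?u i)"
    by (rule basis_map)
  then obtain D where "isometric D" "surj D" "\<And>i. D (e i) = ?u i" by blast
  then show ?thesis unfolding orth_def by blast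
qed

lemma orth_permutation:
  assumes "bij p" "\<And>i. i \<notin> A \<Longrightarrow> p i = i"
  shows "\<exists>T\<in>orth A. \<forall>i. T (e i) = e (p i)"
proof -
  have "orthonormal_on UNIV (e \<circ> p)"
    using assms(1) by (auto simp: orthonormal_on_def e_inner bij_def inj_eq)
  moreover have "x = 0" if x: "\<And>k. x \<bullet> (e \<circ> p) k = 0" for x
  proof (rule eqI)
    fix i
    have "p (inv_into UNIV p i) = i" using assms(1) by (simp add: bij_is_surj surj_f_inv_f)
    then show "x \<bullet> e i = 0 \<bullet> e i" using x[of "inv_into UNIV p i"] by simp
  qed
  ultimately have "\<exists>D. isometric D \<and> surj D \<and> (\<forall>i. D (e i) = (e \<circ> p) i)"
    by (rule basis_map)
  then obtain D where "isometric D" "surj D" "\<And>i. D (e i) = (e \<circ> p) i" by blast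
  then show ?thesis using assms(2) unfolding orth_def by auto
qed

end

section \<open>Reflections, Witt extension and completion of orthonormal families\<close>

definition refl_along :: "'a::real_inner \<Rightarrow> 'a \<Rightarrow> 'a" where
  "refl_along a x = x - (2 * (x \<bullet> a) / (a \<bullet> a)) *\<^sub>R a"

lemma isometric_refl_along: "isometric (refl_along a)"
proof (cases "a = 0")
  case False
  then have "a \<bullet> a \<noteq> 0" by simp
  then show ?thesis
    by (simp add: isometric_def refl_along_def inner_diff inner_commute field_simps)
qed (simp add: isometric_def refl_along_def)

lemma refl_along_idem: "refl_along a (refl_along a x) = x"
proof (cases "a = 0")
  case False
  then have "a \<bullet> a \<noteq> 0" by simp
  then have "refl_along a x \<bullet> a = - (x \<bullet> a)"
    by (simp add: refl_along_def inner_diff)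
  then have "refl_along a (refl_along a x) = refl_along a x + (2 * (x \<bullet> a) / (a \<bullet> a)) *\<^sub>R a"
    by (simp add: refl_along_def[of a "refl_along a x"])
  then show ?thesis by (simp add: refl_along_def)
qed (simp add: refl_along_def)

lemma refl_along_fix: "x \<bullet> a = 0 \<Longrightarrow> refl_along a x = x"
  by (simp add: refl_along_def)

text \<open>Reflection in the perpendicular bisector of a and b. For a = b it is
  \<open>refl_along 0\<close>, the identity, because division by 0 gives 0.\<close>

lemma refl_along_swap:
  assumes "a \<bullet> a = b \<bullet> b" shows "refl_along (a - b) a = b"
proof (cases "a = b")
  case False
  then have nz: "(a - b) \<bullet> (a - b) \<noteq> 0" by simp
  have "(a - b) \<bullet> (a - b) = 2 * (a \<bullet> (a - b))"
    using assms by (simp add: inner_diff inner_commute)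
  then have "2 * (a \<bullet> (a - b)) / ((a - b) \<bullet> (a - b)) = 1" using nz by (metis divide_self)
  then have "refl_along (a - b) a = a - 1 *\<^sub>R (a - b)" unfolding refl_along_def by (simp only:)
  then show ?thesis by simp
qed (simp add: refl_along_def)

lemma split_infinite:
  assumes "infinite (A :: nat set)"
  obtains B C where "B \<union> C = A" "B \<inter> C = {}" "infinite B" "infinite C"
proof -
  let ?f = "enumerate A"
  have bij: "bij_betw ?f UNIV A" using assms by (rule bij_enumerate)
  have inj: "inj ?f" and im: "range ?f = A" using bij by (auto simp: bij_betw_def)
  have E: "infinite {n::nat. even n}" "infinite {n::nat. odd n}"
  proof -
    have "\<exists>n\<ge>m. n \<in> {n. even n}" "\<exists>n\<ge>m. n \<in> {n. odd n}" for m :: nat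
      by (rule exI[of _ "2 * m"], simp) (rule exI[of _ "Suc (2 * m)"], simp)
    then show "infinite {n::nat. even n}" "infinite {n::nat. odd n}"
      unfolding infinite_nat_iff_unbounded_le by blast+
  qed
  show ?thesis
  proof
    show "?f ` {n. even n} \<union> ?f ` {n. odd n} = A" using im by auto
    show "?f ` {n. even n} \<inter> ?f ` {n. odd n} = {}" using inj by (auto simp: inj_eq)
    show "infinite (?f ` {n. even n})" "infinite (?f ` {n. odd n})"
      using E inj by (simp_all add: finite_image_iff inj_on_subset[OF inj])
  qed
qed

lemma bij_betw_countable_infinite:
  assumes "countable A" "infinite A" "countable B" "infinite B"
  shows "\<exists>f. bij_betw f A B"
  using bij_betw_trans[OF to_nat_on_infinite[OF assms(1,2)] bij_betw_from_nat_into[OF assms(3,4)]]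
  by blast

context hilbert begin

lemma refl_along_orth:
  assumes "a \<in> sub A" shows "refl_along a \<in> orth A"
proof -
  have "surj (refl_along a)" by (rule surjI) (rule refl_along_idem)
  moreover have "refl_along a (e i) = e i" if "i \<notin> A" for i
    using subD[OF assms that] by (simp add: refl_along_fix inner_commute)
  ultimately show ?thesis by (simp add: orth_def isometric_refl_along)
qed

text \<open>One reflection per vector: once the earlier vectors are in place, k (x h) is reflected
  to y h. Equal Gram matrices make the earlier y f perpendicular to the normal of the mirror, hence
  fixed, and the condition on differences keeps each normal in \<open>sub A\<close>.\<close>

lemma Witt_finite:
  assumes "finite F"
    and gram: "\<And>f g. f \<in> F \<Longrightarrow> g \<in> F \<Longrightarrow> x f \<bullet> x g = y f \<bullet> y g"
    and diff: "\<And>f. f \<in> F \<Longrightarrow> x f - y f \<in> sub A"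
  shows "\<exists>k\<in>orth A. \<forall>f\<in>F. k (x f) = y f"
  using assms
proof (induction F rule: finite_induct)
  case empty
  show ?case using orth_id by blast
next
  case (insert h F)
  then obtain k where k: "k \<in> orth A" "\<And>f. f \<in> F \<Longrightarrow> k (x f) = y f" by force
  let ?a = "k (x h)" and ?b = "y h"
  have ab: "?a \<bullet> ?a = ?b \<bullet> ?b" using insert.prems(1) by (simp add: orth_inner[OF k(1)])
  have sub: "?a - ?b \<in> sub A"
    using sub_add[OF orth_diff_sub[OF k(1), of "x h"] insert.prems(2)[of h]] by simp
  have fixed: "refl_along (?a - ?b) (y f) = y f" if "f \<in> F" for f
  proof (rule refl_along_fix)
    have "y f \<bullet> ?a = x f \<bullet> x h" using orth_inner[OF k(1), of "x f" "x h"] k(2)[OF that] by simp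
    then show "y f \<bullet> (?a - ?b) = 0" using insert.prems(1)[of f h] that by (simp add: inner_diff)
  qed
  have "refl_along (?a - ?b) \<circ> k \<in> orth A"
    by (rule orth_comp[OF refl_along_orth[OF sub] k(1)])
  moreover have "\<forall>f\<in>insert h F. (refl_along (?a - ?b) \<circ> k) (x f) = y f"
    using fixed k(2) refl_along_swap[OF ab] by simp
  ultimately show ?case by blast
qed

text \<open>Instead of counting dimensions, each new y is handled by splitting A: two solutions from
  disjoint halves have a combination perpendicular to y. This is why A varies in the
  induction.\<close>

lemma perp_exists:
  assumes "finite Y" "infinite A"
  shows "\<exists>x\<in>sub A. norm x = 1 \<and> (\<forall>y\<in>Y. x \<bullet> y = 0)"
proof -
  have "\<exists>x\<in>sub A. x \<noteq> 0 \<and> (\<forall>y\<in>Y. x \<bullet> y = 0)" using assms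
  proof (induction Y arbitrary: A rule: finite_induct)
    case empty
    then obtain i where "i \<in> A" by (metis finite.emptyI all_not_in_conv)
    then have "e i \<in> sub A" "e i \<noteq> 0" using e_in_sub e_inner[of i i] by auto
    then show ?case by blast
  next
    case (insert y Y)
    obtain B C where BC: "B \<union> C = A" "B \<inter> C = {}" "infinite B" "infinite C"
      using split_infinite[OF insert.prems] by blast
    obtain p where p: "p \<in> sub B" "p \<noteq> 0" "\<forall>y\<in>Y. p \<bullet> y = 0" using insert.IH[OF BC(3)] by blast
    obtain q where q: "q \<in> sub C" "q \<noteq> 0" "\<forall>y\<in>Y. q \<bullet> y = 0" using insert.IH[OF BC(4)] by blast
    have pA: "p \<in> sub A" "q \<in> sub A" using p q BC sub_mono by blast+
    have pq: "p \<bullet> q = 0" using inner_sub_disjoint[OF p(1) q(1) BC(2)] .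
    define x where "x = (q \<bullet> y) *\<^sub>R p - (p \<bullet> y) *\<^sub>R q"
    show ?case
    proof (cases "p \<bullet> y = 0")
      case True
      then show ?thesis using p pA by auto
    next
      case False
      have "x \<bullet> q = - (p \<bullet> y) * (q \<bullet> q)" by (simp add: x_def inner_diff pq)
      then have "x \<noteq> 0" using False q(2) by auto
      moreover have "x \<in> sub A" unfolding x_def by (intro sub_diff sub_scale pA)
      moreover have "\<forall>z\<in>insert y Y. x \<bullet> z = 0" using p q by (auto simp: x_def inner_diff)
      ultimately show ?thesis by blast
    qed
  qed
  then obtain x where x: "x \<in> sub A" "x \<noteq> 0" "\<And>y. y \<in> Y \<Longrightarrow> x \<bullet> y = 0" by blast
  then have "(1 / norm x) *\<^sub>R x \<in> sub A" by (intro sub_scale)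
  moreover have "norm ((1 / norm x) *\<^sub>R x) = 1" using x(2) by simp
  moreover have "\<forall>y\<in>Y. ((1 / norm x) *\<^sub>R x) \<bullet> y = 0" using x(3) by simp
  ultimately show ?thesis by blast
qed

text \<open>By Bessel the coordinates along any sequence of distinct members of B tend to 0, so only
  finitely many members have a given squared coordinate above a given positive bound; and every
  member has some nonzero coordinate.\<close>

lemma countable_orthonormal:
  assumes B: "orthonormal_on B id"
  shows "countable (B :: 'a set)"
proof -
  have fin: "finite {b\<in>B. (b \<bullet> e i)\<^sup>2 > inverse (real (Suc n))}" (is "finite ?S") for i n
  proof (rule ccontr)
    assume "infinite ?S"
    then obtain u :: "nat \<Rightarrow> 'a" where u: "inj u" "range u \<subseteq> ?S"
      using infinite_countable_subset[of ?S] by auto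
    have "orthonormal_on UNIV u"
      unfolding orthonormal_on_def
    proof (intro ballI)
      fix j k
      have "u j \<in> B" "u k \<in> B" using u(2) by auto
      then show "u j \<bullet> u k = (if j = k then 1 else 0)"
        using orthonormal_onD[OF B, of "u j" "u k"] inj_eq[OF u(1)] by simp
    qed
    then have "(\<lambda>j. (e i \<bullet> u j)\<^sup>2) \<longlonglongrightarrow> 0" by (intro summable_LIMSEQ_zero Bessel)
    then have "eventually (\<lambda>j. (e i \<bullet> u j)\<^sup>2 < inverse (real (Suc n))) sequentially"
      by (rule order_tendstoD) simp
    then obtain j where "(e i \<bullet> u j)\<^sup>2 < inverse (real (Suc n))"
      using eventually_happens' sequentially_bot by blast
    moreover have "(u j \<bullet> e i)\<^sup>2 > inverse (real (Suc n))" using u(2) by auto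
    ultimately show False by (simp add: inner_commute)
  qed
  have "B \<subseteq> (\<Union>i n. {b\<in>B. (b \<bullet> e i)\<^sup>2 > inverse (real (Suc n))})"
  proof
    fix b assume b: "b \<in> B"
    then have "b \<noteq> 0" using orthonormal_onD[OF B b b] by auto
    then obtain i where "b \<bullet> e i \<noteq> 0" using eqI[of b 0] by auto
    then have "(b \<bullet> e i)\<^sup>2 > 0" by simp
    then obtain n where "inverse (real (Suc n)) < (b \<bullet> e i)\<^sup>2" using reals_Archimedean by blast
    then show "b \<in> (\<Union>i n. {b\<in>B. (b \<bullet> e i)\<^sup>2 > inverse (real (Suc n))})" using b by blast
  qed
  then show ?thesis
    by (rule countable_subset) (intro countable_UN countableI_type countable_finite fin)
qed

lemma maximal_orthonormal:
  assumes V: "V \<subseteq> sub A" "orthonormal_on V id"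
  shows "\<exists>B. V \<subseteq> B \<and> B \<subseteq> sub A \<and> orthonormal_on B id \<and>
    (\<forall>x\<in>sub A. (\<forall>b\<in>B. x \<bullet> b = 0) \<longrightarrow> x = 0)"
proof -
  let ?C = "{B. V \<subseteq> B \<and> B \<subseteq> sub A \<and> orthonormal_on B id}"
  have "\<exists>M\<in>?C. \<forall>X\<in>?C. M \<subseteq> X \<longrightarrow> X = M"
  proof (rule subset_Zorn_nonempty)
    show "?C \<noteq> {}" using V by blast
    fix \<C> assume ne: "\<C> \<noteq> {}" and ch: "subset.chain ?C \<C>"
    have C: "\<C> \<subseteq> ?C" and comp: "\<And>X Y. X \<in> \<C> \<Longrightarrow> Y \<in> \<C> \<Longrightarrow> X \<subseteq> Y \<or> Y \<subseteq> X"
      using ch unfolding subset_chain_def by blast+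
    have "orthonormal_on (\<Union>\<C>) id"
      unfolding orthonormal_on_def
    proof (intro ballI)
      fix b c assume "b \<in> \<Union>\<C>" "c \<in> \<Union>\<C>"
      then obtain X Y where "X \<in> \<C>" "Y \<in> \<C>" "b \<in> X" "c \<in> Y" by blast
      then obtain Z where "Z \<in> \<C>" "b \<in> Z" "c \<in> Z" using comp by blast
      then have "orthonormal_on Z id" "b \<in> Z" "c \<in> Z" using C by auto
      then show "id b \<bullet> id c = (if b = c then 1 else 0)" by (rule orthonormal_onD)
    qed
    moreover have "V \<subseteq> \<Union>\<C>" "\<Union>\<C> \<subseteq> sub A" using ne C by auto
    ultimately show "\<Union>\<C> \<in> ?C" by simp
  qed
  then obtain B where "B \<in> ?C" and max': "\<forall>X\<in>?C. B \<subseteq> X \<longrightarrow> X = B" ..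
  then have B: "V \<subseteq> B" "B \<subseteq> sub A" "orthonormal_on B id" by simp_all
  have max: "X = B" if "X \<in> ?C" "B \<subseteq> X" for X using max' that by simp
  have "x = 0" if x: "x \<in> sub A" and perp: "\<And>b. b \<in> B \<Longrightarrow> x \<bullet> b = 0" for x
  proof (rule ccontr)
    assume nz: "x \<noteq> 0"
    define y where "y = (1 / norm x) *\<^sub>R x"
    have yy: "y \<bullet> y = 1" using nz by (simp add: y_def dot_square_norm power2_eq_square)
    have yb: "y \<bullet> b = 0" "b \<bullet> y = 0" if "b \<in> B" for b
      using perp[OF that] by (simp_all add: y_def inner_commute)
    have "y \<notin> B" using yb(1)[of y] yy by auto
    have "orthonormal_on (insert y B) id"
      using B(3) yy yb \<open>y \<notin> B\<close> by (auto simp: orthonormal_on_def)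
    moreover have "y \<in> sub A" using x by (auto simp: y_def intro: sub_scale)
    ultimately have "insert y B \<in> ?C" using B by auto
    then have "insert y B = B" by (rule max) blast
    then show False using \<open>y \<notin> B\<close> by blast
  qed
  then have "\<forall>x\<in>sub A. (\<forall>b\<in>B. x \<bullet> b = 0) \<longrightarrow> x = 0" by simp
  with B show ?thesis by (intro exI[of _ B] conjI)
qed

text \<open>The family z forces the complement of the v i in \<open>sub A\<close> to be
  infinite-dimensional, so the vectors completing v to a basis can be indexed by the infinite set A
  - A1.\<close>

lemma orth_extend:
  fixes v z :: "nat \<Rightarrow> 'a"
  assumes A1: "A1 \<subseteq> A" "infinite (A - A1)"
    and v: "orthonormal_on A1 v" "\<And>i. i \<in> A1 \<Longrightarrow> v i \<in> sub A"
    and z: "orthonormal_on J z" "\<And>j. j \<in> J \<Longrightarrow> z j \<in> sub A" "infinite J"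
    and perp: "\<And>i j. i \<in> A1 \<Longrightarrow> j \<in> J \<Longrightarrow> z j \<bullet> v i = 0"
  shows "\<exists>T\<in>orth A. \<forall>i\<in>A1. T (e i) = v i"
proof -
  have inj: "inj_on w I" if w: "orthonormal_on I w" for I and w :: "nat \<Rightarrow> 'a"
  proof (rule inj_onI)
    fix i j assume ij: "i \<in> I" "j \<in> I" "w i = w j"
    then have "w i \<bullet> w j = 1" using orthonormal_onD[OF w ij(1) ij(1)] by simp
    then show "i = j" using orthonormal_onD[OF w ij(1) ij(2)] by (simp split: if_splits)
  qed
  let ?V = "v ` A1 \<union> z ` J"
  have "orthonormal_on ?V id"
    unfolding orthonormal_on_def
  proof (intro ballI)
    fix b c assume bc: "b \<in> ?V" "c \<in> ?V"
    have vv: "v i \<bullet> v j = (if v i = v j then 1 else 0)" if "i \<in> A1" "j \<in> A1" for i j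
      using orthonormal_onD[OF v(1) that] inj_on_eq_iff[OF inj[OF v(1)] that] by simp
    have zz: "z i \<bullet> z j = (if z i = z j then 1 else 0)" if "i \<in> J" "j \<in> J" for i j
      using orthonormal_onD[OF z(1) that] inj_on_eq_iff[OF inj[OF z(1)] that] by simp
    have vz: "v i \<bullet> z j = 0 \<and> z j \<bullet> v i = 0 \<and> v i \<noteq> z j" if "i \<in> A1" "j \<in> J" for i j
      using perp[OF that] zz[OF that(2) that(2)] by (auto simp: inner_commute)
    show "id b \<bullet> id c = (if b = c then 1 else 0)"
      using bc vv zz vz by (auto simp del: if_split)
  qed
  moreover have "?V \<subseteq> sub A" using v z by blast
  ultimately obtain B where B: "?V \<subseteq> B" "B \<subseteq> sub A" "orthonormal_on B id"
    and total: "\<forall>x\<in>sub A. (\<forall>b\<in>B. x \<bullet> b = 0) \<longrightarrow> x = 0"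
    using maximal_orthonormal[of ?V A] by blast
  have "z ` J \<subseteq> B - v ` A1"
  proof
    fix b assume "b \<in> z ` J"
    then obtain j where j: "j \<in> J" "b = z j" by blast
    have "b \<noteq> v i" if "i \<in> A1" for i
      using perp[OF that j(1)] orthonormal_onD[OF z(1) j(1) j(1)] j(2) by auto
    then show "b \<in> B - v ` A1" using B(1) j by blast
  qed
  then have "infinite (B - v ` A1)"
    using finite_imageD[OF _ inj[OF z(1)]] z(3) finite_subset by blast
  moreover have "countable (B - v ` A1)" using countable_orthonormal[OF B(3)] by simp
  ultimately obtain \<phi> where \<phi>: "bij_betw \<phi> (A - A1) (B - v ` A1)"
    using bij_betw_countable_infinite[of "A - A1" "B - v ` A1"] A1(2) by auto
  define \<psi> where "\<psi> i = (if i \<in> A1 then v i else \<phi> i)" for i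
  have "bij_betw \<psi> A1 (v ` A1)"
    using inj[OF v(1)] by (simp add: \<psi>_def bij_betw_def inj_on_def)
  moreover have "bij_betw \<psi> (A - A1) (B - v ` A1)"
    using \<phi> by (rule bij_betw_cong[THEN iffD1, rotated]) (simp add: \<psi>_def)
  ultimately have "bij_betw \<psi> (A1 \<union> (A - A1)) (v ` A1 \<union> (B - v ` A1))"
    by (rule bij_betw_combine) blast
  moreover have "A1 \<union> (A - A1) = A" "v ` A1 \<union> (B - v ` A1) = B" using A1 B(1) by auto
  ultimately have \<psi>: "bij_betw \<psi> A B" by simp
  have \<psi>B: "\<psi> i \<in> B" "\<psi> i \<in> sub A" if "i \<in> A" for i
    using bij_betwE[OF \<psi>] B(2) that by auto
  define u where "u i = (if i \<in> A then \<psi> i else e i)" for i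
  have "orthonormal_on UNIV u"
    unfolding orthonormal_on_def
  proof (intro ballI)
    fix i j
    show "u i \<bullet> u j = (if i = j then 1 else 0)"
    proof (cases "i \<in> A"; cases "j \<in> A")
      assume ij: "i \<in> A" "j \<in> A"
      then have "(\<psi> i = \<psi> j) = (i = j)" using \<psi> by (auto simp: bij_betw_def inj_on_def)
      then show ?thesis using ij orthonormal_onD[OF B(3) \<psi>B(1)[OF ij(1)] \<psi>B(1)[OF ij(2)]]
        by (simp add: u_def)
    next
      assume ij: "i \<in> A" "j \<notin> A"
      then show ?thesis using subD[OF \<psi>B(2)[OF ij(1)] ij(2)] by (auto simp: u_def)
    next
      assume ij: "i \<notin> A" "j \<in> A"
      then show ?thesis using subD[OF \<psi>B(2)[OF ij(2)] ij(1)] by (auto simp: u_def inner_commute)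
    next
      assume "i \<notin> A" "j \<notin> A"
      then show ?thesis by (simp add: u_def e_inner)
    qed
  qed
  moreover have "x = 0" if x: "\<And>i. x \<bullet> u i = 0" for x
  proof (rule total[rule_format])
    have "x \<bullet> e i = 0" if "i \<notin> A" for i using x[of i] that by (simp add: u_def)
    then show "x \<in> sub A" by (simp add: sub_def)
    fix b assume "b \<in> B"
    then obtain i where "i \<in> A" "b = \<psi> i" using \<psi> by (auto simp: bij_betw_def)
    then show "x \<bullet> b = 0" using x[of i] by (simp add: u_def)
  qed
  ultimately have "\<exists>T. isometric T \<and> surj T \<and> (\<forall>i. T (e i) = u i)" by (rule basis_map)
  then obtain T where T: "isometric T" "surj T" "\<And>i. T (e i) = u i" by blast
  then have "T \<in> orth A" by (simp add: orth_def u_def)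
  moreover have "\<forall>i\<in>A1. T (e i) = v i" using A1(1) by (auto simp: T u_def \<psi>_def)
  ultimately show ?thesis by blast
qed

section \<open>Factoring orthogonal operators through coordinate subspaces\<close>

text \<open>A new pair has to be perpendicular to finitely many vectors only, so the recursion can
  always be continued. The condition on a new x against an earlier z is moved to the side of x by
  \<open>adj T\<close>.\<close>

lemma perpendicular_sequences:
  assumes T: "T \<in> orth UNIV" and "infinite A" "infinite B"
  shows "\<exists>(x :: nat \<Rightarrow> 'a) (z :: nat \<Rightarrow> 'a). orthonormal_on UNIV x \<and> (\<forall>n. x n \<in> sub B) \<and>
    orthonormal_on UNIV z \<and> (\<forall>n. z n \<in> sub A) \<and> (\<forall>m n. z m \<bullet> T (x n) = 0)"
proof -
  define P where "P f n p \<longleftrightarrow> (case p of (x, z) \<Rightarrow>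
      x \<in> sub B \<and> norm x = 1 \<and> z \<in> sub A \<and> norm z = 1 \<and> z \<bullet> T x = 0 \<and>
      (\<forall>k<n. x \<bullet> fst (f k) = 0 \<and> x \<bullet> adj T (snd (f k)) = 0 \<and>
             z \<bullet> snd (f k) = 0 \<and> z \<bullet> T (fst (f k)) = 0))" for f :: "nat \<Rightarrow> 'a \<times> 'a" and n p
  have "\<exists>f. \<forall>n. P f n (f n)"
  proof (rule dependent_wellorder_choice)
    fix r :: "'a \<times> 'a" and f g :: "nat \<Rightarrow> 'a \<times> 'a" and n :: nat assume "\<And>y. y < n \<Longrightarrow> f y = g y"
    then show "P f n r = P g n r" by (auto simp: P_def)
  next
    fix n :: nat and f :: "nat \<Rightarrow> 'a \<times> 'a"
    let ?Y = "(\<lambda>k. fst (f k)) ` {..<n} \<union> (\<lambda>k. adj T (snd (f k))) ` {..<n}"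
    obtain x where x: "x \<in> sub B" "norm x = 1" "\<forall>y\<in>?Y. x \<bullet> y = 0"
      using perp_exists[of ?Y B] assms(3) by auto
    let ?Z = "insert (T x) ((\<lambda>k. snd (f k)) ` {..<n} \<union> (\<lambda>k. T (fst (f k))) ` {..<n})"
    obtain z where z: "z \<in> sub A" "norm z = 1" "\<forall>y\<in>?Z. z \<bullet> y = 0"
      using perp_exists[of ?Z A] assms(2) by auto
    have "P f n (x, z)" using x z by (simp add: P_def)
    then show "\<exists>r. P f n r" ..
  qed
  then obtain f where f: "\<And>n. P f n (f n)" by blast
  define x where "x n = fst (f n)" for n
  define z where "z n = snd (f n)" for n
  have p: "x n \<in> sub B" "norm (x n) = 1" "z n \<in> sub A" "norm (z n) = 1" "z n \<bullet> T (x n) = 0" for n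
    using f[of n] by (auto simp: P_def x_def z_def split: prod.splits)
  have lt: "x n \<bullet> x k = 0" "x n \<bullet> adj T (z k) = 0" "z n \<bullet> z k = 0" "z n \<bullet> T (x k) = 0"
    if "k < n" for k n
    using f[of n] that by (auto simp: P_def x_def z_def split: prod.splits)
  have "x n \<bullet> x k = (if n = k then 1 else 0)" "z n \<bullet> z k = (if n = k then 1 else 0)" for n k
    using lt(1,3)[of k n] lt(1,3)[of n k] p(2,4)[of n]
    by (auto simp: inner_commute dot_square_norm neq_iff split: if_splits)
  moreover have "z m \<bullet> T (x n) = 0" for m n
  proof (cases m n rule: linorder_cases)
    case less
    have "T (x n) \<bullet> z m = x n \<bullet> adj T (z m)" by (rule orth_adjoint[OF T])
    then show ?thesis using lt(2)[OF less] by (simp add: inner_commute)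
  next
    case equal then show ?thesis using p(5) by simp
  next
    case greater then show ?thesis using lt(4) by simp
  qed
  ultimately have q: "orthonormal_on UNIV x" "orthonormal_on UNIV z" "\<forall>m n. z m \<bullet> T (x n) = 0"
    by (simp_all add: orthonormal_on_def)
  show ?thesis
    by (rule exI[of _ x], rule exI[of _ z]) (simp add: q p)
qed

text \<open>Choose S1 on P \<union> Q and S3 on Q \<union> R so that S1^-1 T S3 maps
  \<open>e i\<close>, for i in R, into \<open>sub (Q \<union> R)\<close>. Some S2 on Q \<union> R
  then has the same values on R, and the remainder S2^-1 S1^-1 T S3 fixes R, so it is supported on P
  \<union> Q.\<close>

lemma orth_factor:
  assumes inf: "infinite P" "infinite Q" "infinite R"
    and disj: "P \<inter> Q = {}" "P \<inter> R = {}" "Q \<inter> R = {}"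
    and T: "T \<in> orth (P \<union> Q \<union> R)"
  shows "\<exists>a\<in>orth (P \<union> Q). \<exists>b\<in>orth (Q \<union> R). \<exists>c\<in>orth (P \<union> Q). \<exists>d\<in>orth (Q \<union> R).
    T = a \<circ> b \<circ> c \<circ> d"
proof -
  let ?E = "P \<union> Q \<union> R" and ?A = "P \<union> Q" and ?B = "Q \<union> R"
  \<comment> \<open>S1 is prescribed on P \<union> Q2 and free on Q1. The \<open>e j\<close> with j
    in Q2 remain perpendicular to the targets of S2 and leave room to complete it; the odd-numbered
    members of z and x do the same for S1 and S3.\<close>
  obtain Q1 Q2 where Q: "Q1 \<union> Q2 = Q" "Q1 \<inter> Q2 = {}" "infinite Q1" "infinite Q2"
    using split_infinite[OF inf(2)] by blast
  have "infinite ?A" "infinite ?B" using inf by auto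
  from perpendicular_sequences[OF orth_UNIV[OF T] this]
  obtain x z :: "nat \<Rightarrow> 'a" where x: "orthonormal_on UNIV x" "\<And>n. x n \<in> sub ?B"
    and z: "orthonormal_on UNIV z" "\<And>n. z n \<in> sub ?A" and xz: "\<And>m n. z m \<bullet> T (x n) = 0"
    by auto
  have reindex: "orthonormal_on I (\<lambda>i. w (2 * i))" "orthonormal_on I (\<lambda>i. w (2 * i + 1))"
    if "orthonormal_on UNIV w" for w :: "nat \<Rightarrow> 'a" and I :: "nat set"
    by (simp_all add: orthonormal_on_def orthonormal_onD[OF that])
  have even_odd: "2 * i + 1 \<noteq> 2 * j" for i j :: nat by presburger
  obtain S1 where S1: "S1 \<in> orth ?A" "\<And>i. i \<in> P \<union> Q2 \<Longrightarrow> S1 (e i) = z (2 * i)"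
  proof -
    have "\<exists>T\<in>orth ?A. \<forall>i\<in>P \<union> Q2. T (e i) = z (2 * i)"
    proof (rule orth_extend[where z = "\<lambda>j. z (2 * j + 1)" and J = UNIV])
      show "P \<union> Q2 \<subseteq> ?A" using Q by auto
      have "Q1 \<subseteq> ?A - (P \<union> Q2)" using Q disj by auto
      then show "infinite (?A - (P \<union> Q2))" using Q(3) finite_subset by blast
      show "z (2 * j + 1) \<bullet> z (2 * i) = 0" for i j
        using orthonormal_onD[OF z(1), of "2 * j + 1" "2 * i"] even_odd[of j i] by simp
    qed (simp_all only: reindex[OF z(1)] z(2) infinite_UNIV_nat not_False_eq_True)
    then show ?thesis using that by blast
  qed
  obtain S3 where S3: "S3 \<in> orth ?B" "\<And>i. i \<in> R \<Longrightarrow> S3 (e i) = x (2 * i)"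
  proof -
    have "\<exists>T\<in>orth ?B. \<forall>i\<in>R. T (e i) = x (2 * i)"
    proof (rule orth_extend[where z = "\<lambda>j. x (2 * j + 1)" and J = UNIV])
      show "R \<subseteq> ?B" by auto
      have "?B - R = Q" using disj by auto
      then show "infinite (?B - R)" using inf by simp
      show "x (2 * j + 1) \<bullet> x (2 * i) = 0" for i j
        using orthonormal_onD[OF x(1), of "2 * j + 1" "2 * i"] even_odd[of j i] by simp
    qed (simp_all only: reindex[OF x(1)] x(2) infinite_UNIV_nat not_False_eq_True)
    then show ?thesis using that by blast
  qed
  define w where "w i = adj S1 (T (x (2 * i)))" for i
  have S1': "adj S1 \<in> orth ?A" by (rule orth_inv[OF S1(1)])
  have w_inner: "w i \<bullet> w j = (if i = j then 1 else 0)" for i j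
    by (simp add: w_def orth_inner[OF S1'] orth_inner[OF T] orthonormal_onD[OF x(1)])
  \<comment> \<open>S1 maps the \<open>e k\<close> with k in P \<union> Q2 to members of z, which
    are perpendicular to all T (x n).\<close>
  have w_sub: "w i \<in> sub (Q1 \<union> R)" for i
    unfolding sub_def
  proof (intro CollectI allI impI)
    fix k assume k: "k \<notin> Q1 \<union> R"
    show "w i \<bullet> e k = 0"
    proof (cases "k \<in> P \<union> Q2")
      case True
      have "w i \<bullet> e k = T (x (2 * i)) \<bullet> S1 (e k)"
        using orth_adjoint[OF S1'] orth_inv_inv[OF S1(1)] by (simp add: w_def)
      then show ?thesis using S1(2)[OF True] xz by (simp add: inner_commute)
    next
      case False
      then have "k \<notin> ?E" using k Q by auto
      have "x (2 * i) \<in> sub ?E" using x(2) sub_mono[of ?B ?E] by blast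
      then have "T (x (2 * i)) \<in> sub ?E" by (rule orth_sub[OF T subset_refl])
      then have "w i \<in> sub ?E" unfolding w_def by (intro orth_sub[OF S1']) auto
      then show ?thesis using \<open>k \<notin> ?E\<close> by (rule subD)
    qed
  qed
  obtain S2 where S2: "S2 \<in> orth ?B" "\<And>i. i \<in> R \<Longrightarrow> S2 (e i) = w i"
  proof -
    have "\<exists>T\<in>orth ?B. \<forall>i\<in>R. T (e i) = w i"
    proof (rule orth_extend[where z = e and J = Q2])
      show "R \<subseteq> ?B" by auto
      have "?B - R = Q" using disj by auto
      then show "infinite (?B - R)" using inf by simp
      show "orthonormal_on R w" by (simp add: orthonormal_on_def w_inner)
      show "w i \<in> sub ?B" for i using w_sub[of i] sub_mono[of "Q1 \<union> R" ?B] Q by blast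
      show "orthonormal_on Q2 e" by (rule orthonormal_e)
      show "e j \<in> sub ?B" if "j \<in> Q2" for j using that Q by (intro e_in_sub) auto
      show "infinite Q2" by fact
      show "e j \<bullet> w i = 0" if "j \<in> Q2" for i j
        using subD[OF w_sub, of j i] that Q disj by (auto simp: inner_commute)
    qed
    then show ?thesis using that by blast
  qed
  have S2': "adj S2 \<in> orth ?B" by (rule orth_inv[OF S2(1)])
  define a where "a = adj S2 \<circ> (adj S1 \<circ> (T \<circ> S3))"
  have "a \<in> orth UNIV" unfolding a_def
    by (intro orth_comp orth_UNIV[OF S2'] orth_UNIV[OF S1'] orth_UNIV[OF T] orth_UNIV[OF S3(1)])
  moreover have "a (e i) = e i" if "i \<notin> ?A" for i
  proof (cases "i \<in> R")
    case True
    then have "a (e i) = adj S2 (S2 (e i))" by (simp add: a_def S3(2) S2(2) w_def)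
    then show ?thesis by (simp add: orth_inv_left[OF S2(1)])
  next
    case False
    then have "S3 (e i) = e i" "T (e i) = e i" "adj S1 (e i) = e i" "adj S2 (e i) = e i"
      using that by (auto intro: orth_fixes_e[OF S3(1)] orth_fixes_e[OF T] orth_fixes_e[OF S1']
          orth_fixes_e[OF S2'])
    then show ?thesis by (simp add: a_def)
  qed
  ultimately have a: "a \<in> orth ?A" by (simp add: orth_def)
  have "T = S1 \<circ> S2 \<circ> a \<circ> adj S3"
    by (rule ext) (simp add: a_def orth_inv_right[OF S1(1)] orth_inv_right[OF S2(1)]
        orth_inv_right[OF S3(1)])
  then show ?thesis using S1(1) S2(1) a orth_inv[OF S3(1)] by blast
qed

end

section \<open>Symmetric sets with countably many covering translates\<close>

text \<open>W is not assumed to contain \<open>id\<close>, so the powers are not nested and the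
  exponents below count factors exactly.\<close>

primrec comp_pow :: "('a \<Rightarrow> 'a) set \<Rightarrow> nat \<Rightarrow> ('a \<Rightarrow> 'a) set" where
  "comp_pow W 0 = {id}"
| "comp_pow W (Suc n) = {S \<circ> T |S T. S \<in> W \<and> T \<in> comp_pow W n}"

lemma comp_pow_add:
  "S \<in> comp_pow W m \<Longrightarrow> T \<in> comp_pow W n \<Longrightarrow> S \<circ> T \<in> comp_pow W (m + n)"
proof (induction m arbitrary: S)
  case (Suc m)
  then obtain S1 S2 where S: "S = S1 \<circ> S2" "S1 \<in> W" "S2 \<in> comp_pow W m" by auto
  then have "S2 \<circ> T \<in> comp_pow W (m + n)" using Suc by blast
  moreover have "S \<circ> T = S1 \<circ> (S2 \<circ> T)" by (simp add: S(1) comp_assoc)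
  ultimately show ?case using S(2) unfolding comp_pow.simps add_Suc by blast
qed simp

lemma comp_pow_1: "T \<in> W \<Longrightarrow> T \<in> comp_pow W 1"
  by simp

lemma (in hilbert) adj_comp:
  "S \<in> orth A \<Longrightarrow> T \<in> orth B \<Longrightarrow> adj (S \<circ> T) = adj T \<circ> adj S"
  by (rule o_inv_distrib) (auto intro: orth_bij)

text \<open>The last assumption says that the translates of W by the g n cover the group: syndetic
  sets, with countably many translates in place of finitely many.\<close>

locale syndetic = hilbert e for e :: "nat \<Rightarrow> 'a::{real_inner, complete_space}" +
  fixes A0 :: "nat set" and W :: "('a \<Rightarrow> 'a) set" and g :: "nat \<Rightarrow> 'a \<Rightarrow> 'a"
  assumes inf: "infinite A0" and W_orth: "W \<subseteq> orth A0"
    and W_adj: "T \<in> W \<Longrightarrow> adj T \<in> W"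
    and g_orth: "g n \<in> orth A0"
    and cover: "T \<in> orth A0 \<Longrightarrow> \<exists>n. adj (g n) \<circ> T \<in> W"
begin

abbreviation V :: "nat \<Rightarrow> ('a \<Rightarrow> 'a) set" where "V \<equiv> comp_pow W"

lemma V_orth: "T \<in> V n \<Longrightarrow> T \<in> orth A0"
proof (induction n arbitrary: T)
  case 0
  then have "T = id" by simp
  then show ?case using orth_id by (simp only:)
next
  case (Suc n)
  then obtain S1 S2 where "T = S1 \<circ> S2" "S1 \<in> W" "S2 \<in> V n" by auto
  then show ?case using Suc.IH W_orth orth_comp[of S1 A0 S2] by blast
qed

lemma V_adj: "T \<in> V n \<Longrightarrow> adj T \<in> V n"
proof (induction n arbitrary: T)
  case 0
  then have "T = id" by simp
  then show ?case by (simp only: inv_id comp_pow.simps singleton_iff)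
next
  case (Suc n)
  then obtain S1 S2 where S: "T = S1 \<circ> S2" "S1 \<in> W" "S2 \<in> V n" by auto
  have "S1 \<in> orth A0" using S(2) W_orth by blast
  then have "adj T = adj S2 \<circ> adj S1" unfolding S(1) by (rule adj_comp[OF _ V_orth[OF S(3)]])
  then show ?case
    using comp_pow_add[OF Suc.IH[OF S(3)] comp_pow_1[OF W_adj[OF S(2)]]]
    unfolding Suc_eq_plus1 by (simp only:)
qed

text \<open>Two of the operators lie in the same translate of W, and the unknown translating factor
  cancels in their quotient, leaving an element of W^-1 W.\<close>

lemma pigeonhole:
  assumes I: "uncountable I" and x: "\<And>i. i \<in> I \<Longrightarrow> x i \<in> orth A0"
  shows "\<exists>i\<in>I. \<exists>j\<in>I. i \<noteq> j \<and> adj (x i) \<circ> x j \<in> V 2"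
proof -
  have "\<exists>n. adj (g n) \<circ> x i \<in> W" if "i \<in> I" for i using cover[OF x[OF that]] .
  then obtain n where n: "\<And>i. i \<in> I \<Longrightarrow> adj (g (n i)) \<circ> x i \<in> W" by metis
  have "\<not> inj_on n I"
    using I countableI' by blast
  then obtain i j where ij: "i \<in> I" "j \<in> I" "i \<noteq> j" "n i = n j" by (auto simp: inj_on_def)
  let ?h = "g (n i)"
  note h = g_orth[of "n i"]
  have "adj (adj ?h \<circ> x i) \<in> W" using W_adj[OF n[OF ij(1)]] .
  moreover have "adj ?h \<circ> x j \<in> W" using n[OF ij(2)] ij(4) by simp
  ultimately have "adj (adj ?h \<circ> x i) \<circ> (adj ?h \<circ> x j) \<in> V (1 + 1)"
    by (intro comp_pow_add comp_pow_1)
  moreover have "adj (adj ?h \<circ> x i) = adj (x i) \<circ> ?h"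
    using adj_comp[OF orth_inv[OF h] x[OF ij(1)]] by (simp add: orth_inv_inv[OF h])
  then have "adj (adj ?h \<circ> x i) \<circ> (adj ?h \<circ> x j) = adj (x i) \<circ> x j"
    by (auto simp: fun_eq_iff orth_inv_right[OF h])
  ultimately show ?thesis using ij(1-3) by (auto simp: numeral_2_eq_2)
qed

text \<open>If for every n some T n on block n were not the restriction of an element of the n-th
  translate, the direct sum of all T n would lie in no translate at all.\<close>

lemma full_block:
  fixes b :: "nat \<Rightarrow> nat"
  shows "\<exists>n. \<forall>T\<in>orth {k\<in>A0. b k = n}. \<exists>S\<in>V 2. \<forall>k\<in>A0. b k = n \<longrightarrow> S (e k) = T (e k)"
proof -
  let ?I = "\<lambda>n. {k\<in>A0. b k = n}"
  have "\<exists>n. \<forall>T\<in>orth (?I n). \<exists>w\<in>W. \<forall>k\<in>?I n. g n (w (e k)) = T (e k)"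
  proof (rule ccontr)
    assume "\<not> ?thesis"
    then have "\<forall>n. \<exists>T. T \<in> orth (?I n) \<and> (\<forall>w\<in>W. \<exists>k\<in>?I n. g n (w (e k)) \<noteq> T (e k))" by blast
    from choice[OF this] obtain T where T': "\<forall>n. T n \<in> orth (?I n) \<and>
      (\<forall>w\<in>W. \<exists>k\<in>?I n. g n (w (e k)) \<noteq> T n (e k))" ..
    have T: "T n \<in> orth (?I n)" "w \<in> W \<Longrightarrow> \<exists>k\<in>?I n. g n (w (e k)) \<noteq> T n (e k)" for n w
      using T'[rule_format, of n] by blast+
    \<comment> \<open>Labels are shifted by one: label 0 collects the indices outside A0, where the
      diagonal operator must be the identity.\<close>
    define b' where "b' k = (if k \<in> A0 then Suc (b k) else 0)" for k
    define T' where "T' n = (case n of 0 \<Rightarrow> id | Suc m \<Rightarrow> T m)" for n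
    have "T' n \<in> orth {k. b' k = n}" for n
    proof (cases n)
      case 0
      then have "T' n = id" by (simp only: T'_def nat.case)
      then show ?thesis using orth_id by (simp only:)
    next
      case (Suc m)
      have "{k. b' k = n} = ?I m" by (auto simp: b'_def Suc)
      then show ?thesis using T(1)[of m] by (simp add: T'_def Suc)
    qed
    then have "\<exists>D\<in>orth UNIV. \<forall>k. D (e k) = T' (b' k) (e k)" by (rule orth_direct_sum)
    then obtain D where D: "D \<in> orth UNIV" "\<And>k. D (e k) = T' (b' k) (e k)" by blast
    then have "D \<in> orth A0" by (simp add: orth_def b'_def T'_def)
    then obtain n where n: "adj (g n) \<circ> D \<in> W" using cover by blast
    then obtain k where k: "k \<in> ?I n" "g n ((adj (g n) \<circ> D) (e k)) \<noteq> T n (e k)" using T(2) by blast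
    moreover have "D (e k) = T n (e k)" using k(1) D(2)[of k] by (simp add: b'_def T'_def)
    ultimately show False by (simp add: orth_inv_right[OF g_orth])
  qed
  then obtain n where n: "\<And>T. T \<in> orth (?I n) \<Longrightarrow> \<exists>w\<in>W. \<forall>k\<in>?I n. g n (w (e k)) = T (e k)"
    by blast
  have "\<exists>S\<in>V 2. \<forall>k\<in>A0. b k = n \<longrightarrow> S (e k) = T (e k)" if T: "T \<in> orth (?I n)" for T
  proof -
    \<comment> \<open>The elements realizing the identity and T carry the same factor g n, which
      cancels in w0^-1 w1.\<close>
    obtain w0 where w0: "w0 \<in> W" "\<And>k. k \<in> ?I n \<Longrightarrow> g n (w0 (e k)) = id (e k)"
      using n[OF orth_id] by blast
    obtain w1 where w1: "w1 \<in> W" "\<And>k. k \<in> ?I n \<Longrightarrow> g n (w1 (e k)) = T (e k)"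
      using n[OF T] by blast
    have wo: "w0 \<in> orth A0" "w1 \<in> orth A0" using w0(1) w1(1) W_orth by blast+
    have "(adj w0 \<circ> w1) (e k) = T (e k)" if k: "k \<in> ?I n" for k
    proof -
      have "T (e k) \<in> sub (?I n)" by (rule orth_sub[OF T subset_refl e_in_sub[OF k]])
      then have "(g n \<circ> w0) (T (e k)) = id (T (e k))"
        by (rule orth_agree[OF orth_comp[OF g_orth wo(1)] orth_id, rotated]) (simp add: w0(2))
      then have "g n (w0 (T (e k))) = g n (w1 (e k))" using w1(2)[OF k] by simp
      then have "w0 (T (e k)) = w1 (e k)"
        using orth_bij[OF g_orth[of n]] by (simp add: bij_def inj_eq)
      then have "adj w0 (w1 (e k)) = adj w0 (w0 (T (e k)))" by simp
      then show ?thesis by (simp add: orth_inv_left[OF wo(1)])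
    qed
    moreover have "adj w0 \<circ> w1 \<in> V 2"
      using comp_pow_add[OF comp_pow_1[OF W_adj[OF w0(1)]] comp_pow_1[OF w1(1)]]
      by (simp add: numeral_2_eq_2)
    ultimately show ?thesis by blast
  qed
  then show ?thesis by blast
qed

text \<open>An operator supported on I sees a conjugating operator only through its action on
  \<open>sub I\<close>. Thus D, which need not lie in a power of W, can be replaced by some S in V 2
  that agrees with it on one block.\<close>

lemma conj_agree:
  assumes D: "D \<in> orth I" and S: "S \<in> orth A" and x: "x \<in> orth I"
    and eq: "\<And>k. k \<in> I \<Longrightarrow> S (e k) = D (e k)"
  shows "S \<circ> x \<circ> adj S = D \<circ> x \<circ> adj D"
proof (rule orth_eqI)
  show "S \<circ> x \<circ> adj S \<in> orth UNIV"
    by (intro orth_comp orth_UNIV[OF S] orth_UNIV[OF x] orth_UNIV[OF orth_inv[OF S]])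
  show DI: "D \<circ> x \<circ> adj D \<in> orth I"
    by (intro orth_comp D x orth_inv[OF D])
  have SD: "S y = D y" if "y \<in> sub I" for y by (rule orth_agree[OF S D eq that])
  fix i
  show "(S \<circ> x \<circ> adj S) (e i) = (D \<circ> x \<circ> adj D) (e i)"
  proof (cases "i \<in> I")
    case True
    have s: "adj D (e i) \<in> sub I"
      by (rule orth_sub[OF orth_inv[OF D] subset_refl e_in_sub[OF True]])
    then have "S (adj D (e i)) = e i" using SD[OF s] by (simp add: orth_inv_right[OF D])
    then have "adj S (S (adj D (e i))) = adj S (e i)" by simp
    then have "adj S (e i) = adj D (e i)" by (simp add: orth_inv_left[OF S])
    moreover have "x (adj D (e i)) \<in> sub I" by (rule orth_sub[OF x subset_refl s])
    then have "S (x (adj D (e i))) = D (x (adj D (e i)))" by (rule SD)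
    ultimately show ?thesis by simp
  next
    case False
    have "adj S (e i) \<bullet> e k = 0" if k: "k \<in> I" for k
    proof -
      have "adj S (e i) \<bullet> e k = e i \<bullet> D (e k)"
        using orth_adjoint[OF orth_inv[OF S], of "e i" "e k"]
          by (simp add: orth_inv_inv[OF S] eq[OF k])
      moreover have "D (e k) \<in> sub I" by (rule orth_sub[OF D subset_refl e_in_sub[OF k]])
      ultimately show ?thesis using subD[of "D (e k)" I i] False by (simp add: inner_commute)
    qed
    then have "adj S (e i) \<in> sub (- I)" by (simp add: sub_def)
    then have "x (adj S (e i)) = adj S (e i)" by (rule orth_fix[OF x]) simp
    then show ?thesis using orth_fixes_e[OF DI False] by (simp add: orth_inv_right[OF S])
  qed
qed

end

section \<open>Orthogonal groups of coordinate blocks inside a power of W\<close>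

lemma uncountable_nat_sets: "uncountable (UNIV :: nat set set)"
  using Cantors_theorem[of "UNIV :: nat set"] by (simp add: uncountable_def)

context syndetic begin

text \<open>Inside block n, j numbers copies of a bilateral shift along m, and l is the
  multiplicity. Each set \<alpha> gives the operator shifting exactly the copies with j in \<alpha>;
  the quotient of two of them is a shift on any copy where the sets differ.\<close>

lemma shift_in_V:
  assumes \<tau>: "bij_betw \<tau> (UNIV :: (nat \<times> nat \<times> int \<times> nat) set) A0"
  shows "\<exists>j. \<exists>x\<in>V 2. x \<in> orth {i. \<exists>j m l. i = \<tau> (n, j, m, l)} \<and>
    (\<forall>m l. x (e (\<tau> (n, j, m, l))) = e (\<tau> (n, j, m + 1, l)))"
proof -
  have \<tau>_A0: "\<tau> t \<in> A0" for t using \<tau> by (auto simp: bij_betw_def)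
  define c where "c = inv_into UNIV \<tau>"
  have c: "c (\<tau> t) = t" for t using \<tau> by (simp add: c_def bij_betw_def)
  have \<tau>c: "\<tau> (c i) = i" if "i \<in> A0" for i using \<tau> that by (simp add: c_def bij_betw_inv_into_right)
  let ?I = "{i. \<exists>j m l. i = \<tau> (n, j, m, l)}"
  define sh where "sh d \<alpha> t = (case t of (k, j, m, l) \<Rightarrow>
      (k, j, if k = n \<and> j \<in> \<alpha> then m + d else m, l))"
    for d :: int and \<alpha> :: "nat set" and t :: "nat \<times> nat \<times> int \<times> nat"
  have sh_inv: "sh (- d) \<alpha> (sh d \<alpha> t) = t" for d \<alpha> t by (auto simp: sh_def split: prod.splits)
  have "\<exists>X\<in>orth ?I. \<forall>t. X (e (\<tau> t)) = e (\<tau> (sh 1 \<alpha> t))" for \<alpha>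
  proof -
    define p where "p d i = (if i \<in> A0 then \<tau> (sh d \<alpha> (c i)) else i)" for d i
    have "p (- d) (p d i) = i" for d i
      by (simp add: p_def \<tau>_A0 c sh_inv \<tau>c)
    from this[of 1] this[of "- 1"] have "bij (p 1)"
      by (intro o_bij[of "p (- 1)"]) (auto simp: fun_eq_iff)
    moreover have "p 1 i = i" if "i \<notin> ?I" for i
    proof (cases "i \<in> A0")
      case True
      obtain k j m l where t: "c i = (k, j, m, l)" by (metis prod_cases4)
      then have "i = \<tau> (k, j, m, l)" using \<tau>c[OF True] by simp
      then have "k \<noteq> n" using that by auto
      then show ?thesis using True \<tau>c[OF True] by (simp add: p_def t sh_def)
    qed (simp add: p_def)
    ultimately have "\<exists>X\<in>orth ?I. \<forall>i. X (e i) = e (p 1 i)" by (rule orth_permutation)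
    then obtain X where "X \<in> orth ?I" "\<And>i. X (e i) = e (p 1 i)" by blast
    moreover have "p 1 (\<tau> t) = \<tau> (sh 1 \<alpha> t)" for t by (simp add: p_def \<tau>_A0 c)
    ultimately have "X \<in> orth ?I \<and> (\<forall>t. X (e (\<tau> t)) = e (\<tau> (sh 1 \<alpha> t)))" by simp
    then show ?thesis by blast
  qed
  then have "\<forall>\<alpha>. \<exists>X. X \<in> orth ?I \<and> (\<forall>t. X (e (\<tau> t)) = e (\<tau> (sh 1 \<alpha> t)))" by blast
  from choice[OF this] obtain X where
    X': "\<forall>\<alpha>. X \<alpha> \<in> orth ?I \<and> (\<forall>t. X \<alpha> (e (\<tau> t)) = e (\<tau> (sh 1 \<alpha> t)))" ..
  have X: "X \<alpha> \<in> orth ?I" "X \<alpha> (e (\<tau> t)) = e (\<tau> (sh 1 \<alpha> t))" for \<alpha> t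
    using spec[OF X', of \<alpha>] by (rule conjunct1, blast)
  have IA0: "?I \<subseteq> A0" using \<tau>_A0 by auto
  have XA0: "X \<alpha> \<in> orth A0" for \<alpha> by (rule subsetD[OF orth_mono[OF IA0] X(1)])
  have "\<exists>\<alpha>\<in>UNIV. \<exists>\<beta>\<in>UNIV. \<alpha> \<noteq> \<beta> \<and> adj (X \<alpha>) \<circ> X \<beta> \<in> V 2"
    by (rule pigeonhole[OF uncountable_nat_sets XA0])
  then obtain \<alpha> \<beta> where "\<alpha> \<noteq> \<beta>" and V2: "adj (X \<alpha>) \<circ> X \<beta> \<in> V 2" by blast
  have adjX: "adj (X \<alpha>) (e (\<tau> t)) = e (\<tau> (sh (- 1) \<alpha> t))" for \<alpha> t
  proof -
    have "sh 1 \<alpha> (sh (- 1) \<alpha> t) = t" using sh_inv[of "- 1" \<alpha> t] by simp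
    then have "X \<alpha> (e (\<tau> (sh (- 1) \<alpha> t))) = e (\<tau> t)" by (simp add: X(2))
    then have "adj (X \<alpha>) (X \<alpha> (e (\<tau> (sh (- 1) \<alpha> t)))) = adj (X \<alpha>) (e (\<tau> t))" by simp
    then show ?thesis by (simp add: orth_inv_left[OF X(1)])
  qed
  let ?x = "adj (X \<alpha>) \<circ> X \<beta>"
  have xI: "?x \<in> orth ?I" by (rule orth_comp[OF orth_inv[OF X(1)] X(1)])
  obtain j where "j \<in> \<alpha> - \<beta> \<or> j \<in> \<beta> - \<alpha>" using \<open>\<alpha> \<noteq> \<beta>\<close> by blast
  then show ?thesis
  proof
    assume j: "j \<in> \<beta> - \<alpha>"
    then have "?x (e (\<tau> (n, j, m, l))) = e (\<tau> (n, j, m + 1, l))" for m l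
      by (simp add: X(2) adjX sh_def)
    then show ?thesis using V2 xI by blast
  next
    \<comment> \<open>Here the quotient shifts downwards, so its inverse is used.\<close>
    assume j: "j \<in> \<alpha> - \<beta>"
    then have "?x (e (\<tau> (n, j, m + 1, l))) = e (\<tau> (n, j, m, l))" for m l
      by (simp add: X(2) adjX sh_def)
    then have "adj ?x (e (\<tau> (n, j, m, l))) = e (\<tau> (n, j, m + 1, l))" for m l
      using orth_inv_left[OF xI, of "e (\<tau> (n, j, m + 1, l))"] by simp
    moreover have "adj ?x \<in> V 2" "adj ?x \<in> orth ?I" by (rule V_adj[OF V2], rule orth_inv[OF xI])
    ultimately show ?thesis by blast
  qed
qed

text \<open>An infinite repetition swindle: D acts on each B m, m \<ge> 0, as the copy of u carried
  there by x^m. Conjugation by x drops the copy on B 0, so u = D x D^-1 x^-1. By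
  \<open>conj_agree\<close> D x D^-1 equals S x S^-1 with S in V 2, which accounts for 8 = 2 + 2 + 2
  + 2.\<close>

lemma small_support:
  "\<exists>B. B \<subseteq> A0 \<and> infinite B \<and> infinite (A0 - B) \<and> orth B \<subseteq> V 8"
proof -
  have "infinite (UNIV :: (nat \<times> nat \<times> int \<times> nat) set)" by (simp add: finite_prod)
  then obtain \<tau> where \<tau>: "bij_betw \<tau> (UNIV :: (nat \<times> nat \<times> int \<times> nat) set) A0"
    using bij_betw_countable_infinite[of "UNIV :: (nat \<times> nat \<times> int \<times> nat) set" A0] inf by auto
  have \<tau>_inj: "\<tau> s = \<tau> t \<longleftrightarrow> s = t" for s t
    using \<tau> by (auto simp: bij_betw_def inj_eq)
  have \<tau>_A0: "\<tau> t \<in> A0" for t using \<tau> by (auto simp: bij_betw_def)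
  have \<tau>_surj: "\<exists>t. i = \<tau> t" if "i \<in> A0" for i using \<tau> that by (auto simp: bij_betw_def)
  define b1 where "b1 i = fst (inv_into UNIV \<tau> i)" for i
  have b1: "b1 (\<tau> t) = fst t" for t using \<tau> by (simp add: b1_def bij_betw_def)
  obtain n where full: "\<And>T. T \<in> orth {k\<in>A0. b1 k = n} \<Longrightarrow>
      \<exists>S\<in>V 2. \<forall>k\<in>A0. b1 k = n \<longrightarrow> S (e k) = T (e k)"
    using full_block[of b1] by blast
  let ?I = "{i. \<exists>j m l. i = \<tau> (n, j, m, l)}"
  have I: "{k\<in>A0. b1 k = n} = ?I"
    using \<tau>_A0 \<tau>_surj by (auto simp: b1) (metis b1 fst_conv prod_cases4)
  obtain j x where xV: "x \<in> V 2" and xI: "x \<in> orth ?I"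
    and x: "\<And>m l. x (e (\<tau> (n, j, m, l))) = e (\<tau> (n, j, m + 1, l))"
    using shift_in_V[OF \<tau>, of n] by blast
  define B where "B m = {\<tau> (n, j, m, l) |l. True}" for m
  have B_disj: "B m \<inter> B m' = {}" if "m \<noteq> m'" for m m' using that by (auto simp: B_def \<tau>_inj)
  have B_inf: "infinite (B m)" for m
  proof -
    have "B m = range (\<lambda>l. \<tau> (n, j, m, l))" by (auto simp: B_def)
    moreover have "inj (\<lambda>l. \<tau> (n, j, m, l))" by (auto simp: inj_def \<tau>_inj)
    ultimately show ?thesis using range_inj_infinite by metis
  qed
  have B_I: "B m \<subseteq> ?I" "B m \<subseteq> A0" for m using \<tau>_A0 by (auto simp: B_def)
  have adjx: "adj x (e (\<tau> (n, j, m, l))) = e (\<tau> (n, j, m - 1, l))" for m l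
    using orth_inv_left[OF xI, of "e (\<tau> (n, j, m - 1, l))"] by (simp add: x)
  have "u \<in> V 8" if u: "u \<in> orth (B 0)" for u
  proof -
    define U where "U m = (x ^^ m) \<circ> u \<circ> adj (x ^^ m)" for m :: nat
    have xm: "x ^^ m \<in> orth ?I" for m
    proof (induction m)
      case 0 then show ?case using orth_id by (simp only: funpow.simps)
    next
      case (Suc m) then show ?case unfolding funpow.simps by (rule orth_comp[OF xI])
    qed
    have xme: "(x ^^ m) (e (\<tau> (n, j, k, l))) = e (\<tau> (n, j, k + int m, l))" for m k l
      by (induction m) (simp_all add: x ac_simps)
    have U: "U m \<in> orth (B (int m))" for m
    proof -
      have "U m (e i) = e i" if i: "i \<notin> B (int m)" for i
      proof -
        let ?y = "adj (x ^^ m) (e i)"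
        have "?y \<bullet> e k = 0" if kB: "k \<in> B 0" for k
        proof -
          obtain l where k: "k = \<tau> (n, j, 0, l)" using kB by (auto simp: B_def)
          have "?y \<bullet> e k = e i \<bullet> (x ^^ m) (e k)"
            using orth_adjoint[OF orth_inv[OF xm[of m]], of "e i" "e k"]
              by (simp add: orth_inv_inv[OF xm])
          also have "\<dots> = 0" using i by (auto simp: k xme e_inner B_def)
          finally show ?thesis .
        qed
        then have "?y \<in> sub (- B 0)" by (simp add: sub_def)
        then have "u ?y = ?y" by (rule orth_fix[OF u]) simp
        then show ?thesis by (simp add: U_def orth_inv_right[OF xm])
      qed
      moreover have "U m \<in> orth UNIV" unfolding U_def
        by (rule orth_comp[OF orth_comp[OF orth_UNIV[OF xm] orth_UNIV[OF u]]
              orth_UNIV[OF orth_inv[OF xm]]])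
      ultimately show ?thesis by (simp add: orth_def)
    qed
    have U_Suc: "U (Suc m) (x y) = x (U m y)" for m y
    proof -
      have "adj (x ^^ Suc m) = adj (x ^^ m) \<circ> adj x"
        using adj_comp[OF xI xm[of m]] by simp
      then have "adj (x ^^ Suc m) (x y) = adj (x ^^ m) y" by (simp add: orth_inv_left[OF xI])
      then show ?thesis by (simp add: U_def)
    qed
    have U_0: "U 0 = u" by (simp add: U_def id_def[symmetric])
    \<comment> \<open>\<open>None\<close> labels the indices outside all B m with m \<ge> 0, where D
      is the identity.\<close>
    define b where "b i = (if \<exists>m::nat. i \<in> B (int m) then Some (THE m::nat. i \<in> B (int m)) else None)" for i
    have bB: "b i = Some m \<longleftrightarrow> i \<in> B (int m)" for i m
    proof -
      have "(THE m::nat. i \<in> B (int m)) = m" if "i \<in> B (int m)" for m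
      proof (rule the_equality)
        show "m' = m" if "i \<in> B (int m')" for m'
          using B_disj[of "int m'" "int m"] that \<open>i \<in> B (int m)\<close> by auto
      qed (rule that)
      then show ?thesis by (auto simp: b_def)
    qed
    define T where "T p = (case p of None \<Rightarrow> id | Some m \<Rightarrow> U m)" for p
    have "T p \<in> orth {k. b k = p}" for p
    proof (cases p)
      case None
      then have "T p = id" by (simp only: T_def option.case)
      then show ?thesis using orth_id by (simp only:)
    next
      case (Some m)
      then show ?thesis using U[of m] by (simp add: T_def bB)
    qed
    then have "\<exists>D\<in>orth UNIV. \<forall>k. D (e k) = T (b k) (e k)" by (rule orth_direct_sum)
    then obtain D where D: "D \<in> orth UNIV" "\<And>k. D (e k) = T (b k) (e k)" by blast
    let ?J = "\<Union>m::nat. B (int m)"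
    have De: "D (e k) = U m (e k)" if "k \<in> B (int m)" for k m
      using D(2)[of k] that bB[of k m] by (simp add: T_def)
    have De': "D (e k) = e k" if "k \<notin> ?J" for k
    proof -
      have "b k = None" using that by (auto simp: b_def)
      then show ?thesis using D(2)[of k] by (simp add: T_def)
    qed
    have DJ: "D \<in> orth ?J" using D(1) De' by (simp add: orth_def)
    have DI: "D \<in> orth ?I" using DJ orth_mono[of ?J ?I] B_I(1) by blast
    obtain S where S: "S \<in> V 2" "\<And>k. k \<in> ?I \<Longrightarrow> S (e k) = D (e k)"
      using full[unfolded I, OF DI] I by blast
    have conj: "S \<circ> x \<circ> adj S = D \<circ> x \<circ> adj D"
      by (rule conj_agree[OF DI V_orth[OF S(1)] xI S(2)])
    have "D \<circ> x = u \<circ> x \<circ> D"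
    proof (rule orth_eqI)
      show "D \<circ> x \<in> orth UNIV" by (intro orth_comp D(1) orth_UNIV[OF xI])
      show "u \<circ> x \<circ> D \<in> orth UNIV" by (intro orth_comp D(1) orth_UNIV[OF xI] orth_UNIV[OF u])
      fix i
      show "(D \<circ> x) (e i) = (u \<circ> x \<circ> D) (e i)"
      proof (cases "i \<in> ?J")
        case True
        then obtain m l where i: "i = \<tau> (n, j, int m, l)" "i \<in> B (int m)" by (auto simp: B_def)
        have "\<tau> (n, j, int m + 1, l) \<in> B (int (Suc m))" by (auto simp: B_def algebra_simps)
        then have "D (x (e i)) = U (Suc m) (x (e i))" using De by (simp add: i(1) x)
        then have 1: "D (x (e i)) = x (U m (e i))" by (simp add: U_Suc)
        have "U m (e i) \<in> sub (B (int m))" by (rule orth_sub[OF U subset_refl e_in_sub[OF i(2)]])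
        then have "x (U m (e i)) \<bullet> e k = 0" if kB: "k \<in> B 0" for k
        proof -
          assume s: "U m (e i) \<in> sub (B (int m))"
          obtain l where k: "k = \<tau> (n, j, 0, l)" using kB by (auto simp: B_def)
          have "x (U m (e i)) \<bullet> e k = U m (e i) \<bullet> e (\<tau> (n, j, -1, l))"
            using orth_adjoint[OF xI, of "U m (e i)" "e k"] by (simp add: k adjx)
          moreover have "\<tau> (n, j, -1, l) \<notin> B (int m)" by (auto simp: B_def \<tau>_inj)
          ultimately show ?thesis using subD[OF s] by simp
        qed
        then have "x (U m (e i)) \<in> sub (- B 0)" by (simp add: sub_def)
        then have "u (x (U m (e i))) = x (U m (e i))" by (rule orth_fix[OF u]) simp
        then show ?thesis using 1 De[OF i(2)] by simp
      next
        case False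
        show ?thesis
        \<comment> \<open>This block lies outside the support of D but is carried into it by x, onto
          B 0.\<close>
        proof (cases "i \<in> B (-1)")
          case True
          then obtain l where i: "i = \<tau> (n, j, -1, l)" by (auto simp: B_def)
          have "\<tau> (n, j, 0, l) \<in> B (int 0)" by (auto simp: B_def)
          then show ?thesis using De[of _ 0] De'[OF False] by (simp add: i x U_0)
        next
          case i: False
          have "x (e i) \<bullet> e k = 0" if "k \<in> ?J" for k
          proof -
            obtain m :: nat and l where k: "k = \<tau> (n, j, int m, l)" using \<open>k \<in> ?J\<close>
              by (auto simp: B_def)
            have "x (e i) \<bullet> e k = e i \<bullet> e (\<tau> (n, j, int m - 1, l))"
              using orth_adjoint[OF xI, of "e i" "e k"] by (simp add: k adjx)
            moreover have "i \<noteq> \<tau> (n, j, int m - 1, l)"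
            proof (cases m)
              case 0 then show ?thesis using i by (auto simp: B_def)
            next
              case (Suc m') then show ?thesis using False by (auto simp: B_def)
            qed
            ultimately show ?thesis by (simp add: e_inner)
          qed
          then have s: "x (e i) \<in> sub (- ?J)" by (simp add: sub_def)
          then have "D (x (e i)) = x (e i)" by (rule orth_fix[OF DJ]) (rule Compl_disjoint)
          moreover have "B (int 0) \<subseteq> ?J" by blast
          then have "u (x (e i)) = x (e i)" by (intro orth_fix[OF u s]) auto
          ultimately show ?thesis using De'[OF False] by simp
        qed
      qed
    qed
    then have "D (x y) = u (x (D y))" for y by (simp add: fun_eq_iff)
    then have "u z = (D \<circ> x \<circ> adj D) (adj x z)" for z
      by (simp add: orth_inv_right[OF D(1)] orth_inv_right[OF xI])
    then have "u = S \<circ> x \<circ> adj S \<circ> adj x" by (simp add: fun_eq_iff conj[symmetric])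
    moreover have "S \<circ> x \<circ> adj S \<circ> adj x \<in> V (2 + 2 + 2 + 2)"
      by (intro comp_pow_add S(1) xV V_adj)
    ultimately show ?thesis by simp
  qed
  moreover have "B 1 \<subseteq> A0 - B 0" using B_I B_disj[of 0 1] by auto
  then have "infinite (A0 - B 0)" using B_inf finite_subset by blast
  ultimately show ?thesis using B_I(2) B_inf by blast
qed

text \<open>B' has to contain almost all of C = A0 - B and overlap B infinitely, whichever two
  members of an uncountable family the pigeonhole returns. So B is indexed by the nodes of the
  binary tree and C by its levels, and the involution of a branch exchanges each level with the node
  of the branch on it. Two branches share finitely many nodes, so their quotient moves nodes of one
  branch onto all but finitely many of C.\<close>

lemma cofinite_support:
  "\<exists>F. finite F \<and> F \<subseteq> A0 \<and> orth (A0 - F) \<subseteq> V 40"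
proof -
  obtain B where B: "B \<subseteq> A0" "infinite B" "infinite (A0 - B)" "orth B \<subseteq> V 8"
    using small_support by blast
  define C where "C = A0 - B"
  have "infinite (UNIV :: bool list set)" by (rule infinite_UNIV_listI)
  then have "\<exists>f. bij_betw f (UNIV :: bool list set) B"
    by (intro bij_betw_countable_infinite B(2)) auto
  then obtain \<beta> where \<beta>: "bij_betw \<beta> (UNIV :: bool list set) B" ..
  have "\<exists>f. bij_betw f (UNIV :: nat set) C"
    unfolding C_def by (intro bij_betw_countable_infinite B(3)) auto
  then obtain \<gamma> where \<gamma>: "bij_betw \<gamma> (UNIV :: nat set) C" ..
  define lb where "lb = inv_into UNIV \<beta>"
  define lc where "lc = inv_into UNIV \<gamma>"
  have \<beta>B: "\<beta> w \<in> B" and lb: "lb (\<beta> w) = w" for w using \<beta> by (auto simp: bij_betw_def lb_def)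
  have \<gamma>C: "\<gamma> n \<in> C" and lc: "lc (\<gamma> n) = n" for n using \<gamma> by (auto simp: bij_betw_def lc_def)
  have \<beta>_surj: "\<exists>w. i = \<beta> w" if "i \<in> B" for i using \<beta> that by (auto simp: bij_betw_def)
  have \<gamma>_surj: "\<exists>n. i = \<gamma> n" if "i \<in> C" for i using \<gamma> that by (auto simp: bij_betw_def)
  have BC: "\<beta> w \<notin> C" "\<gamma> n \<notin> B" for w n using \<beta>B \<gamma>C by (auto simp: C_def)
  \<comment> \<open>The node of the branch \<alpha> on level n.\<close>
  define pre where "pre \<alpha> n = map (\<lambda>i. i \<in> \<alpha>) [0..<n]" for \<alpha> :: "nat set" and n
  have len: "length (pre \<alpha> n) = n" for \<alpha> n by (simp add: pre_def)
  define p where "p \<alpha> i = (if i \<in> C then \<beta> (pre \<alpha> (lc i))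
    else if i \<in> B \<and> lb i = pre \<alpha> (length (lb i)) then \<gamma> (length (lb i)) else i)" for \<alpha> i
  have p\<gamma>: "p \<alpha> (\<gamma> n) = \<beta> (pre \<alpha> n)" for \<alpha> n by (simp add: p_def \<gamma>C lc)
  have p\<beta>: "p \<alpha> (\<beta> (pre \<alpha> n)) = \<gamma> n" for \<alpha> n by (simp add: p_def BC \<beta>B lb len)
  have p\<beta>': "p \<alpha> (\<beta> w) = \<beta> w" if "w \<noteq> pre \<alpha> (length w)" for \<alpha> w
    using that by (simp add: p_def BC \<beta>B lb)
  have p_out: "p \<alpha> i = i" if "i \<notin> A0" for \<alpha> i using that B(1) by (auto simp: p_def C_def)
  have pp: "p \<alpha> (p \<alpha> i) = i" for \<alpha> i
  proof -
    consider n where "i = \<gamma> n" | w where "i = \<beta> w" | "i \<notin> A0"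
      using \<beta>_surj[of i] \<gamma>_surj[of i] unfolding C_def by blast
    then show ?thesis
    proof cases
      case 1 then show ?thesis by (simp add: p\<gamma> p\<beta>)
    next
      case (2 w)
      show ?thesis
      proof (cases "w = pre \<alpha> (length w)")
        case True
        then show ?thesis using p\<beta>[of \<alpha> "length w"] p\<gamma>[of \<alpha> "length w"] 2 by simp
      qed (simp add: 2 p\<beta>')
    next
      case 3 then show ?thesis by (simp add: p_out)
    qed
  qed
  have "\<exists>X\<in>orth A0. \<forall>i. X (e i) = e (p \<alpha> i)" for \<alpha>
  proof (rule orth_permutation)
    show "bij (p \<alpha>)" by (rule o_bij[of "p \<alpha>"]) (simp_all add: fun_eq_iff pp)
  qed (rule p_out)
  then have "\<forall>\<alpha>. \<exists>X. X \<in> orth A0 \<and> (\<forall>i. X (e i) = e (p \<alpha> i))" by blast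
  from choice[OF this] obtain X where
    X': "\<forall>\<alpha>. X \<alpha> \<in> orth A0 \<and> (\<forall>i. X \<alpha> (e i) = e (p \<alpha> i))" ..
  have X: "X \<alpha> \<in> orth A0" "X \<alpha> (e i) = e (p \<alpha> i)" for \<alpha> i
    using spec[OF X', of \<alpha>] by (rule conjunct1, blast)
  have "\<exists>s\<in>UNIV. \<exists>t\<in>UNIV. s \<noteq> t \<and> adj (X s) \<circ> X t \<in> V 2"
    by (rule pigeonhole[OF uncountable_nat_sets X(1)])
  then obtain s t where "s \<noteq> t" and V2: "adj (X s) \<circ> X t \<in> V 2" by blast
  define h where "h = adj (X s) \<circ> X t"
  have hV: "h \<in> V 2" using V2 by (simp add: h_def)
  have hA0: "h \<in> orth A0" by (rule V_orth[OF hV])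
  have "adj (X s) (e i) = e (p s i)" for i
    using orth_inv_left[OF X(1)[of s], of "e (p s i)"] by (simp add: X(2) pp)
  then have h: "h (e i) = e (p s (p t i))" for i by (simp add: h_def X(2))
  \<comment> \<open>The image of B under the index permutation of h; both factors are involutions,
    so membership is tested with them in reverse order.\<close>
  define B' where "B' = {i. p t (p s i) \<in> B}"
  have B'V: "orth B' \<subseteq> V 12"
  proof
    fix T assume T: "T \<in> orth B'"
    let ?S = "adj h \<circ> T \<circ> h"
    have "?S \<in> orth UNIV"
      by (rule orth_comp[OF orth_comp[OF orth_UNIV[OF orth_inv[OF hA0]] orth_UNIV[OF T]]
            orth_UNIV[OF hA0]])
    moreover have "?S (e i) = e i" if "i \<notin> B" for i
    proof -
      have "p s (p t i) \<notin> B'" using that by (simp add: B'_def pp)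
      then have "T (h (e i)) = h (e i)" by (simp add: h orth_fixes_e[OF T])
      then show ?thesis by (simp add: orth_inv_left[OF hA0])
    qed
    ultimately have "?S \<in> orth B" by (simp add: orth_def)
    then have "?S \<in> V 8" using B(4) by blast
    then have "h \<circ> ?S \<circ> adj h \<in> V (2 + 8 + 2)" by (intro comp_pow_add hV V_adj)
    moreover have "h \<circ> ?S \<circ> adj h = T" by (simp add: fun_eq_iff orth_inv_right[OF hA0])
    ultimately show "T \<in> V 12" by simp
  qed
  obtain N where N: "(N \<in> s) \<noteq> (N \<in> t)" using \<open>s \<noteq> t\<close> by blast
  \<comment> \<open>Position N occurs in a prefix of length n only for n > N.\<close>
  have pre_ne: "pre s n \<noteq> pre t n" if "n > N" for n
  proof
    assume "pre s n = pre t n"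
    then have "pre s n ! N = pre t n ! N" by simp
    then show False using N that by (simp add: pre_def)
  qed
  have inf_img: "infinite (f ` {N<..})" if "\<And>m n. f m = f n \<Longrightarrow> m = n" for f :: "nat \<Rightarrow> nat"
    using that finite_imageD[of f "{N<..}"] infinite_Ioi[of N] by (auto simp: inj_on_def)
  have \<beta>pre_inj: "m = n" if "\<beta> (pre \<alpha> m) = \<beta> (pre \<alpha> n)" for \<alpha> m n
  proof -
    have "lb (\<beta> (pre \<alpha> m)) = lb (\<beta> (pre \<alpha> n))" using that by simp
    then have "length (pre \<alpha> m) = length (pre \<alpha> n)" by (simp add: lb)
    then show ?thesis by (simp add: len)
  qed
  have \<gamma>_inj: "m = n" if "\<gamma> m = \<gamma> n" for m n
    using that lc by metis
  have \<gamma>B': "\<gamma> n \<in> B'" if "n > N" for n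
    using pre_ne[OF that] by (simp add: B'_def p\<gamma> p\<beta>' len \<beta>B)
  have "infinite (B - B')"
  proof -
    have "\<beta> (pre t n) \<in> B - B'" if "n > N" for n
      using pre_ne[OF that] by (simp add: B'_def p\<beta> p\<beta>' len \<beta>B BC)
    then have "(\<lambda>n. \<beta> (pre t n)) ` {N<..} \<subseteq> B - B'" by auto
    then show ?thesis using inf_img[of "\<lambda>n. \<beta> (pre t n)"] \<beta>pre_inj finite_subset by blast
  qed
  moreover have "infinite (B \<inter> B')"
  proof -
    have "\<beta> (pre s n) \<in> B \<inter> B'" for n by (simp add: B'_def p\<beta> p\<gamma> \<beta>B)
    then have "(\<lambda>n. \<beta> (pre s n)) ` {N<..} \<subseteq> B \<inter> B'" by auto
    then show ?thesis using inf_img[of "\<lambda>n. \<beta> (pre s n)"] \<beta>pre_inj finite_subset by blast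
  qed
  moreover have "infinite (B' - B)"
  proof -
    have "\<gamma> ` {N<..} \<subseteq> B' - B" using \<gamma>B' BC by auto
    then show ?thesis using inf_img[of \<gamma>] \<gamma>_inj finite_subset by blast
  qed
  ultimately have inf3: "infinite (B - B')" "infinite (B \<inter> B')" "infinite (B' - B)" .
  define F where "F = A0 - (B \<union> B')"
  have "F \<subseteq> \<gamma> ` {..N}"
  proof
    fix i assume i: "i \<in> F"
    then have "i \<in> C" by (simp add: F_def C_def)
    then obtain n where "i = \<gamma> n" using \<gamma>_surj by blast
    moreover have "n \<le> N" using i \<gamma>B'[of n] \<open>i = \<gamma> n\<close> by (force simp: F_def)
    ultimately show "i \<in> \<gamma> ` {..N}" by blast
  qed
  then have "finite F" using finite_subset by blast
  moreover have "F \<subseteq> A0" by (auto simp: F_def)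
  moreover have "T \<in> V 40" if "T \<in> orth (A0 - F)" for T
  proof -
    have "B' \<subseteq> A0" using p_out B(1) by (auto simp: B'_def) (metis p_out subsetD)
    then have "A0 - F = (B - B') \<union> (B \<inter> B') \<union> (B' - B)" using B(1) by (auto simp: F_def)
    then have T: "T \<in> orth ((B - B') \<union> (B \<inter> B') \<union> (B' - B))" using that by simp
    have U: "(B - B') \<union> (B \<inter> B') = B" "(B \<inter> B') \<union> (B' - B) = B'" by auto
    obtain a b c d where abcd: "a \<in> orth B" "b \<in> orth B'" "c \<in> orth B" "d \<in> orth B'"
      "T = a \<circ> b \<circ> c \<circ> d"
      using orth_factor[OF inf3 _ _ _ T] unfolding U by auto
    have "a \<in> V 8" "b \<in> V 12" "c \<in> V 8" "d \<in> V 12" using abcd B(4) B'V by blast+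
    then have "a \<circ> b \<circ> c \<circ> d \<in> V (8 + 12 + 8 + 12)" by (intro comp_pow_add)
    then show ?thesis using abcd(5) by simp
  qed
  ultimately show ?thesis by blast
qed

end

section \<open>Prescribed inner products, rotations, and a neighbourhood of the identity in a power
  of W\<close>

context hilbert begin

text \<open>
  A symmetric diagonally dominant matrix is a Gram matrix: give each unordered pair of indices
  its own basis vector, and let that vector carry the corresponding off-diagonal entry.
\<close>

lemma gram_diag_dominant:
  fixes M :: "nat \<Rightarrow> nat \<Rightarrow> real" and b :: "nat \<times> nat \<Rightarrow> nat"
  assumes F: "finite F" and sym: "\<And>i j. M i j = M j i"
    and dom: "\<And>i. i \<in> F \<Longrightarrow> (\<Sum>j\<in>F - {i}. \<bar>M i j\<bar>) \<le> M i i"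
    and b: "inj b"
  shows "\<exists>z. (\<forall>i\<in>F. z i \<in> sub (range b)) \<and> (\<forall>i\<in>F. \<forall>k\<in>F. z i \<bullet> z k = M i k)"
proof -
  \<comment> \<open>The product of c i j and c j i must be M i j, so the sign goes into one of the
    two factors; the diagonal coefficient takes what the other squares leave of M i i.\<close>
  define c where "c i j = (if i = j then sqrt (M i i - (\<Sum>j\<in>F - {i}. \<bar>M i j\<bar>))
      else if i < j then sqrt \<bar>M i j\<bar> else sgn (M i j) * sqrt \<bar>M i j\<bar>)" for i j
  define q where "q i j = b (min i j, max i j)" for i j
  have q: "q i j = q k l \<longleftrightarrow> (i = k \<and> j = l) \<or> (i = l \<and> j = k)" for i j k l
    using b by (auto simp: q_def inj_eq min_def max_def)
  define z where "z i = (\<Sum>j\<in>F. c i j *\<^sub>R e (q i j))" for i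
  have zz: "z i \<bullet> z k = (\<Sum>j\<in>F. \<Sum>l\<in>F. c i j * c k l * (if q i j = q k l then 1 else 0))" for i k
  proof -
    have "z i \<bullet> z k = (\<Sum>j\<in>F. (c i j *\<^sub>R e (q i j)) \<bullet> z k)"
      by (simp only: z_def inner_sum_left)
    also have "\<dots> = (\<Sum>j\<in>F. \<Sum>l\<in>F. (c i j *\<^sub>R e (q i j)) \<bullet> (c k l *\<^sub>R e (q k l)))"
      by (simp only: z_def inner_sum_right)
    finally show ?thesis by (simp add: e_inner mult_ac)
  qed
  have "z i \<in> sub (range b)" for i
    unfolding z_def by (intro subspace_sum subspace_sub sub_scale e_in_sub) (simp add: q_def)
  moreover have "z i \<bullet> z k = M i k" if i: "i \<in> F" and k: "k \<in> F" for i k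
  proof (cases "i = k")
    case True
    have "z i \<bullet> z i = (\<Sum>j\<in>F. \<Sum>l\<in>F. if l = j then c i j * c i l else 0)"
      unfolding zz by (intro sum.cong refl) (auto simp: q)
    also have "\<dots> = (\<Sum>j\<in>F. (c i j)\<^sup>2)" using F by (simp add: power2_eq_square)
    also have "\<dots> = (c i i)\<^sup>2 + (\<Sum>j\<in>F - {i}. (c i j)\<^sup>2)" using F i by (rule sum.remove)
    also have "(\<Sum>j\<in>F - {i}. (c i j)\<^sup>2) = (\<Sum>j\<in>F - {i}. \<bar>M i j\<bar>)"
      by (intro sum.cong refl) (auto simp: c_def power_mult_distrib sgn_if)
    also have "(c i i)\<^sup>2 = M i i - (\<Sum>j\<in>F - {i}. \<bar>M i j\<bar>)"
      using dom[OF i] by (simp add: c_def)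
    finally show ?thesis using True by simp
  next
    case False
    have "z i \<bullet> z k = (\<Sum>j\<in>F. \<Sum>l\<in>F. if l = i then (if j = k then c i k * c k i else 0) else 0)"
      unfolding zz using False by (intro sum.cong refl) (auto simp: q)
    also have "\<dots> = c i k * c k i" using F i k by simp
    also have "\<dots> = sgn (M i k) * (sqrt \<bar>M i k\<bar> * sqrt \<bar>M i k\<bar>)"
      using False sym[of i k] by (auto simp: c_def)
    also have "\<dots> = M i k" by (simp add: sgn_mult_abs)
    finally show ?thesis .
  qed
  ultimately show ?thesis by blast
qed

text \<open>Take w i as the sum over k of N i k times \<open>e (u k)\<close>, plus a correction z i.
  Orthonormality then asks the z i to have Gram matrix 1 - N N^T, which is diagonally dominant for
  small N.\<close>

lemma orthonormal_prescribed:
  fixes N :: "nat \<Rightarrow> nat \<Rightarrow> real" and u :: "nat \<Rightarrow> nat" and b :: "nat \<times> nat \<Rightarrow> nat"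
  assumes F: "finite F" and u: "inj u" and b: "inj b" and ub: "range u \<inter> range b = {}"
    and N: "\<And>i j. i \<in> F \<Longrightarrow> j \<in> F \<Longrightarrow> \<bar>N i j\<bar> \<le> 1 / (2 * (real (card F) + 1))"
  shows "\<exists>w. (\<forall>i\<in>F. w i \<in> sub (range u \<union> range b)) \<and> orthonormal_on F w \<and>
    (\<forall>i\<in>F. \<forall>j\<in>F. w i \<bullet> e (u j) = N i j)"
proof -
  define n where "n = real (card F)"
  define \<eta> where "\<eta> = 1 / (2 * (n + 1))"
  define M where "M i j = (if i = j then 1 else 0) - (\<Sum>k\<in>F. N i k * N j k)" for i j
  have n: "n \<ge> 0" by (simp add: n_def)
  \<comment> \<open>A row of 1 - N N^T has off-diagonal sum at most (n - 1) n \<eta>^2 and diagonal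
    entry at least 1 - n \<eta>^2, so dominance follows from n^2 \<eta>^2 \<le> 1; the choice of
    \<eta> provides it.\<close>
  have \<eta>: "n * (n + 1) * \<eta>\<^sup>2 \<le> 1"
  proof -
    have "n * (n + 1) \<le> (2 * (n + 1))\<^sup>2" using n by (simp add: power2_eq_square algebra_simps)
    then have "n * (n + 1) / (2 * (n + 1))\<^sup>2 \<le> 1" using n by (simp add: divide_le_eq)
    then show ?thesis by (simp add: \<eta>_def power_divide)
  qed
  have NN: "\<bar>\<Sum>k\<in>F. N i k * N j k\<bar> \<le> n * \<eta>\<^sup>2" if "i \<in> F" "j \<in> F" for i j
  proof -
    have "\<bar>\<Sum>k\<in>F. N i k * N j k\<bar> \<le> (\<Sum>k\<in>F. \<bar>N i k * N j k\<bar>)" by (rule sum_abs)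
    also have "\<dots> \<le> (\<Sum>k\<in>F. \<eta>\<^sup>2)"
    proof (rule sum_mono)
      fix k assume "k \<in> F"
      then show "\<bar>N i k * N j k\<bar> \<le> \<eta>\<^sup>2"
        unfolding abs_mult power2_eq_square \<eta>_def n_def
        using N that by (intro mult_mono) auto
    qed
    finally show ?thesis by (simp add: n_def)
  qed
  have "\<exists>z. (\<forall>i\<in>F. z i \<in> sub (range b)) \<and> (\<forall>i\<in>F. \<forall>k\<in>F. z i \<bullet> z k = M i k)"
  proof (rule gram_diag_dominant[OF F _ _ b])
    show "M i j = M j i" for i j by (auto simp: M_def mult.commute)
    fix i assume i: "i \<in> F"
    have "(\<Sum>j\<in>F - {i}. \<bar>M i j\<bar>) \<le> (\<Sum>j\<in>F - {i}. n * \<eta>\<^sup>2)"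
      using NN i by (intro sum_mono) (auto simp: M_def)
    also have "\<dots> = (n - 1) * (n * \<eta>\<^sup>2)"
    proof -
      have "card F \<noteq> 0" using F i by auto
      then have "real (card F - 1) = real (card F) - 1" by (simp add: of_nat_diff)
      then show ?thesis using F i by (simp add: n_def card_Diff_singleton)
    qed
    also have "\<dots> \<le> 1 - n * \<eta>\<^sup>2"
    proof -
      have "n * n * \<eta>\<^sup>2 \<le> n * (n + 1) * \<eta>\<^sup>2" using n by (intro mult_right_mono mult_left_mono) auto
      then show ?thesis using \<eta> by (simp add: algebra_simps)
    qed
    also have "\<dots> \<le> M i i" using NN[OF i i] by (simp add: M_def)
    finally show "(\<Sum>j\<in>F - {i}. \<bar>M i j\<bar>) \<le> M i i" .
  qed
  then obtain z where z: "\<And>i. i \<in> F \<Longrightarrow> z i \<in> sub (range b)"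
    "\<And>i k. i \<in> F \<Longrightarrow> k \<in> F \<Longrightarrow> z i \<bullet> z k = M i k" by blast
  have ze: "z i \<bullet> e (u j) = 0" if "i \<in> F" for i j
    using subD[OF z(1)[OF that], of "u j"] ub by auto
  have ez: "e (u j) \<bullet> z i = 0" if "i \<in> F" for i j
    using ze[OF that] by (simp add: inner_commute)
  define w where "w i = (\<Sum>k\<in>F. N i k *\<^sub>R e (u k)) + z i" for i
  have uu: "e (u i) \<bullet> e (u j) = (if i = j then 1 else 0)" for i j
    using u by (simp add: e_inner inj_eq)
  have "w i \<bullet> e (u j) = N i j" if "i \<in> F" "j \<in> F" for i j
    using F that by (simp add: w_def inner_add_left inner_sum_left uu ze if_distrib cong: if_cong)
  moreover have "w i \<in> sub (range u \<union> range b)" if "i \<in> F" for i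
    unfolding w_def
    using z(1)[OF that] sub_mono[of "range b" "range u \<union> range b"]
    by (intro sub_add subspace_sum subspace_sub sub_scale e_in_sub) auto
  moreover have "w i \<bullet> w j = (if i = j then 1 else 0)" if "i \<in> F" "j \<in> F" for i j
  proof -
    have "w i \<bullet> w j = (\<Sum>k\<in>F. N i k * N j k) + z i \<bullet> z j"
      using F that by (simp add: w_def inner_add inner_sum_left inner_sum_right uu ze ez
          if_distrib mult.commute cong: if_cong)
    then show ?thesis using z(2)[OF that] by (simp add: M_def)
  qed
  ultimately show ?thesis unfolding orthonormal_on_def by blast
qed

lemma rotation_exists:
  assumes F: "finite F" and u: "inj u" and uF: "range u \<inter> F = {}"
    and A: "F \<subseteq> A" "range u \<subseteq> A"
  shows "\<exists>R\<in>orth A. \<forall>f\<in>F. R (e f) = cos t *\<^sub>R e f + sin t *\<^sub>R e (u f) \<and>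
    R (e (u f)) = cos t *\<^sub>R e (u f) - sin t *\<^sub>R e f"
proof -
  \<comment> \<open>The Boolean selects between \<open>e f\<close> and its partner
    \<open>e (u f)\<close> in the plane to be rotated.\<close>
  define x where "x p = (if snd p then e (u (fst p)) else e (fst p))" for p :: "nat \<times> bool"
  define y where "y p = (if snd p then cos t *\<^sub>R e (u (fst p)) - sin t *\<^sub>R e (fst p)
    else cos t *\<^sub>R e (fst p) + sin t *\<^sub>R e (u (fst p)))" for p :: "nat \<times> bool"
  have ne: "u f \<noteq> g" "g \<noteq> u f" if "g \<in> F" for f g using uF that by auto
  have trig: "sin t * sin t + cos t * cos t = 1" "cos t * cos t + sin t * sin t = 1"
    using sin_cos_squared_add[of t] by (simp_all add: power2_eq_square)
  have "\<exists>R\<in>orth A. \<forall>p\<in>F \<times> UNIV. R (x p) = y p"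
  proof (rule Witt_finite)
    show "finite (F \<times> (UNIV :: bool set))" using F by simp
    fix p assume p: "p \<in> F \<times> (UNIV :: bool set)"
    then have s: "e (fst p) \<in> sub A" "e (u (fst p)) \<in> sub A" using A by (auto intro!: e_in_sub)
    show "x p - y p \<in> sub A" unfolding x_def y_def
      by (cases "snd p") (simp_all add: s sub_add sub_diff sub_scale)
    fix r assume r: "r \<in> F \<times> (UNIV :: bool set)"
    show "x p \<bullet> x r = y p \<bullet> y r"
      using p r ne u trig
      by (auto simp: x_def y_def inner_add inner_diff e_inner inj_eq)
  qed
  then obtain R where R: "R \<in> orth A" "\<And>p. p \<in> F \<times> UNIV \<Longrightarrow> R (x p) = y p" by blast
  have "R (e f) = cos t *\<^sub>R e f + sin t *\<^sub>R e (u f) \<and>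
    R (e (u f)) = cos t *\<^sub>R e (u f) - sin t *\<^sub>R e f" if "f \<in> F" for f
    using R(2)[of "(f, True)"] R(2)[of "(f, False)"] that by (simp add: x_def y_def)
  then show ?thesis using R(1) by blast
qed

end

context syndetic begin

text \<open>For angles a, b in (0, 1) the quotient of the two rotations turns each plane by b - a,
  and 0 < |b - a| < 1 < pi gives a nonzero sine. The R t are chosen one by one and need not form a
  one-parameter group, so the addition formulas are applied on the planes only.\<close>

lemma rotation_in_V:
  assumes F: "finite F" and u: "inj u" and uF: "range u \<inter> F = {}"
    and A: "F \<subseteq> A0" "range u \<subseteq> A0"
  shows "\<exists>g\<in>V 2. \<exists>c s. s \<noteq> 0 \<and> (\<forall>f\<in>F. g (e f) = c *\<^sub>R e f + s *\<^sub>R e (u f))"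
proof -
  have "\<forall>t. \<exists>R. R \<in> orth A0 \<and> (\<forall>f\<in>F. R (e f) = cos t *\<^sub>R e f + sin t *\<^sub>R e (u f) \<and>
    R (e (u f)) = cos t *\<^sub>R e (u f) - sin t *\<^sub>R e f)"
    using rotation_exists[OF F u uF A] by blast
  from choice[OF this] obtain R where R': "\<forall>t. R t \<in> orth A0 \<and>
    (\<forall>f\<in>F. R t (e f) = cos t *\<^sub>R e f + sin t *\<^sub>R e (u f) \<and>
    R t (e (u f)) = cos t *\<^sub>R e (u f) - sin t *\<^sub>R e f)" ..
  have R: "R t \<in> orth A0" for t using R' by blast
  have Re: "R t (e f) = cos t *\<^sub>R e f + sin t *\<^sub>R e (u f)"
    "R t (e (u f)) = cos t *\<^sub>R e (u f) - sin t *\<^sub>R e f" if "f \<in> F" for t f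
    using R' that by blast+
  have "uncountable {0<..<1::real}" by (simp add: uncountable_open_interval)
  then have "\<exists>a\<in>{0<..<1::real}. \<exists>b\<in>{0<..<1}. a \<noteq> b \<and> adj (R a) \<circ> R b \<in> V 2"
    by (rule pigeonhole) (rule R)
  then obtain a b where ab: "a \<in> {0<..<1::real}" "b \<in> {0<..<1}" "a \<noteq> b"
    and V2: "adj (R a) \<circ> R b \<in> V 2" by blast
  define t where "t = b - a"
  have "(adj (R a) \<circ> R b) (e f) = cos t *\<^sub>R e f + sin t *\<^sub>R e (u f)" if f: "f \<in> F" for f
  proof -
    have lin: "linear (R a)" using isometric_linear orth_isometric[OF R] by blast
    have trig: "cos b = cos t * cos a - sin t * sin a" "sin b = sin t * cos a + cos t * sin a"
      using cos_add[of t a] sin_add[of t a] by (simp_all add: t_def)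
    have "R a (cos t *\<^sub>R e f + sin t *\<^sub>R e (u f)) = R b (e f)"
      unfolding linear_add[OF lin] linear_scale[OF lin] Re[OF f]
      by (simp only: trig scaleR_add_left scaleR_diff_left scaleR_add_right scaleR_diff_right
          scaleR_scaleR) (simp add: algebra_simps)
    then have "adj (R a) (R a (cos t *\<^sub>R e f + sin t *\<^sub>R e (u f))) = adj (R a) (R b (e f))" by simp
    then show ?thesis by (simp add: orth_inv_left[OF R])
  qed
  moreover have "sin t \<noteq> 0"
  proof -
    have "\<bar>t\<bar> < 1" "t \<noteq> 0" using ab by (auto simp: t_def)
    then have "0 < \<bar>t\<bar>" "\<bar>t\<bar> < pi" using pi_gt3 by auto
    then have "sin \<bar>t\<bar> > 0" by (rule sin_gt_zero)
    then show ?thesis by (auto simp: abs_if split: if_splits)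
  qed
  ultimately show ?thesis using V2 by (intro bexI[OF _ V2] exI[of _ "cos t"] exI[of _ "sin t"]) auto
qed

text \<open>The conjugates of K by h realize all matrices c^2 + s^2 N with N small. This gives a
  neighbourhood of h0, the case N = 0, rather than of the identity; multiplication by h0^-1 costs
  the last 44 factors.\<close>

theorem neighbourhood_in_V:
  "\<exists>F \<epsilon>. finite F \<and> \<epsilon> > 0 \<and>
    (\<forall>T\<in>orth A0. (\<forall>f\<in>F. norm (T (e f) - e f) < \<epsilon>) \<longrightarrow> T \<in> V 168)"
proof -
  obtain F where F: "finite F" "F \<subseteq> A0" "orth (A0 - F) \<subseteq> V 40"
    using cofinite_support by blast
  have "infinite (A0 - F)" using inf F(1) by simp
  then obtain A1 A2 where A: "A1 \<union> A2 = A0 - F" "A1 \<inter> A2 = {}" "infinite A1" "infinite A2"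
    by (rule split_infinite)
  obtain u :: "nat \<Rightarrow> nat" where u: "bij_betw u UNIV A1"
    using bij_betw_countable_infinite[of "UNIV :: nat set" A1] A by auto
  obtain b :: "nat \<times> nat \<Rightarrow> nat" where b: "bij_betw b UNIV A2"
    using bij_betw_countable_infinite[of "UNIV :: (nat \<times> nat) set" A2] A by (auto simp: finite_prod)
  have uA: "inj u" "range u = A1" using u by (auto simp: bij_betw_def)
  have bA: "inj b" "range b = A2" using b by (auto simp: bij_betw_def)
  have disj: "range u \<inter> range b = {}" "range u \<inter> F = {}" using A uA bA by auto
  have uF: "u f \<notin> F" "u f \<in> A0 - F" for f using A uA by auto
  obtain h c s where h: "h \<in> V 2" and s: "s \<noteq> 0"
    and he: "\<And>f. f \<in> F \<Longrightarrow> h (e f) = c *\<^sub>R e f + s *\<^sub>R e (u f)"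
    using rotation_in_V[OF F(1) uA(1) disj(2) F(2)] uA A by blast
  define \<eta> where "\<eta> = 1 / (2 * (real (card F) + 1))"
  have \<eta>: "\<eta> > 0" by (simp add: \<eta>_def add_pos_nonneg)
  note hA0 = V_orth[OF h]
  have fixed: "k (e f) = e f" if "k \<in> orth (A0 - F)" "f \<in> F" for k f
    using orth_fixes_e[OF that(1)] that(2) by simp
  have special: "\<exists>h1\<in>V 44. \<forall>i\<in>F. \<forall>j\<in>F. h1 (e i) \<bullet> e j = c\<^sup>2 * (if i = j then 1 else 0) + s\<^sup>2 * N i j"
    if N: "\<And>i j. i \<in> F \<Longrightarrow> j \<in> F \<Longrightarrow> \<bar>N i j\<bar> \<le> \<eta>" for N
  proof -
    have "\<exists>w. (\<forall>i\<in>F. w i \<in> sub (range u \<union> range b)) \<and> orthonormal_on F w \<and>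
        (\<forall>i\<in>F. \<forall>j\<in>F. w i \<bullet> e (u j) = N i j)"
      by (rule orthonormal_prescribed[OF F(1) uA(1) bA(1) disj(1)]) (rule N[unfolded \<eta>_def])
    then obtain w where w: "\<And>i. i \<in> F \<Longrightarrow> w i \<in> sub (A0 - F)" "orthonormal_on F w"
      "\<And>i j. i \<in> F \<Longrightarrow> j \<in> F \<Longrightarrow> w i \<bullet> e (u j) = N i j"
      unfolding uA(2) bA(2) A(1) by blast
    have "\<exists>k\<in>orth (A0 - F). \<forall>i\<in>F. k (e (u i)) = w i"
    proof (rule Witt_finite[OF F(1)])
      show "e (u i) \<bullet> e (u j) = w i \<bullet> w j" if "i \<in> F" "j \<in> F" for i j
        using orthonormal_onD[OF w(2) that] uA(1) by (simp add: e_inner inj_eq)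
      show "e (u i) - w i \<in> sub (A0 - F)" if "i \<in> F" for i
        by (intro sub_diff w(1) that e_in_sub uF)
    qed
    then obtain k where k: "k \<in> orth (A0 - F)" "\<And>i. i \<in> F \<Longrightarrow> k (e (u i)) = w i" by blast
    have lin: "linear k" using isometric_linear orth_isometric[OF k(1)] by blast
    let ?h = "adj h \<circ> k \<circ> h"
    have "?h \<in> V (2 + 40 + 2)" using k(1) F(3) h by (intro comp_pow_add V_adj) auto
    then have hV: "?h \<in> V 44" by simp
    have hh: "?h (e i) \<bullet> e j = c\<^sup>2 * (if i = j then 1 else 0) + s\<^sup>2 * N i j"
      if i: "i \<in> F" and j: "j \<in> F" for i j
    proof -
      have "?h (e i) \<bullet> e j = k (h (e i)) \<bullet> h (e j)"
        using orth_adjoint[OF orth_inv[OF hA0]] by (simp add: orth_inv_inv[OF hA0])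
      also have "k (h (e i)) = c *\<^sub>R e i + s *\<^sub>R w i"
        by (simp add: he[OF i] linear_add[OF lin] linear_scale[OF lin] fixed[OF k(1) i] k(2)[OF i])
      also have "(c *\<^sub>R e i + s *\<^sub>R w i) \<bullet> h (e j) =
          c\<^sup>2 * (e i \<bullet> e j) + c * s * (e i \<bullet> e (u j)) + c * s * (w i \<bullet> e j) + s\<^sup>2 * (w i \<bullet> e (u j))"
        by (simp add: he[OF j] inner_add power2_eq_square algebra_simps)
      also have "\<dots> = c\<^sup>2 * (if i = j then 1 else 0) + s\<^sup>2 * N i j"
        using subD[OF w(1)[OF i], of j] j i uF(1)[of j] w(3)[OF i j] by (auto simp: e_inner)
      finally show ?thesis .
    qed
    show ?thesis by (rule bexI[OF _ hV]) (intro ballI hh)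
  qed
  have close: "T \<in> V 124" if T: "T \<in> orth A0"
    and near: "\<And>i j. i \<in> F \<Longrightarrow> j \<in> F \<Longrightarrow> \<bar>T (e i) \<bullet> e j - c\<^sup>2 * (if i = j then 1 else 0)\<bar> \<le> s\<^sup>2 * \<eta>" for T
  proof -
    define N where "N i j = (T (e i) \<bullet> e j - c\<^sup>2 * (if i = j then 1 else 0)) / s\<^sup>2" for i j
    have "\<bar>N i j\<bar> \<le> \<eta>" if "i \<in> F" "j \<in> F" for i j
      using near[OF that] s
        by (simp add: N_def abs_div_pos[symmetric] divide_le_eq mult.commute abs_divide)
    then obtain h1 where h1: "h1 \<in> V 44"
      "\<And>i j. i \<in> F \<Longrightarrow> j \<in> F \<Longrightarrow> h1 (e i) \<bullet> e j = c\<^sup>2 * (if i = j then 1 else 0) + s\<^sup>2 * N i j"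
      using special[of N] by blast
    have h1e: "h1 (e i) \<bullet> e j = T (e i) \<bullet> e j" if "i \<in> F" "j \<in> F" for i j
      using h1(2)[OF that] s by (simp add: N_def)
    note h1A0 = V_orth[OF h1(1)]
    \<comment> \<open>Equal matrices mean that h1 (e i) and T (e i) differ by a vector without
      coordinates in F, so k can be taken to fix F pointwise.\<close>
    have "\<exists>k\<in>orth (A0 - F). \<forall>i\<in>F. k (h1 (e i)) = T (e i)"
    proof (rule Witt_finite[OF F(1)])
      show "h1 (e i) \<bullet> h1 (e j) = T (e i) \<bullet> T (e j)" for i j
        by (simp add: orth_inner[OF T] orth_inner[OF h1A0])
      show "h1 (e i) - T (e i) \<in> sub (A0 - F)" if i: "i \<in> F" for i
        unfolding sub_def
      proof (intro CollectI allI impI)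
        fix j assume "j \<notin> A0 - F"
        then consider "j \<in> F" | "j \<notin> A0" by blast
        then show "(h1 (e i) - T (e i)) \<bullet> e j = 0"
        proof cases
          case 1 then show ?thesis using h1e[OF i] by (simp add: inner_diff)
        next
          case 2 then show ?thesis by (simp add: inner_diff orth_coord[OF T] orth_coord[OF h1A0])
        qed
      qed
    qed
    then obtain k where k: "k \<in> orth (A0 - F)" "\<And>i. i \<in> F \<Longrightarrow> k (h1 (e i)) = T (e i)" by blast
    have kA0: "k \<in> orth A0" using k(1) orth_mono[of "A0 - F" A0] by blast
    \<comment> \<open>After k has corrected the images of F, the remaining right-hand factor fixes F
      pointwise.\<close>
    define l where "l = adj h1 \<circ> (adj k \<circ> T)"
    have "l \<in> orth A0" unfolding l_def
      by (rule orth_comp[OF orth_inv[OF h1A0] orth_comp[OF orth_inv[OF kA0] T]])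
    moreover have "l (e f) = e f" if "f \<in> F" for f
      using k(2)[OF that, symmetric]
        by (simp add: l_def orth_inv_left[OF kA0] orth_inv_left[OF h1A0])
    ultimately have "l \<in> orth (A0 - F)" by (auto simp: orth_def)
    then have "k \<circ> h1 \<circ> l \<in> V (40 + 44 + 40)" using k(1) F(3) h1(1) by (intro comp_pow_add) auto
    moreover have "k \<circ> h1 \<circ> l = T"
      by (simp add: fun_eq_iff l_def orth_inv_right[OF kA0] orth_inv_right[OF h1A0])
    ultimately show ?thesis by simp
  qed
  obtain h0 where h0: "h0 \<in> V 44"
    "\<And>i j. i \<in> F \<Longrightarrow> j \<in> F \<Longrightarrow> h0 (e i) \<bullet> e j = c\<^sup>2 * (if i = j then 1 else 0)"
    using special[of "\<lambda>_ _. 0"] \<eta> by auto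
  note h0A0 = V_orth[OF h0(1)]
  have "T \<in> V 168" if T: "T \<in> orth A0" and near: "\<And>f. f \<in> F \<Longrightarrow> norm (T (e f) - e f) < s\<^sup>2 * \<eta>" for T
  proof -
    have "\<bar>(h0 \<circ> T) (e i) \<bullet> e j - c\<^sup>2 * (if i = j then 1 else 0)\<bar> \<le> s\<^sup>2 * \<eta>"
      if ij: "i \<in> F" "j \<in> F" for i j
    proof -
      have "(h0 \<circ> T) (e i) \<bullet> e j - h0 (e i) \<bullet> e j = h0 (T (e i) - e i) \<bullet> e j"
        using isometric_diff[OF orth_isometric[OF h0A0]] by (simp add: inner_diff)
      also have "\<bar>\<dots>\<bar> \<le> norm (h0 (T (e i) - e i)) * norm (e j)" by (rule Cauchy_Schwarz_ineq2)
      also have "\<dots> = norm (T (e i) - e i)"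
        by (simp add: isometric_norm[OF orth_isometric[OF h0A0]] norm_eq_sqrt_inner[of "e j"] e_inner)
      also have "\<dots> \<le> s\<^sup>2 * \<eta>" using near[OF ij(1)] by simp
      finally show ?thesis using h0(2)[OF ij] by simp
    qed
    then have "h0 \<circ> T \<in> V 124" by (intro close orth_comp[OF h0A0 T])
    then have "adj h0 \<circ> (h0 \<circ> T) \<in> V (44 + 124)" by (intro comp_pow_add V_adj h0(1))
    moreover have "adj h0 \<circ> (h0 \<circ> T) = T" by (simp add: fun_eq_iff orth_inv_left[OF h0A0])
    ultimately show ?thesis by simp
  qed
  then have "\<forall>T\<in>orth A0. (\<forall>f\<in>F. norm (T (e f) - e f) < s\<^sup>2 * \<eta>) \<longrightarrow> T \<in> V 168" by simp
  moreover have "s\<^sup>2 * \<eta> > 0" using s \<eta> by simp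
  ultimately show ?thesis using F(1) by (intro exI[of _ F] exI[of _ "s\<^sup>2 * \<eta>"] conjI)
qed

end

section \<open>Homomorphisms of orthogonal groups into separable groups\<close>

locale top_group = group H for H (structure) +
  fixes S :: "'h topology"
  assumes top_group: "topological_group H S"
begin

lemma topspace_eq: "topspace S = carrier H"
  using top_group by (simp add: topological_group_def)

lemma continuous_mult: "continuous_map (prod_topology S S) S (\<lambda>(g, h). g \<otimes> h)"
  using top_group by (simp add: topological_group_def)

lemma continuous_inv: "continuous_map S S (\<lambda>g. inv g)"
  using top_group by (simp add: topological_group_def)

lemma mult_neighbourhood:
  assumes "openin S U" "\<one> \<in> U"
  shows "\<exists>V. openin S V \<and> \<one> \<in> V \<and> (\<forall>x\<in>V. \<forall>y\<in>V. x \<otimes> y \<in> U)"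
proof -
  let ?P = "{p \<in> topspace (prod_topology S S). (case p of (g, h) \<Rightarrow> g \<otimes> h) \<in> U}"
  have "openin (prod_topology S S) ?P"
    by (rule openin_continuous_map_preimage[OF continuous_mult assms(1)])
  moreover have "(\<one>, \<one>) \<in> ?P" using assms(2) by (simp add: topspace_eq)
  ultimately have "\<exists>V1 V2. openin S V1 \<and> openin S V2 \<and> \<one> \<in> V1 \<and> \<one> \<in> V2 \<and> V1 \<times> V2 \<subseteq> ?P"
    using iffD1[OF openin_prod_topology_alt, rule_format, of S S ?P "\<one>" "\<one>"] by simp
  then obtain V1 V2 where V: "openin S V1" "openin S V2" "\<one> \<in> V1" "\<one> \<in> V2" "V1 \<times> V2 \<subseteq> ?P"
    by blast
  have "x \<otimes> y \<in> U" if "x \<in> V1 \<inter> V2" "y \<in> V1 \<inter> V2" for x y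
  proof -
    have "(x, y) \<in> ?P" using V(5) that by blast
    then show ?thesis by simp
  qed
  then show ?thesis using V by (intro exI[of _ "V1 \<inter> V2"]) auto
qed

lemma inv_neighbourhood:
  assumes "openin S U" "\<one> \<in> U"
  shows "\<exists>V. openin S V \<and> \<one> \<in> V \<and> (\<forall>x\<in>V. x \<in> U \<and> inv x \<in> U)"
proof -
  let ?P = "{x \<in> topspace S. inv x \<in> U}"
  have "openin S ?P" by (rule openin_continuous_map_preimage[OF continuous_inv assms(1)])
  then have "openin S (U \<inter> ?P)" using assms(1) by blast
  moreover have "\<one> \<in> U \<inter> ?P" using assms(2) by (simp add: topspace_eq)
  ultimately show ?thesis by blast
qed

lemma continuous_left_mult: "a \<in> carrier H \<Longrightarrow> continuous_map S S (\<lambda>x. a \<otimes> x)"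
proof -
  assume a: "a \<in> carrier H"
  have "continuous_map S (prod_topology S S) (\<lambda>x. (a, x))"
    using a by (simp add: continuous_map_pairedI topspace_eq)
  from continuous_map_compose[OF this continuous_mult] show ?thesis by (simp add: o_def)
qed

lemma limitin_mult:
  assumes "limitin S x a F" "limitin S y b F"
  shows "limitin S (\<lambda>n. x n \<otimes> y n) (a \<otimes> b) F"
proof -
  have "limitin (prod_topology S S) (\<lambda>n. (x n, y n)) (a, b) F"
    using assms by (simp add: limitin_pairwise o_def)
  from continuous_map_limit[OF continuous_mult this] show ?thesis by (simp add: o_def)
qed

text \<open>The dense set meets each open translate x V.\<close>

lemma dense_translate:
  assumes sep: "separable_space S" and V: "openin S V" "\<one> \<in> V"
  shows "\<exists>D. countable D \<and> D \<subseteq> carrier H \<and> (\<forall>x\<in>carrier H. \<exists>d\<in>D. inv x \<otimes> d \<in> V)"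
proof -
  obtain D where D: "countable D" "D \<subseteq> carrier H" "S closure_of D = carrier H"
    using sep by (auto simp: separable_space_def topspace_eq)
  have "\<exists>d\<in>D. inv x \<otimes> d \<in> V" if x: "x \<in> carrier H" for x
  proof -
    let ?P = "{y \<in> topspace S. inv x \<otimes> y \<in> V}"
    have "openin S ?P"
      using openin_continuous_map_preimage[OF continuous_left_mult V(1)] x by simp
    moreover have "x \<in> ?P" using x V(2) by (simp add: topspace_eq)
    moreover have "x \<in> S closure_of D" using D(3) x by simp
    then have "\<forall>T. x \<in> T \<and> openin S T \<longrightarrow> (\<exists>y. y \<in> D \<and> y \<in> T)" unfolding in_closure_of
      by (rule conjunct2)
    ultimately have "\<exists>y. y \<in> D \<and> y \<in> ?P" by (elim allE[of _ ?P]) (rule mp, simp_all only: simp_thms)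
    then show ?thesis by blast
  qed
  with D show ?thesis by (intro exI[of _ D]) blast
qed

end

context hilbert begin

text \<open>A Steinhaus-type argument: the exponent of \<open>neighbourhood_in_V\<close> does not
  depend on W, so a neighbourhood V whose 168-fold products stay in U can be fixed before W is
  formed from it.\<close>

theorem orth_hom_seq_continuous:
  fixes H :: "'h monoid" and S :: "'h topology" and f :: "('a \<Rightarrow> 'a) \<Rightarrow> 'h"
  assumes A: "infinite A" and tg: "topological_group H S" and sep: "separable_space S"
    and fH: "\<And>T. T \<in> orth A \<Longrightarrow> f T \<in> carrier H"
    and hom: "\<And>T1 T2. T1 \<in> orth A \<Longrightarrow> T2 \<in> orth A \<Longrightarrow> f (T1 \<circ> T2) = f T1 \<otimes>\<^bsub>H\<^esub> f T2"
    and T: "\<And>n::nat. T n \<in> orth A" "\<And>i. (\<lambda>n. T n (e i)) \<longlonglongrightarrow> e i"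
  shows "limitin S (\<lambda>n. f (T n)) \<one>\<^bsub>H\<^esub> sequentially"
proof -
  interpret group H using tg by (simp add: topological_group_def)
  interpret top_group H S by unfold_locales (rule tg)
  have f_id: "f id = \<one>\<^bsub>H\<^esub>"
  proof -
    have "f id \<otimes>\<^bsub>H\<^esub> f id = f id" using hom[OF orth_id orth_id] by simp
    then show ?thesis using fH[OF orth_id] by (metis l_cancel_one')
  qed
  have f_adj: "f (adj T) = inv\<^bsub>H\<^esub> (f T)" if T: "T \<in> orth A" for T
  proof -
    have "adj T \<circ> T = id" by (simp add: fun_eq_iff orth_inv_left[OF T])
    then have "f (adj T) \<otimes>\<^bsub>H\<^esub> f T = \<one>\<^bsub>H\<^esub>" using hom[OF orth_inv[OF T] T] f_id by simp
    then show ?thesis using fH[OF T] fH[OF orth_inv[OF T]] by (simp add: inv_equality)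
  qed
  have power: "\<exists>V. openin S V \<and> \<one>\<^bsub>H\<^esub> \<in> V \<and>
      (\<forall>W\<subseteq>orth A. f ` W \<subseteq> V \<longrightarrow> comp_pow W m \<subseteq> orth A \<and> f ` comp_pow W m \<subseteq> U)"
    if "openin S U" "\<one>\<^bsub>H\<^esub> \<in> U" for U and m :: nat
    using that
  proof (induction m arbitrary: U)
    case 0
    have "comp_pow W 0 \<subseteq> orth A \<and> f ` comp_pow W 0 \<subseteq> U" for W
      using orth_id f_id 0(2) by (simp del: id_apply)
    then show ?case using 0 by (intro exI[of _ U]) blast
  next
    case (Suc m)
    obtain V1 where V1: "openin S V1" "\<one>\<^bsub>H\<^esub> \<in> V1" "\<forall>x\<in>V1. \<forall>y\<in>V1. x \<otimes>\<^bsub>H\<^esub> y \<in> U"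
      using mult_neighbourhood[OF Suc.prems] by blast
    obtain V2 where V2: "openin S V2" "\<one>\<^bsub>H\<^esub> \<in> V2"
      "\<forall>W\<subseteq>orth A. f ` W \<subseteq> V2 \<longrightarrow> comp_pow W m \<subseteq> orth A \<and> f ` comp_pow W m \<subseteq> V1"
      using Suc.IH[OF V1(1,2)] by blast
    have "comp_pow W (Suc m) \<subseteq> orth A \<and> f ` comp_pow W (Suc m) \<subseteq> U"
      if W: "W \<subseteq> orth A" "f ` W \<subseteq> V1 \<inter> V2" for W
    proof -
      have IH: "comp_pow W m \<subseteq> orth A" "f ` comp_pow W m \<subseteq> V1" using V2(3) W by auto
      have "R \<in> orth A \<and> f R \<in> U" if R: "R \<in> comp_pow W (Suc m)" for R
      proof -
        obtain R1 R2 where R12: "R = R1 \<circ> R2" "R1 \<in> W" "R2 \<in> comp_pow W m" using R by auto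
        then have o: "R1 \<in> orth A" "R2 \<in> orth A" using W(1) IH(1) by auto
        have "f R1 \<in> V1" "f R2 \<in> V1" using R12 W(2) IH(2) by auto
        then show ?thesis unfolding R12(1) hom[OF o] using V1(3) orth_comp[OF o] by blast
      qed
      then show ?thesis by blast
    qed
    moreover have "openin S (V1 \<inter> V2)" "\<one>\<^bsub>H\<^esub> \<in> V1 \<inter> V2" using V1 V2 by auto
    ultimately show ?case by blast
  qed
  have "\<forall>\<^sub>F n in sequentially. f (T n) \<in> U" if U: "openin S U" "\<one>\<^bsub>H\<^esub> \<in> U" for U
  proof -
    from power[OF U, of 168] obtain V where V: "openin S V" "\<one>\<^bsub>H\<^esub> \<in> V"
      and V_pow: "\<forall>W\<subseteq>orth A. f ` W \<subseteq> V \<longrightarrow> comp_pow W 168 \<subseteq> orth A \<and> f ` comp_pow W 168 \<subseteq> U"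
      by (elim exE conjE)
    obtain V1 where V1: "openin S V1" "\<one>\<^bsub>H\<^esub> \<in> V1" "\<forall>x\<in>V1. \<forall>y\<in>V1. x \<otimes>\<^bsub>H\<^esub> y \<in> V"
      using mult_neighbourhood[OF V(1,2)] by blast
    obtain V0 where V0: "openin S V0" "\<one>\<^bsub>H\<^esub> \<in> V0" "\<forall>x\<in>V0. x \<in> V1 \<and> inv\<^bsub>H\<^esub> x \<in> V1"
      using inv_neighbourhood[OF V1(1,2)] by blast
    obtain D where D: "countable D" "D \<subseteq> carrier H"
      "\<And>x. x \<in> carrier H \<Longrightarrow> \<exists>d\<in>D. inv\<^bsub>H\<^esub> x \<otimes>\<^bsub>H\<^esub> d \<in> V0"
      using dense_translate[OF sep V0(1,2)] by blast
    \<comment> \<open>Elements close to the same member d of the dense set are close to each other,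
      since d cancels in the middle.\<close>
    have V0V: "inv\<^bsub>H\<^esub> x \<otimes>\<^bsub>H\<^esub> y \<in> V"
      if "d \<in> D" "x \<in> carrier H" "y \<in> carrier H" "inv\<^bsub>H\<^esub> x \<otimes>\<^bsub>H\<^esub> d \<in> V0" "inv\<^bsub>H\<^esub> y \<otimes>\<^bsub>H\<^esub> d \<in> V0" for d x y
    proof -
      have d: "d \<in> carrier H" using D(2) that(1) by blast
      have "inv\<^bsub>H\<^esub> (inv\<^bsub>H\<^esub> y \<otimes>\<^bsub>H\<^esub> d) = inv\<^bsub>H\<^esub> d \<otimes>\<^bsub>H\<^esub> y" using d that by (simp add: inv_mult_group)
      then have "(inv\<^bsub>H\<^esub> x \<otimes>\<^bsub>H\<^esub> d) \<otimes>\<^bsub>H\<^esub> (inv\<^bsub>H\<^esub> d \<otimes>\<^bsub>H\<^esub> y) \<in> V"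
        using V0(3) V1(3) that(4,5) by metis
      moreover have "(inv\<^bsub>H\<^esub> x \<otimes>\<^bsub>H\<^esub> d) \<otimes>\<^bsub>H\<^esub> (inv\<^bsub>H\<^esub> d \<otimes>\<^bsub>H\<^esub> y) = inv\<^bsub>H\<^esub> x \<otimes>\<^bsub>H\<^esub> y"
      proof -
        have "d \<otimes>\<^bsub>H\<^esub> (inv\<^bsub>H\<^esub> d \<otimes>\<^bsub>H\<^esub> y) = y" using d that(3) by (simp add: m_assoc[symmetric])
        then show ?thesis using d that(2,3) by (simp add: m_assoc)
      qed
      ultimately show ?thesis by simp
    qed
    \<comment> \<open>Asking the same of the inverse makes W symmetric.\<close>
    define W where "W = {T \<in> orth A. f T \<in> V \<and> f (adj T) \<in> V}"
    define P where "P d T \<longleftrightarrow> T \<in> orth A \<and> inv\<^bsub>H\<^esub> (f T) \<otimes>\<^bsub>H\<^esub> d \<in> V0" for d T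
    \<comment> \<open>One operator is chosen for each member of D that the image of some operator
      comes close to; the default \<open>id\<close> keeps g inside the group.\<close>
    define g where "g n = (let d = from_nat_into D n in if \<exists>T. P d T then SOME T. P d T else id)" for n
    have g_orth: "g n \<in> orth A" for n
    proof (cases "\<exists>T. P (from_nat_into D n) T")
      case True
      then have "P (from_nat_into D n) (g n)"
        unfolding g_def Let_def if_P[OF True] by (rule someI_ex)
      then show ?thesis by (simp add: P_def)
    next
      case False
      then show ?thesis using orth_id by (simp only: g_def Let_def if_False)
    qed
    interpret W: syndetic e A W g
    proof unfold_locales
      show "infinite A" by (rule A)
      show "W \<subseteq> orth A" by (auto simp: W_def)
      show "adj T \<in> W" if "T \<in> W" for T
        using that orth_inv orth_inv_inv by (auto simp: W_def)
      show "g n \<in> orth A" for n by (rule g_orth)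
      fix T assume T: "T \<in> orth A"
      obtain d where d: "d \<in> D" "P d T" using D(3)[OF fH[OF T]] T by (auto simp: P_def)
      obtain n where n: "from_nat_into D n = d" using from_nat_into_surj[OF D(1) d(1)] by blast
      have "P d (g n)" using someI[of "P d", OF d(2)] d(2) by (auto simp: g_def n Let_def)
      then have "inv\<^bsub>H\<^esub> (f (g n)) \<otimes>\<^bsub>H\<^esub> f T \<in> V" "inv\<^bsub>H\<^esub> (f T) \<otimes>\<^bsub>H\<^esub> f (g n) \<in> V"
        using V0V[OF d(1) fH[OF g_orth] fH[OF T]] V0V[OF d(1) fH[OF T] fH[OF g_orth]] d(2)
        by (auto simp: P_def)
      moreover have "adj (adj (g n) \<circ> T) = adj T \<circ> g n"
        using adj_comp[OF orth_inv[OF g_orth] T] orth_inv_inv[OF g_orth] by simp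
      ultimately have "adj (g n) \<circ> T \<in> W"
        using orth_comp[OF orth_inv[OF g_orth] T]
        by (simp add: W_def hom[OF orth_inv[OF g_orth] T] hom[OF orth_inv[OF T] g_orth]
            f_adj[OF T] f_adj[OF g_orth])
      then show "\<exists>n. adj (g n) \<circ> T \<in> W" ..
    qed
    obtain F \<epsilon> where F: "finite F" "\<epsilon> > 0"
      "\<And>T. T \<in> orth A \<Longrightarrow> (\<And>i. i \<in> F \<Longrightarrow> norm (T (e i) - e i) < \<epsilon>) \<Longrightarrow> T \<in> comp_pow W 168"
      using W.neighbourhood_in_V by metis
    have "\<forall>\<^sub>F n in sequentially. \<forall>i\<in>F. norm (T n (e i) - e i) < \<epsilon>"
      using T(2) F(2)
        by (intro eventually_ball_finite F(1) ballI) (auto simp: tendsto_iff dist_norm)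
    then show ?thesis
    proof (rule eventually_mono)
      fix n assume "\<forall>i\<in>F. norm (T n (e i) - e i) < \<epsilon>"
      then have "T n \<in> comp_pow W 168" by (intro F(3) T(1)) blast
      moreover have "W \<subseteq> orth A" "f ` W \<subseteq> V" by (auto simp: W_def)
      then have "f ` comp_pow W 168 \<subseteq> U" using V_pow by simp
      ultimately show "f (T n) \<in> U" by blast
    qed
  qed
  then show ?thesis by (simp add: limitin_def topspace_eq)
qed

end

section \<open>Isometry groups of metric spaces\<close>

context Metric_space begin

abbreviation "Isom \<equiv> isom_group M d"
abbreviation "IsomT \<equiv> pointwise_topology M d"

lemma Isom_group: "group Isom"
  by (rule isom_group_group)

lemma topspace_IsomT: "topspace IsomT = carrier Isom"
  by (rule topspace_pointwise_topology) (rule Metric_space_axioms)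

lemma Isom_iff:
  "g \<in> carrier Isom \<longleftrightarrow> g \<in> extensional M \<and> bij_betw g M M \<and> (\<forall>x\<in>M. \<forall>y\<in>M. d (g x) (g y) = d x y)"
  by (auto simp: isom_group_def Bij_def)

lemma Isom_in: "g \<in> carrier Isom \<Longrightarrow> x \<in> M \<Longrightarrow> g x \<in> M"
  by (auto simp: Isom_iff bij_betw_def)

lemma Isom_d: "g \<in> carrier Isom \<Longrightarrow> x \<in> M \<Longrightarrow> y \<in> M \<Longrightarrow> d (g x) (g y) = d x y"
  by (auto simp: Isom_iff)

lemma Isom_mult: "g \<in> carrier Isom \<Longrightarrow> h \<in> carrier Isom \<Longrightarrow> x \<in> M \<Longrightarrow> (g \<otimes>\<^bsub>Isom\<^esub> h) x = g (h x)"
  by (simp add: isom_group_def BijGroup_def compose_def)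

lemma Isom_one: "\<one>\<^bsub>Isom\<^esub> = (\<lambda>x\<in>M. x)"
  by (simp add: isom_group_def BijGroup_def)

lemma Isom_inv:
  assumes g: "g \<in> carrier Isom" and x: "x \<in> M"
  shows "(inv\<^bsub>Isom\<^esub> g) (g x) = x" "g ((inv\<^bsub>Isom\<^esub> g) x) = x"
proof -
  interpret group Isom by (rule Isom_group)
  have "inv\<^bsub>Isom\<^esub> g \<otimes>\<^bsub>Isom\<^esub> g = \<one>\<^bsub>Isom\<^esub>" "g \<otimes>\<^bsub>Isom\<^esub> inv\<^bsub>Isom\<^esub> g = \<one>\<^bsub>Isom\<^esub>"
    using g by simp_all
  then show "(inv\<^bsub>Isom\<^esub> g) (g x) = x" "g ((inv\<^bsub>Isom\<^esub> g) x) = x"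
    using Isom_mult[OF inv_closed[OF g] g x] Isom_mult[OF g inv_closed[OF g] x] x
    by (simp_all add: Isom_one)
qed

lemma Isom_eqI:
  assumes "g \<in> carrier Isom" "h \<in> carrier Isom" "\<And>x. x \<in> M \<Longrightarrow> g x = h x"
  shows "g = h"
  using assms by (intro extensionalityI[of _ M]) (auto simp: Isom_iff)

lemma openin_evaluation:
  assumes "x \<in> M"
  shows "openin IsomT {g \<in> carrier Isom. g x \<in> mball y r}"
  using openin_continuous_map_preimage[OF continuous_map_orbit[OF Metric_space_axioms assms] openin_mball]
  by (simp add: topspace_IsomT)

lemma IsomT_neighbourhood:
  assumes U: "openin IsomT U" and g: "g \<in> U"
  shows "\<exists>F r. finite F \<and> F \<subseteq> M \<and> r > 0 \<and> (\<forall>h\<in>carrier Isom. (\<forall>x\<in>F. d (g x) (h x) < r) \<longrightarrow> h \<in> U)"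
proof -
  obtain T where T: "openin (product_topology (\<lambda>_. mtopology) M) T" "U = T \<inter> carrier Isom"
    using U unfolding pointwise_topology_def openin_subtopology by blast
  have gG: "g \<in> T" "g \<in> carrier Isom" using g T by auto
  from iffD1[OF openin_product_topology_alt T(1), rule_format, OF gG(1)]
  obtain B where B: "finite {i \<in> M. B i \<noteq> topspace mtopology}" "\<And>i. i \<in> M \<Longrightarrow> openin mtopology (B i)"
    "g \<in> PiE M B" "PiE M B \<subseteq> T"
    by (elim exE conjE) simp
  define F where "F = {i \<in> M. B i \<noteq> topspace mtopology}"
  have "\<exists>r>0. mball (g x) r \<subseteq> B x" if "x \<in> F" for x
  proof -
    have "x \<in> M" using that by (simp add: F_def)
    then have "openin mtopology (B x)" "g x \<in> B x" using B(2,3) by (auto simp: PiE_def)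
    then show ?thesis by (auto simp: openin_mtopology)
  qed
  then have "\<forall>x\<in>F. \<exists>r>0. mball (g x) r \<subseteq> B x" ..
  from bchoice[OF this] obtain r where "\<forall>x\<in>F. r x > 0 \<and> mball (g x) (r x) \<subseteq> B x" ..
  then have r: "r x > 0" "mball (g x) (r x) \<subseteq> B x" if "x \<in> F" for x using that by blast+
  define q where "q = Min (insert 1 (r ` F))"
  have fin: "finite F" using B(1) by (simp add: F_def)
  have q: "q > 0" "\<And>x. x \<in> F \<Longrightarrow> q \<le> r x" using fin r(1) by (auto simp: q_def)
  have "h \<in> U" if h: "h \<in> carrier Isom" "\<forall>x\<in>F. d (g x) (h x) < q" for h
  proof -
    have "h x \<in> B x" if x: "x \<in> M" for x
    proof (cases "x \<in> F")
      case True
      have "h x \<in> mball (g x) (r x)"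
        using Isom_in[OF h(1) x] Isom_in[OF gG(2) x] bspec[OF h(2) True] q(2)[OF True] by simp
      then show ?thesis using r(2)[OF True] by blast
    next
      case False
      then have "B x = M" using x by (simp add: F_def)
      then show ?thesis using Isom_in[OF h(1) x] by simp
    qed
    then have "h \<in> PiE M B" using h(1) by (auto simp: PiE_def Isom_iff)
    then show ?thesis using B(4) T(2) h(1) by blast
  qed
  then show ?thesis
    using fin q(1) by (intro exI[of _ F] exI[of _ q]) (auto simp: F_def)
qed

lemma IsomT_continuous_mapI:
  assumes "\<And>p. p \<in> topspace Y \<Longrightarrow> f p \<in> carrier Isom"
    and "\<And>p x r. p \<in> topspace Y \<Longrightarrow> x \<in> M \<Longrightarrow> r > 0 \<Longrightarrow>
      \<exists>U. openin Y U \<and> p \<in> U \<and> (\<forall>q\<in>U. d (f p x) (f q x) < r)"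
  shows "continuous_map Y IsomT f"
proof -
  have "continuous_map Y mtopology (\<lambda>p. f p x)" if x: "x \<in> M" for x
    unfolding continuous_map_to_metric
  proof (intro ballI allI impI)
    fix p and r :: real assume p: "p \<in> topspace Y" and r: "0 < r"
    obtain U where U: "openin Y U" "p \<in> U" "\<forall>q\<in>U. d (f p x) (f q x) < r"
      using assms(2)[OF p x r] by blast
    have "f q x \<in> mball (f p x) r" if "q \<in> U" for q
    proof -
      have "q \<in> topspace Y" using that openin_subset[OF U(1)] by (rule rev_subsetD)
      then show ?thesis using U(3) that Isom_in[OF assms(1) x] p by simp
    qed
    then show "\<exists>U. openin Y U \<and> p \<in> U \<and> (\<forall>y\<in>U. f y x \<in> mball (f p x) r)" using U by blast
  qed
  moreover have "f p \<in> extensional M" "f p \<in> carrier Isom" if "p \<in> topspace Y" for p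
    using assms(1)[OF that] by (simp_all add: Isom_iff)
  then have "f ` topspace Y \<subseteq> extensional M" "f ` topspace Y \<subseteq> carrier Isom" by blast+
  ultimately show ?thesis
    unfolding pointwise_topology_def continuous_map_in_subtopology continuous_map_componentwise
    by auto
qed

text \<open>An isometry g' does not enlarge the error of h' at x, so a product is controlled by
  evaluating g' at h x and h' at x. For inverses, d (g^-1 x) (h^-1 x) = d (h y) (g y) with y = g^-1
  x.\<close>

lemma Isom_topological_group: "topological_group Isom IsomT"
proof -
  interpret group Isom by (rule Isom_group)
  have "continuous_map (prod_topology IsomT IsomT) IsomT (\<lambda>(g, h). g \<otimes>\<^bsub>Isom\<^esub> h)"
  proof (rule IsomT_continuous_mapI)
    fix p assume "p \<in> topspace (prod_topology IsomT IsomT)"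
    then show "(case p of (g, h) \<Rightarrow> g \<otimes>\<^bsub>Isom\<^esub> h) \<in> carrier Isom" by (auto simp: topspace_IsomT)
  next
    fix p x and r :: real
    assume "p \<in> topspace (prod_topology IsomT IsomT)" and x: "x \<in> M" and r: "r > 0"
    then obtain g h where p: "p = (g, h)" "g \<in> carrier Isom" "h \<in> carrier Isom"
      by (auto simp: topspace_IsomT)
    have hx: "h x \<in> M" "g (h x) \<in> M" using p x by (simp_all add: Isom_in)
    let ?U = "{g' \<in> carrier Isom. g' (h x) \<in> mball (g (h x)) (r / 2)}"
    let ?V = "{h' \<in> carrier Isom. h' x \<in> mball (h x) (r / 2)}"
    have "d (g (h x)) (g' (h' x)) < r" if "g' \<in> ?U" "h' \<in> ?V" for g' h'
    proof -
      have gh: "g' \<in> carrier Isom" "h' x \<in> M" using that by auto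
      have "d (g' (h x)) (g' (h' x)) < r / 2" using Isom_d[OF gh(1) hx(1) gh(2)] that by simp
      moreover have "d (g (h x)) (g' (h x)) < r / 2" using that by simp
      moreover have "d (g (h x)) (g' (h' x)) \<le> d (g (h x)) (g' (h x)) + d (g' (h x)) (g' (h' x))"
        by (rule triangle) (use hx gh in \<open>auto simp: Isom_in\<close>)
      ultimately show ?thesis by simp
    qed
    then have "\<forall>q\<in>?U \<times> ?V. d ((case p of (g, h) \<Rightarrow> g \<otimes>\<^bsub>Isom\<^esub> h) x) ((case q of (g, h) \<Rightarrow> g \<otimes>\<^bsub>Isom\<^esub> h) x) < r"
      using p x by (auto simp: Isom_mult)
    moreover have "openin (prod_topology IsomT IsomT) (?U \<times> ?V)"
      by (intro openin_prod_Times_iff[THEN iffD2] disjI2 conjI openin_evaluation hx x)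
    moreover have "p \<in> ?U \<times> ?V" using p r hx by simp
    ultimately show "\<exists>U. openin (prod_topology IsomT IsomT) U \<and> p \<in> U \<and>
        (\<forall>q\<in>U. d ((case p of (g, h) \<Rightarrow> g \<otimes>\<^bsub>Isom\<^esub> h) x) ((case q of (g, h) \<Rightarrow> g \<otimes>\<^bsub>Isom\<^esub> h) x) < r)"
      by blast
  qed
  moreover have "continuous_map IsomT IsomT (\<lambda>g. inv\<^bsub>Isom\<^esub> g)"
  proof (rule IsomT_continuous_mapI)
    fix g x and r :: real assume g': "g \<in> topspace IsomT" and x: "x \<in> M" and r: "r > 0"
    have g: "g \<in> carrier Isom" using g' by (simp add: topspace_IsomT)
    define y where "y = (inv\<^bsub>Isom\<^esub> g) x"
    have y: "y \<in> M" "g y = x" using g x by (simp_all add: y_def Isom_in Isom_inv)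
    let ?U = "{h \<in> carrier Isom. h y \<in> mball (g y) r}"
    have "d ((inv\<^bsub>Isom\<^esub> g) x) ((inv\<^bsub>Isom\<^esub> h) x) < r" if "h \<in> ?U" for h
    proof -
      have h: "h \<in> carrier Isom" "(inv\<^bsub>Isom\<^esub> h) x \<in> M" using that x by (auto simp: Isom_in)
      have "d y ((inv\<^bsub>Isom\<^esub> h) x) = d (h y) (h ((inv\<^bsub>Isom\<^esub> h) x))"
        using Isom_d[OF h(1) y(1) h(2)] by simp
      also have "\<dots> = d (h y) (g y)" using h x y by (simp add: Isom_inv)
      also have "\<dots> < r" using that by (simp add: commute)
      finally show ?thesis by (simp add: y_def)
    qed
    moreover have "openin IsomT ?U" by (rule openin_evaluation[OF y(1)])
    moreover have "g \<in> ?U" using y g r x by simp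
    ultimately show "\<exists>U. openin IsomT U \<and> g \<in> U \<and> (\<forall>h\<in>U. d ((inv\<^bsub>Isom\<^esub> g) x) ((inv\<^bsub>Isom\<^esub> h) x) < r)"
      by blast
  qed (simp add: topspace_IsomT)
  ultimately show ?thesis
    unfolding topological_group_def using Isom_group topspace_IsomT by blast
qed

text \<open>A table lists finitely many points of D with approximate images in D, together with a
  tolerance. There are countably many tables, and one isometry is picked for each table that some
  isometry fits.\<close>

lemma IsomT_separable:
  assumes D: "countable D" "D \<subseteq> M" "\<And>x r. x \<in> M \<Longrightarrow> r > 0 \<Longrightarrow> \<exists>q\<in>D. d x q < r"
  shows "separable_space IsomT"
proof -
  define P where "P l g \<longleftrightarrow> g \<in> carrier Isom \<and>
    (\<forall>p\<in>set (fst l). d (g (fst p)) (snd p) < inverse (real (Suc (snd l))))" for l g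
  define pick where "pick l = (SOME g. P l g)" for l
  define I where "I = {l \<in> lists (D \<times> D) \<times> (UNIV :: nat set). \<exists>g. P l g}"
  have pick: "P l (pick l)" if "l \<in> I" for l
  proof -
    have "\<exists>g. P l g" using that by (simp add: I_def)
    then show ?thesis unfolding pick_def by (rule someI_ex)
  qed
  have "countable I"
  proof (rule countable_subset)
    show "I \<subseteq> lists (D \<times> D) \<times> (UNIV :: nat set)" by (auto simp: I_def)
    show "countable (lists (D \<times> D) \<times> (UNIV :: nat set))"
      using D(1) by (intro countable_SIGMA countable_lists) auto
  qed
  then have "countable (pick ` I)" by simp
  moreover have "pick ` I \<subseteq> carrier Isom" using pick by (auto simp: P_def)
  moreover have "carrier Isom \<subseteq> IsomT closure_of (pick ` I)"
  proof
    fix g assume g: "g \<in> carrier Isom"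
    have "\<exists>h\<in>pick ` I. h \<in> U" if U: "g \<in> U" "openin IsomT U" for U
    proof -
      obtain F r where F: "finite F" "F \<subseteq> M" "r > 0"
        "\<And>h. h \<in> carrier Isom \<Longrightarrow> (\<forall>x\<in>F. d (g x) (h x) < r) \<Longrightarrow> h \<in> U"
        using IsomT_neighbourhood[OF U(2,1)] by metis
      \<comment> \<open>Four distances below 1 / (n + 1) add up when g and the picked isometry are
        compared at a point.\<close>
      obtain n where n: "inverse (real (Suc n)) < r / 4"
        using reals_Archimedean[of "r / 4"] F(3) by auto
      let ?s = "inverse (real (Suc n))"
      have s: "?s > 0" by simp
      have "\<exists>q. q \<in> D \<and> d x q < ?s" if "x \<in> F" for x using D(3)[of x ?s] that F(2) s by blast
      then obtain q where q: "\<And>x. x \<in> F \<Longrightarrow> q x \<in> D \<and> d x (q x) < ?s" by metis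
      have "\<exists>y. y \<in> D \<and> d (g (q x)) y < ?s" if "x \<in> F" for x
        using D(3)[of "g (q x)" ?s] that q[OF that] s D(2) Isom_in[OF g] by blast
      then obtain y where y: "\<And>x. x \<in> F \<Longrightarrow> y x \<in> D \<and> d (g (q x)) (y x) < ?s" by metis
      obtain xs where xs: "set xs = F" using F(1) finite_list by blast
      define l where "l = (map (\<lambda>x. (q x, y x)) xs, n)"
      have "P l g" using g y by (auto simp: P_def l_def xs)
      moreover have "fst l \<in> lists (D \<times> D)" using q y by (auto simp: l_def xs)
      ultimately have lI: "l \<in> I" by (auto simp: I_def l_def)
      let ?h = "pick l"
      have h: "?h \<in> carrier Isom" "\<And>x. x \<in> F \<Longrightarrow> d (?h (q x)) (y x) < ?s"
        using pick[OF lI] by (auto simp: P_def l_def xs)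
      have "d (g x) (?h x) < r" if x: "x \<in> F" for x
      proof -
        have m: "x \<in> M" "q x \<in> M" "y x \<in> M" "g x \<in> M" "g (q x) \<in> M" "?h x \<in> M" "?h (q x) \<in> M"
          using x F(2) q[OF x] y[OF x] D(2) Isom_in[OF g] Isom_in[OF h(1)] by auto
        have "d (g x) (?h x) \<le> d (g x) (g (q x)) + d (g (q x)) (?h x)"
          by (rule triangle) (use m in auto)
        also have "d (g (q x)) (?h x) \<le> d (g (q x)) (y x) + d (y x) (?h x)"
          by (rule triangle) (use m in auto)
        also have "d (y x) (?h x) \<le> d (y x) (?h (q x)) + d (?h (q x)) (?h x)"
          by (rule triangle) (use m in auto)
        finally have "d (g x) (?h x) \<le> d x (q x) + d (g (q x)) (y x) + d (?h (q x)) (y x) + d x (q x)"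
          using Isom_d[OF g m(1,2)] Isom_d[OF h(1) m(2,1)] by (simp add: commute)
        then show ?thesis using q[OF x] y[OF x] h(2)[OF x] n by linarith
      qed
      then have "?h \<in> U" using F(4)[OF h(1)] by blast
      then show ?thesis using lI by blast
    qed
    then show "g \<in> IsomT closure_of (pick ` I)"
      using g by (auto simp: in_closure_of topspace_IsomT)
  qed
  then have "IsomT closure_of (pick ` I) = topspace IsomT"
    unfolding topspace_IsomT[symmetric] by (intro subset_antisym closure_of_subset_topspace)
  ultimately show ?thesis unfolding separable_space_def topspace_IsomT by blast
qed

section \<open>Complete metrizability of the isometry group\<close>

lemma d_diff_le:
  assumes "u \<in> M" "v \<in> M" "u' \<in> M" "v' \<in> M"
  shows "\<bar>d u v - d u' v'\<bar> \<le> d u u' + d v v'"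
proof -
  have "d u v \<le> d u u' + d u' v" "d u' v \<le> d u' v' + d v' v"
    "d u' v' \<le> d u' u + d u v'" "d u v' \<le> d u v + d v v'"
    using assms by (auto intro: triangle)
  then show ?thesis by (simp add: commute)
qed

text \<open>The image of x is the limit of p along points of D tending to x. It is described by its
  distances to the p q, which pass to the limit directly and later yield the isometry property by
  approximation.\<close>

lemma isometric_extension:
  assumes comp: "mcomplete" and D: "D \<subseteq> M" "\<And>x r. x \<in> M \<Longrightarrow> r > 0 \<Longrightarrow> \<exists>q\<in>D. d x q < r"
    and p: "\<And>q. q \<in> D \<Longrightarrow> p q \<in> M" "\<And>q q'. q \<in> D \<Longrightarrow> q' \<in> D \<Longrightarrow> d (p q) (p q') = d q q'"
  shows "\<exists>a. \<forall>x\<in>M. a x \<in> M \<and> (\<forall>q\<in>D. d (a x) (p q) = d x q)"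
proof -
  have "\<exists>y. y \<in> M \<and> (\<forall>q\<in>D. d y (p q) = d x q)" if x: "x \<in> M" for x
  proof -
    have "\<forall>n. \<exists>q. q \<in> D \<and> d x q < inverse (real (Suc n))"
      using D(2)[OF x, of "inverse (real (Suc _))"]
        by (meson inverse_positive_iff_positive of_nat_0_less_iff zero_less_Suc)
    from choice[OF this] obtain s where s': "\<forall>n. s n \<in> D \<and> d x (s n) < inverse (real (Suc n))" ..
    have s: "s n \<in> D" "s n \<in> M" "d x (s n) < inverse (real (Suc n))" for n using s' D(1) by blast+
    have small: "\<exists>N. \<forall>n\<ge>N. d x (s n) < r" if r: "r > 0" for r
    proof -
      obtain N where N: "inverse (real (Suc N)) < r" using reals_Archimedean[OF r] by blast
      have "d x (s n) < r" if "n \<ge> N" for n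
      proof -
        have "inverse (real (Suc n)) \<le> inverse (real (Suc N))" using that by (simp add: field_simps)
        then show ?thesis using s(3)[of n] N by linarith
      qed
      then show ?thesis by blast
    qed
    have "MCauchy (\<lambda>n. p (s n))"
      unfolding MCauchy_def
    proof (intro conjI allI impI)
      show "range (\<lambda>n. p (s n)) \<subseteq> M" using p(1) s(1) by blast
      fix r :: real assume r: "r > 0"
      obtain N where N: "\<And>n. n \<ge> N \<Longrightarrow> d x (s n) < r / 2" using small[of "r / 2"] r by auto
      have "d (p (s m)) (p (s n)) < r" if "N \<le> m" "N \<le> n" for m n
      proof -
        have "d (s m) (s n) \<le> d (s m) x + d x (s n)" by (rule triangle[OF s(2) x s(2)])
        then show ?thesis using N[OF that(1)] N[OF that(2)] p(2)[OF s(1) s(1)]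
          by (simp add: commute)
      qed
      then show "\<exists>N. \<forall>m n. N \<le> m \<longrightarrow> N \<le> n \<longrightarrow> d (p (s m)) (p (s n)) < r" by blast
    qed
    then obtain y where y: "limitin mtopology (\<lambda>n. p (s n)) y sequentially"
      using comp unfolding mcomplete_def by blast
    then have yM: "y \<in> M" using limitin_mspace by blast
    have "d y (p q) = d x q" if q: "q \<in> D" for q
    proof -
      have "\<bar>d y (p q) - d x q\<bar> \<le> 0 + r" if r: "r > 0" for r
      proof -
        obtain N1 where N1: "\<And>n. n \<ge> N1 \<Longrightarrow> d x (s n) < r / 2" using small[of "r / 2"] r by auto
        have "\<forall>\<^sub>F n in sequentially. p (s n) \<in> M \<and> d (p (s n)) y < r / 2"
          using y r half_gt_zero[OF r] unfolding limitin_metric by blast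
        then obtain N2 where N2: "\<And>n. n \<ge> N2 \<Longrightarrow> d (p (s n)) y < r / 2"
          unfolding eventually_sequentially by blast
        define n where "n = max N1 N2"
        have n: "d x (s n) < r / 2" "d (p (s n)) y < r / 2" using N1 N2 by (simp_all add: n_def)
        have m: "p (s n) \<in> M" "p q \<in> M" "q \<in> M" using p(1) s(1) q D(1) by auto
        have "\<bar>d y (p q) - d (p (s n)) (p q)\<bar> \<le> d y (p (s n)) + d (p q) (p q)"
          by (rule d_diff_le[OF yM m(2) m(1) m(2)])
        moreover have "\<bar>d x q - d (s n) q\<bar> \<le> d x (s n) + d q q"
          by (rule d_diff_le[OF x m(3) s(2) m(3)])
        ultimately show ?thesis using n p(2)[OF s(1) q] m by (simp add: commute abs_le_iff)
      qed
      then have "\<bar>d y (p q) - d x q\<bar> \<le> 0" by (rule field_le_epsilon)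
      then show ?thesis by simp
    qed
    then show ?thesis using yM by blast
  qed
  then have "\<forall>x\<in>M. \<exists>y. y \<in> M \<and> (\<forall>q\<in>D. d y (p q) = d x q)" by blast
  from bchoice[OF this] show ?thesis .
qed

text \<open>
  An isometry is recorded by its restriction to a dense set together with that of its inverse;
  the identity \<open>d (g x) y = d x (inv g y)\<close> makes the set of such records closed.
\<close>

lemma IsomT_completely_metrizable:
  assumes comp: "mcomplete" and D: "countable D" "D \<subseteq> M"
    and dense: "\<And>x r. x \<in> M \<Longrightarrow> r > 0 \<Longrightarrow> \<exists>q\<in>D. d x q < r"
  shows "completely_metrizable_space IsomT"
proof -
  interpret G: group Isom by (rule Isom_group)
  \<comment> \<open>Label \<open>True\<close> records the isometry and \<open>False\<close> its
    inverse.\<close>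
  let ?I = "D \<times> (UNIV :: bool set)"
  let ?Y = "product_topology (\<lambda>_. mtopology) ?I"
  have "countable ?I" using D(1) by simp
  then have "countable {i \<in> ?I. \<not> (\<exists>a. topspace mtopology \<subseteq> {a})}"
    by (rule countable_subset[rotated]) blast
  then have cY: "completely_metrizable_space ?Y"
    unfolding completely_metrizable_space_product_topology
    using completely_metrizable_space_mtopology[OF comp] by blast
  define \<Phi> where "\<Phi> g = (\<lambda>i\<in>?I. if snd i then g (fst i) else (inv\<^bsub>Isom\<^esub> g) (fst i))" for g
  have \<Phi>: "\<Phi> g (x, True) = g x" "\<Phi> g (x, False) = (inv\<^bsub>Isom\<^esub> g) x" if "x \<in> D" for g x
    using that by (simp_all add: \<Phi>_def)
  have DM: "x \<in> M" if "x \<in> D" for x using that D(2) by blast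
  let ?S = "\<Phi> ` carrier Isom"
  have SY: "?S \<subseteq> topspace ?Y"
  proof
    fix p assume "p \<in> ?S"
    then obtain g where g: "g \<in> carrier Isom" "p = \<Phi> g" by blast
    have "\<Phi> g i \<in> M" if "i \<in> ?I" for i
      using that DM Isom_in[OF g(1), of "fst i"] Isom_in[OF G.inv_closed[OF g(1)], of "fst i"]
      by (auto simp: \<Phi>_def)
    moreover have "\<Phi> g \<in> extensional ?I" by (simp add: \<Phi>_def)
    ultimately show "p \<in> topspace ?Y" by (simp add: g(2) PiE_iff)
  qed
  have zero: "a = b" if "\<And>r. r > 0 \<Longrightarrow> \<bar>a - b\<bar> \<le> r" for a b :: real
  proof -
    have "\<bar>a - b\<bar> \<le> 0 + r" if "r > 0" for r using \<open>\<And>r. r > 0 \<Longrightarrow> \<bar>a - b\<bar> \<le> r\<close>[OF that] by simp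
    then have "\<bar>a - b\<bar> \<le> 0" by (rule field_le_epsilon)
    then show ?thesis by simp
  qed
  have adjoint: "d (g x) y = d x ((inv\<^bsub>Isom\<^esub> g) y)" if "g \<in> carrier Isom" "x \<in> M" "y \<in> M" for g x y
    using Isom_d[OF that(1,2), of "(inv\<^bsub>Isom\<^esub> g) y"] Isom_inv(2)[OF that(1,3)]
      Isom_in[OF G.inv_closed[OF that(1)] that(3)] by simp
  have "?Y closure_of ?S \<subseteq> ?S"
  proof
    fix p assume p: "p \<in> ?Y closure_of ?S"
    then have pY: "p \<in> topspace ?Y" and
      meets: "\<And>U. p \<in> U \<Longrightarrow> openin ?Y U \<Longrightarrow> \<exists>q\<in>?S. q \<in> U" by (auto simp: in_closure_of)
    have pM: "p i \<in> M" if "i \<in> ?I" for i using pY that by (auto simp: PiE_iff)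
    have near: "\<exists>g\<in>carrier Isom. d (p i) (\<Phi> g i) < r \<and> d (p j) (\<Phi> g j) < r"
      if i: "i \<in> ?I" and j: "j \<in> ?I" and r: "r > 0" for i j r
    proof -
      let ?U = "{q \<in> topspace ?Y. q i \<in> mball (p i) r} \<inter> {q \<in> topspace ?Y. q j \<in> mball (p j) r}"
      have "openin ?Y ?U"
        using i j by (intro openin_Int openin_continuous_map_preimage[OF _ openin_mball]
            continuous_map_product_projection)
      moreover have "p \<in> ?U" using pY pM[OF i] pM[OF j] r by simp
      ultimately have "\<exists>q\<in>?S. q \<in> ?U" by (intro meets)
      then obtain g where "g \<in> carrier Isom" "\<Phi> g \<in> ?U" by blast
      then show ?thesis by (intro bexI[of _ g]) simp_all
    qed
    have isoT: "d (p (x, b)) (p (y, b)) = d x y" if x: "x \<in> D" and y: "y \<in> D" for x y b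
    proof (rule zero)
      fix r :: real assume "r > 0"
      then obtain g where g: "g \<in> carrier Isom" "d (p (x, b)) (\<Phi> g (x, b)) < r / 2"
        "d (p (y, b)) (\<Phi> g (y, b)) < r / 2" using near[of "(x, b)" "(y, b)" "r / 2"] x y by auto
      have m: "\<Phi> g (x, b) \<in> M" "\<Phi> g (y, b) \<in> M"
        using x y DM Isom_in[OF g(1)] Isom_in[OF G.inv_closed[OF g(1)]] by (simp_all add: \<Phi>_def)
      have "d (\<Phi> g (x, b)) (\<Phi> g (y, b)) = d x y"
        using x y DM Isom_d[OF g(1)] Isom_d[OF G.inv_closed[OF g(1)]] by (simp add: \<Phi>_def)
      then show "\<bar>d (p (x, b)) (p (y, b)) - d x y\<bar> \<le> r"
        using d_diff_le[OF pM pM m, of "(x, b)" "(y, b)"] x y g by simp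
    qed
    \<comment> \<open>A pointwise limit of surjective isometries need not be surjective. This
      relation survives the limit and makes the limit of the inverses an inverse of the
      limit.\<close>
    have adj: "d (p (x, True)) y = d x (p (y, False))" if x: "x \<in> D" and y: "y \<in> D" for x y
    proof (rule zero)
      fix r :: real assume "r > 0"
      then obtain g where g: "g \<in> carrier Isom" "d (p (x, True)) (g x) < r / 2"
        "d (p (y, False)) ((inv\<^bsub>Isom\<^esub> g) y) < r / 2"
        using near[of "(x, True)" "(y, False)" "r / 2"] x y by (auto simp: \<Phi>)
      have m: "p (x, True) \<in> M" "p (y, False) \<in> M" "x \<in> M" "y \<in> M" using pM x y DM by auto
      have "\<bar>d (p (x, True)) y - d (g x) y\<bar> \<le> d (p (x, True)) (g x) + d y y"
        by (rule d_diff_le[OF m(1,4) Isom_in[OF g(1) m(3)] m(4)])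
      moreover have "\<bar>d x (p (y, False)) - d x ((inv\<^bsub>Isom\<^esub> g) y)\<bar> \<le>
          d x x + d (p (y, False)) ((inv\<^bsub>Isom\<^esub> g) y)"
        by (rule d_diff_le[OF m(3,2,3) Isom_in[OF G.inv_closed[OF g(1)] m(4)]])
      ultimately show "\<bar>d (p (x, True)) y - d x (p (y, False))\<bar> \<le> r"
        using adjoint[OF g(1) m(3,4)] g m by (simp add: abs_le_iff)
    qed
    have ext: "\<exists>a. \<forall>x\<in>M. a x \<in> M \<and> (\<forall>q\<in>D. d (a x) (p (q, b)) = d x q)" for b
      by (rule isometric_extension[OF comp D(2) dense]) (simp_all add: pM isoT)
    obtain a where "\<forall>x\<in>M. a x \<in> M \<and> (\<forall>q\<in>D. d (a x) (p (q, True)) = d x q)" using ext[of True] ..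
    then have a: "\<And>x. x \<in> M \<Longrightarrow> a x \<in> M"
      "\<And>x q. x \<in> M \<Longrightarrow> q \<in> D \<Longrightarrow> d (a x) (p (q, True)) = d x q" by simp_all
    obtain b where "\<forall>x\<in>M. b x \<in> M \<and> (\<forall>q\<in>D. d (b x) (p (q, False)) = d x q)" using ext[of False] ..
    then have b: "\<And>x. x \<in> M \<Longrightarrow> b x \<in> M"
      "\<And>x q. x \<in> M \<Longrightarrow> q \<in> D \<Longrightarrow> d (b x) (p (q, False)) = d x q" by simp_all
    have iso: "d (c x) (c y) = d x y"
      if c: "\<And>x. x \<in> M \<Longrightarrow> c x \<in> M" "\<And>x q. x \<in> M \<Longrightarrow> q \<in> D \<Longrightarrow> d (c x) (p (q, t)) = d x q"
        and x: "x \<in> M" and y: "y \<in> M" for c t x y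
    proof (rule zero)
      fix r :: real assume "r > 0"
      then obtain q q' where q: "q \<in> D" "d x q < r / 4" "q' \<in> D" "d y q' < r / 4"
        using dense[OF x, of "r / 4"] dense[OF y, of "r / 4"] by auto
      have "\<bar>d (c x) (c y) - d (p (q, t)) (p (q', t))\<bar> \<le> d (c x) (p (q, t)) + d (c y) (p (q', t))"
        by (intro d_diff_le c(1) x y pM SigmaI q UNIV_I)
      moreover have "\<bar>d x y - d q q'\<bar> \<le> d x q + d y q'" by (intro d_diff_le x y DM q)
      ultimately show "\<bar>d (c x) (c y) - d x y\<bar> \<le> r"
        using isoT[OF q(1,3)] c(2)[OF x q(1)] c(2)[OF y q(3)] q by (simp add: abs_le_iff)
    qed
    have ab: "d (a x) y = d x (b y)" if x: "x \<in> M" and y: "y \<in> M" for x y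
    proof (rule zero)
      fix r :: real assume "r > 0"
      then obtain q q' where q: "q \<in> D" "d x q < r / 4" "q' \<in> D" "d y q' < r / 4"
        using dense[OF x, of "r / 4"] dense[OF y, of "r / 4"] by auto
      have "\<bar>d (a x) y - d (p (q, True)) q'\<bar> \<le> d (a x) (p (q, True)) + d y q'"
        by (intro d_diff_le a(1) x y pM SigmaI q UNIV_I DM)
      moreover have "\<bar>d x (b y) - d q (p (q', False))\<bar> \<le> d x q + d (b y) (p (q', False))"
        by (intro d_diff_le b(1) x y pM SigmaI q UNIV_I DM)
      ultimately show "\<bar>d (a x) y - d x (b y)\<bar> \<le> r"
        using adj[OF q(1,3)] a(2)[OF x q(1)] b(2)[OF y q(3)] q by (simp add: abs_le_iff)
    qed
    \<comment> \<open>For y = a x the relation \<open>ab\<close> reads d (a x) (a x) = d x (b (a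
      x)).\<close>
    have ba: "b (a x) = x" if x: "x \<in> M" for x
      using ab[OF x a(1)[OF x]] a(1)[OF x] b(1)[OF a(1)[OF x]] x by simp
    have ab': "a (b y) = y" if y: "y \<in> M" for y
      using ab[OF b(1)[OF y] y] a(1)[OF b(1)[OF y]] b(1)[OF y] y by simp
    define g where "g = restrict a M"
    have "bij_betw g M M"
      by (rule bij_betwI[where g = b]) (use a b ba ab' in \<open>auto simp: g_def\<close>)
    then have g: "g \<in> carrier Isom"
      using iso[OF a] by (simp add: Isom_iff g_def)
    have "(inv\<^bsub>Isom\<^esub> g) x = b x" if x: "x \<in> M" for x
      using Isom_inv(1)[OF g b(1)[OF x]] x b(1)[OF x] ab'[OF x] by (simp add: g_def)
    moreover have "a x = p (x, True)" "b x = p (x, False)" if "x \<in> D" for x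
      using a(2)[OF DM[OF that] that] b(2)[OF DM[OF that] that] a(1)[OF DM[OF that]]
        b(1)[OF DM[OF that]] pM[of "(x, True)"] pM[of "(x, False)"] DM[OF that] that by simp_all
    ultimately have "\<Phi> g i = p i" if "i \<in> ?I" for i
      using that DM by (cases i) (simp add: \<Phi>_def g_def)
    moreover have "p \<in> extensional ?I" using pY by (simp add: PiE_def)
    ultimately have "\<Phi> g = p" by (intro extensionalityI[of _ ?I]) (simp_all add: \<Phi>_def)
    then show "p \<in> ?S" using g by blast
  qed
  then have "closedin ?Y ?S" using SY closure_of_subset_eq by blast
  then have cZ: "completely_metrizable_space (subtopology ?Y ?S)"
    by (rule completely_metrizable_space_closedin[OF cY])
  have inj: "inj_on \<Phi> (carrier Isom)"
  proof (rule inj_onI)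
    fix g h assume g: "g \<in> carrier Isom" and h: "h \<in> carrier Isom" and eq: "\<Phi> g = \<Phi> h"
    show "g = h"
    proof (rule Isom_eqI[OF g h])
      fix x assume x: "x \<in> M"
      have "d (g x) (h x) = 0"
      proof (rule zero)
        fix r :: real assume "r > 0"
        then obtain q where q: "q \<in> D" "d x q < r / 2" using dense[OF x, of "r / 2"] by auto
        have "g q = h q" using fun_cong[OF eq, of "(q, True)"] q by (simp add: \<Phi>)
        have "\<bar>d (g x) (h x) - d (g q) (h q)\<bar> \<le> d (g x) (g q) + d (h x) (h q)"
          by (rule d_diff_le[OF Isom_in[OF g x] Isom_in[OF h x] Isom_in[OF g DM[OF q(1)]] Isom_in[OF h DM[OF q(1)]]])
        then show "\<bar>d (g x) (h x) - 0\<bar> \<le> r"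
          using \<open>g q = h q\<close> Isom_d[OF g x DM[OF q(1)]] Isom_d[OF h x DM[OF q(1)]] q
            Isom_in[OF h DM[OF q(1)]] by simp
      qed
      then show "g x = h x" using Isom_in[OF g x] Isom_in[OF h x] by simp
    qed
  qed
  define \<Psi> where "\<Psi> = inv_into (carrier Isom) \<Phi>"
  have \<Psi>\<Phi>: "\<Psi> (\<Phi> g) = g" if "g \<in> carrier Isom" for g using inj that by (simp add: \<Psi>_def)
  have "continuous_map IsomT mtopology (\<lambda>g. \<Phi> g i)" if i: "i \<in> ?I" for i
  proof -
    obtain x b where xb: "i = (x, b)" "x \<in> D" using i by auto
    note orb = continuous_map_orbit[OF Metric_space_axioms DM[OF xb(2)]]
    have "continuous_map IsomT IsomT (\<lambda>g. inv\<^bsub>Isom\<^esub> g)"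
      using Isom_topological_group by (simp add: topological_group_def)
    from continuous_map_compose[OF this orb] orb show ?thesis
      using xb by (cases b) (simp_all add: \<Phi> o_def)
  qed
  moreover have "\<Phi> ` topspace IsomT \<subseteq> extensional ?I" by (auto simp: \<Phi>_def)
  ultimately have "continuous_map IsomT (subtopology ?Y ?S) \<Phi>"
    unfolding continuous_map_in_subtopology continuous_map_componentwise
    by (auto simp: topspace_IsomT)
  moreover have "continuous_map (subtopology ?Y ?S) IsomT \<Psi>"
  proof (rule IsomT_continuous_mapI)
    have top: "topspace (subtopology ?Y ?S) = ?S" using SY by auto
    fix p assume p: "p \<in> topspace (subtopology ?Y ?S)"
    then obtain g where g: "g \<in> carrier Isom" "p = \<Phi> g" using top by auto
    then show "\<Psi> p \<in> carrier Isom" by (simp add: \<Psi>\<Phi>)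
    fix x and r :: real assume x: "x \<in> M" and r: "r > 0"
    then obtain q where q: "q \<in> D" "d x q < r / 3" using dense[OF x, of "r / 3"] by auto
    let ?U = "?S \<inter> {p' \<in> topspace ?Y. p' (q, True) \<in> mball (p (q, True)) (r / 3)}"
    have "openin (subtopology ?Y ?S) ?U"
      using q by (intro openin_subtopology_Int2 openin_continuous_map_preimage[OF _ openin_mball]
          continuous_map_product_projection) auto
    moreover have "p \<in> ?U"
      using p top SY g q r Isom_in[OF g(1) DM[OF q(1)]] by (auto simp: \<Phi>)
    moreover have "d (\<Psi> p x) (\<Psi> p' x) < r" if p': "p' \<in> ?U" for p'
    proof -
      obtain h where h: "h \<in> carrier Isom" "p' = \<Phi> h" using p' by auto
      have gh: "d (g q) (h q) < r / 3" using p' q by (simp add: g h \<Phi>)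
      have "\<bar>d (g x) (h x) - d (g q) (h q)\<bar> \<le> d (g x) (g q) + d (h x) (h q)"
        by (rule d_diff_le[OF Isom_in[OF g(1) x] Isom_in[OF h(1) x] Isom_in[OF g(1) DM[OF q(1)]] Isom_in[OF h(1) DM[OF q(1)]]])
      then show ?thesis
        using gh q Isom_d[OF g(1) x DM[OF q(1)]] Isom_d[OF h(1) x DM[OF q(1)]]
        by (simp add: g h \<Psi>\<Phi> abs_le_iff)
    qed
    ultimately show "\<exists>U. openin (subtopology ?Y ?S) U \<and> p \<in> U \<and> (\<forall>q\<in>U. d (\<Psi> p x) (\<Psi> q x) < r)"
      by blast
  qed
  ultimately have "homeomorphic_maps IsomT (subtopology ?Y ?S) \<Phi> \<Psi>"
    using \<Psi>\<Phi> by (auto simp: homeomorphic_maps_def topspace_IsomT)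
  then have "IsomT homeomorphic_space subtopology ?Y ?S" by (auto simp: homeomorphic_space_def)
  then show ?thesis using cZ homeomorphic_completely_metrizable_space by blast
qed

theorem Isom_polish:
  assumes "mcomplete" "countable D" "D \<subseteq> M"
    and "\<And>x r. x \<in> M \<Longrightarrow> r > 0 \<Longrightarrow> \<exists>q\<in>D. d x q < r"
  shows "polish_group Isom IsomT"
  unfolding polish_group_def
  using Isom_topological_group IsomT_separable[OF assms(2-4)] IsomT_completely_metrizable[OF assms]
  by simp

end

section \<open>From a point stabilizer to the whole isometry group\<close>

text \<open>Sequences decide closedness in the metrizable source, so preimages of closed sets can be
  tested with them; left translation moves the limit to the unit.\<close>

lemma hom_continuous_if_sequentially:
  assumes G: "topological_group G T" and met: "metrizable_space T"
    and H: "topological_group H S" and f: "f \<in> hom G H"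
    and seq: "\<And>h :: nat \<Rightarrow> _. (\<And>n. h n \<in> carrier G) \<Longrightarrow> limitin T h \<one>\<^bsub>G\<^esub> sequentially \<Longrightarrow>
      limitin S (\<lambda>n. f (h n)) \<one>\<^bsub>H\<^esub> sequentially"
  shows "continuous_map T S f"
proof -
  interpret G: group G using G by (simp add: topological_group_def)
  interpret G: top_group G T by unfold_locales (rule G)
  interpret H: group H using H by (simp add: topological_group_def)
  interpret H: top_group H S by unfold_locales (rule H)
  obtain M d where "Metric_space M d" and T: "T = Metric_space.mtopology M d"
    using met by (auto simp: metrizable_space_def)
  then interpret M: Metric_space M d by simp
  have MG: "M = carrier G" using G.topspace_eq unfolding T by simp
  have fH: "f x \<in> carrier H" if "x \<in> carrier G" for x using hom_in_carrier[OF f that] .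
  show ?thesis
    unfolding continuous_map_closedin
  proof (intro conjI allI impI ballI Pi_I)
    show "f x \<in> topspace S" if "x \<in> topspace T" for x
      using that fH by (simp add: G.topspace_eq H.topspace_eq)
    fix C assume C: "closedin S C"
    show "closedin T {x \<in> topspace T. f x \<in> C}"
      unfolding T M.metric_closedin_iff_sequentially_closed
    proof (intro conjI allI impI)
      fix \<sigma> l assume *: "range \<sigma> \<subseteq> {x \<in> topspace M.mtopology. f x \<in> C} \<and> limitin M.mtopology \<sigma> l sequentially"
      have \<sigma>: "\<sigma> n \<in> carrier G" "f (\<sigma> n) \<in> C" for n
        using * unfolding M.topspace_mtopology by (auto simp: MG[symmetric])
      have l: "l \<in> carrier G" using * M.limitin_mspace MG by blast
      have lT: "limitin T \<sigma> l sequentially" using * unfolding T by blast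
      define h where "h n = inv\<^bsub>G\<^esub> l \<otimes>\<^bsub>G\<^esub> \<sigma> n" for n
      have "limitin T (\<lambda>n. inv\<^bsub>G\<^esub> l \<otimes>\<^bsub>G\<^esub> \<sigma> n) (inv\<^bsub>G\<^esub> l \<otimes>\<^bsub>G\<^esub> l) sequentially"
        using lT l by (intro G.limitin_mult) (simp_all add: G.topspace_eq)
      then have "limitin T h \<one>\<^bsub>G\<^esub> sequentially" using l by (simp add: h_def[abs_def])
      then have "limitin S (\<lambda>n. f (h n)) \<one>\<^bsub>H\<^esub> sequentially"
      proof (rule seq[rotated])
        show "h n \<in> carrier G" for n using l \<sigma> by (simp add: h_def)
      qed
      then have "limitin S (\<lambda>n. f l \<otimes>\<^bsub>H\<^esub> f (h n)) (f l \<otimes>\<^bsub>H\<^esub> \<one>\<^bsub>H\<^esub>) sequentially"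
        using fH[OF l] by (intro H.limitin_mult) (simp_all add: H.topspace_eq)
      moreover have "f l \<otimes>\<^bsub>H\<^esub> f (h n) = f (\<sigma> n)" for n
      proof -
        have "l \<otimes>\<^bsub>G\<^esub> h n = \<sigma> n" using l \<sigma>(1) by (simp add: h_def G.m_assoc[symmetric])
        moreover have "h n \<in> carrier G" using l \<sigma>(1) by (simp add: h_def)
        ultimately show ?thesis using hom_mult[OF f l, of "h n"] by simp
      qed
      ultimately have "limitin S (\<lambda>n. f (\<sigma> n)) (f l) sequentially" using fH[OF l] by simp
      then have "f l \<in> C" by (rule limitin_closedin[OF _ C]) (simp_all add: \<sigma>)
      then show "l \<in> {x \<in> topspace M.mtopology. f x \<in> C}"
        unfolding M.topspace_mtopology using l MG by simp
    qed auto
  qed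
qed

context Metric_space begin

text \<open>Stated pointwise so that the limit can be written \<open>\<lambda>x. x\<close>, which in
  general is not the extensional unit of the group.\<close>

definition tends_Isom :: "(nat \<Rightarrow> 'a \<Rightarrow> 'a) \<Rightarrow> ('a \<Rightarrow> 'a) \<Rightarrow> bool" where
  "tends_Isom g h \<longleftrightarrow> (\<forall>x\<in>M. (\<lambda>n. d (g n x) (h x)) \<longlonglongrightarrow> 0)"

lemma limitin_IsomT_imp_tends:
  assumes "\<And>n. g n \<in> carrier Isom" "limitin IsomT g h sequentially"
  shows "tends_Isom g h"
  unfolding tends_Isom_def
proof
  fix x assume x: "x \<in> M"
  from continuous_map_limit[OF continuous_map_orbit[OF Metric_space_axioms x] assms(2)]
  have "limitin mtopology (\<lambda>n. g n x) (h x) sequentially" by (simp add: o_def)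
  then show "(\<lambda>n. d (g n x) (h x)) \<longlonglongrightarrow> 0" by (simp add: limitin_metric_dist_null)
qed

lemma tendsto_d_le:
  assumes "\<And>n. 0 \<le> a n \<and> a n \<le> b n" "b \<longlonglongrightarrow> (0::real)"
  shows "a \<longlonglongrightarrow> 0"
  by (rule tendsto_sandwich[OF _ _ tendsto_const assms(2)]) (simp_all add: assms(1))

text \<open>
  Continuity on the stabilizer \<open>K\<close> of a point \<open>o'\<close> spreads to the whole group: it also holds on
  the conjugate \<open>b K b\<inverse>\<close>, and an isometry close to \<open>b \<kappa> b\<inverse>\<close> is
  \<open>k (b \<kappa>' b\<inverse>) l\<close> with \<open>\<kappa>' \<in> K\<close> close to \<open>\<kappa>\<close> adjusted so that the distance from
  \<open>o'\<close> to its image is right, \<open>k \<in> K\<close> near \<open>1\<close> turning that image to the correct place, and then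
  \<open>l \<in> K\<close>.
\<close>

theorem Isom_hom_continuous:
  fixes H :: "'h monoid" and S :: "'h topology" and f :: "('a \<Rightarrow> 'a) \<Rightarrow> 'h"
  assumes met: "metrizable_space IsomT" and H: "topological_group H S" and f: "f \<in> hom Isom H"
    and o: "o' \<in> M"
    and stab: "\<And>k :: nat \<Rightarrow> _. (\<And>n. k n \<in> carrier Isom \<and> k n o' = o') \<Longrightarrow> tends_Isom k (\<lambda>x. x) \<Longrightarrow>
      limitin S (\<lambda>n. f (k n)) \<one>\<^bsub>H\<^esub> sequentially"
    and b: "b \<in> carrier Isom" "c \<in> M" "b c = o'"
    and \<kappa>: "\<kappa> \<in> carrier Isom" "\<kappa> o' = o'"
    and adjust: "\<And>r. r \<longlonglongrightarrow> d (b (\<kappa> c)) o' \<Longrightarrow> \<exists>k. (\<forall>n. k n \<in> carrier Isom \<and> k n o' = o') \<and>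
      tends_Isom k \<kappa> \<and> (\<forall>\<^sub>F n in sequentially. d (b (k n c)) o' = r n)"
    and turn: "\<And>x y. (\<And>n. x n \<in> M \<and> y n \<in> M) \<Longrightarrow> (\<lambda>n. d (x n) (b (\<kappa> c))) \<longlonglongrightarrow> 0 \<Longrightarrow>
      (\<lambda>n. d (y n) (b (\<kappa> c))) \<longlonglongrightarrow> 0 \<Longrightarrow> (\<forall>\<^sub>F n in sequentially. d (x n) o' = d (y n) o') \<Longrightarrow>
      \<exists>k. (\<forall>n. k n \<in> carrier Isom \<and> k n o' = o') \<and> tends_Isom k (\<lambda>x. x) \<and>
        (\<forall>\<^sub>F n in sequentially. k n (x n) = y n)"
  shows "continuous_map IsomT S f"
proof (rule hom_continuous_if_sequentially[OF Isom_topological_group met H f])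
  interpret G: group Isom by (rule Isom_group)
  interpret H: group H using H by (simp add: topological_group_def)
  interpret H: top_group H S by unfold_locales (rule H)
  fix h :: "nat \<Rightarrow> 'a \<Rightarrow> 'a"
  assume h: "\<And>n. h n \<in> carrier Isom" and lim: "limitin IsomT h \<one>\<^bsub>Isom\<^esub> sequentially"
  have fH: "f x \<in> carrier H" if "x \<in> carrier Isom" for x using hom_in_carrier[OF f that] .
  note [simp] = hom_mult[OF f] fH H.m_assoc
  have f_inv: "f (inv\<^bsub>Isom\<^esub> x) = inv\<^bsub>H\<^esub> (f x)" if "x \<in> carrier Isom" for x
  proof -
    interpret group_hom Isom H f by unfold_locales (rule f)
    show ?thesis using that by (rule hom_inv)
  qed
  have h1: "(\<lambda>n. d (h n x) x) \<longlonglongrightarrow> 0" if "x \<in> M" for x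
    using limitin_IsomT_imp_tends[OF h lim] that by (simp add: tends_Isom_def Isom_one)
  let ?bi = "inv\<^bsub>Isom\<^esub> b"
  have bi: "?bi \<in> carrier Isom" "?bi o' = c" using b Isom_inv(1)[OF b(1,2)] by simp_all
  \<comment> \<open>The product h0 h n near h0 is factored instead of h n near the identity: h0
    moves o' to the point about which \<open>adjust\<close> and \<open>turn\<close> give
    control.\<close>
  define h0 where "h0 = b \<otimes>\<^bsub>Isom\<^esub> \<kappa> \<otimes>\<^bsub>Isom\<^esub> ?bi"
  have h0: "h0 \<in> carrier Isom" using b \<kappa> by (simp add: h0_def)
  have h0x: "h0 x = b (\<kappa> (?bi x))" if "x \<in> M" for x
    using b \<kappa> that by (simp add: h0_def Isom_mult Isom_in[OF bi(1)])
  let ?p = "b (\<kappa> c)"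
  have p: "h0 o' = ?p" using h0x[OF o] bi by simp
  have pM: "?p \<in> M" using Isom_in[OF h0 o] p by simp
  \<comment> \<open>The image of o' that the factorization has to reproduce: k' n will give its
    distance from o', and k n its direction.\<close>
  define y where "y n = h0 (h n o')" for n
  have yM: "y n \<in> M" for n by (simp add: y_def Isom_in h h0 o)
  have "d (y n) ?p = d (h n o') o'" for n
    using Isom_d[OF h0 Isom_in[OF h o] o] p by (simp add: y_def)
  then have y: "(\<lambda>n. d (y n) ?p) \<longlonglongrightarrow> 0" using h1[OF o] by simp
  have "(\<lambda>n. d (y n) o') \<longlonglongrightarrow> d ?p o'"
  proof (rule Lim_null[THEN iffD2], rule tendsto_norm_zero_cancel, rule tendsto_d_le[OF _ y])
    show "0 \<le> norm (d (y n) o' - d ?p o') \<and> norm (d (y n) o' - d ?p o') \<le> d (y n) ?p" for n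
      using d_diff_le[OF yM[of n] o pM o] o by simp
  qed
  from adjust[OF this] obtain k' where k': "\<And>n. k' n \<in> carrier Isom" "\<And>n. k' n o' = o'"
    "tends_Isom k' \<kappa>" "\<forall>\<^sub>F n in sequentially. d (b (k' n c)) o' = d (y n) o'" by blast
  define x where "x n = b (k' n c)" for n
  have xM: "x n \<in> M" for n by (simp add: x_def Isom_in b k')
  have "d (x n) ?p = d (k' n c) (\<kappa> c)" for n
    unfolding x_def by (rule Isom_d[OF b(1) Isom_in[OF k'(1) b(2)] Isom_in[OF \<kappa>(1) b(2)]])
  then have "(\<lambda>n. d (x n) ?p) \<longlonglongrightarrow> 0" using k'(3) b(2) by (simp add: tends_Isom_def)
  moreover have "\<forall>\<^sub>F n in sequentially. d (x n) o' = d (y n) o'" using k'(4) by (simp add: x_def)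
  ultimately have "\<exists>k. (\<forall>n. k n \<in> carrier Isom \<and> k n o' = o') \<and> tends_Isom k (\<lambda>x. x) \<and>
        (\<forall>\<^sub>F n in sequentially. k n (x n) = y n)"
    using xM yM y by (intro turn) simp_all
  then obtain k where k: "\<And>n. k n \<in> carrier Isom" "\<And>n. k n o' = o'" "tends_Isom k (\<lambda>x. x)"
    "\<forall>\<^sub>F n in sequentially. k n (x n) = y n" by blast
  define m where "m n = k n \<otimes>\<^bsub>Isom\<^esub> (b \<otimes>\<^bsub>Isom\<^esub> k' n \<otimes>\<^bsub>Isom\<^esub> ?bi)" for n
  have m: "m n \<in> carrier Isom" for n using k k' b by (simp add: m_def)
  have mx: "m n z = k n (b (k' n (?bi z)))" if "z \<in> M" for n z
    using b k k' that
      by (simp add: m_def Isom_mult Isom_in[OF bi(1)] Isom_in[OF k'(1)] Isom_in[OF b(1)])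
  define l0 where "l0 n = inv\<^bsub>Isom\<^esub> (m n) \<otimes>\<^bsub>Isom\<^esub> (h0 \<otimes>\<^bsub>Isom\<^esub> h n)" for n
  have l0: "l0 n \<in> carrier Isom" for n using m h0 h by (simp add: l0_def)
  have l0x: "m n (l0 n z) = h0 (h n z)" if "z \<in> M" for n z
  proof -
    have "l0 n z = (inv\<^bsub>Isom\<^esub> (m n)) (h0 (h n z))"
      using that m h0 h by (simp add: l0_def Isom_mult Isom_in[OF h])
    then show ?thesis using Isom_inv(2)[OF m Isom_in[OF h0 Isom_in[OF h that]]] by simp
  qed
  have l0_tends: "(\<lambda>n. d (l0 n z) z) \<longlonglongrightarrow> 0" if z: "z \<in> M" for z
  proof (rule tendsto_d_le)
    let ?w = "h0 z" and ?v = "\<lambda>n. b (k' n (?bi z))"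
    have biz: "?bi z \<in> M" by (rule Isom_in[OF bi(1) z])
    have v: "?v n \<in> M" for n by (rule Isom_in[OF b(1) Isom_in[OF k'(1) biz]])
    have w: "?w \<in> M" by (rule Isom_in[OF h0 z])
    have hz: "h n z \<in> M" "h0 (h n z) \<in> M" for n
      by (rule Isom_in[OF h z], rule Isom_in[OF h0 Isom_in[OF h z]])
    have kw: "k n ?w \<in> M" "k n (?v n) \<in> M" for n
      by (rule Isom_in[OF k(1) w], rule Isom_in[OF k(1) v])
    show "0 \<le> d (l0 n z) z \<and> d (l0 n z) z \<le>
        d (h n z) z + (d (k n ?w) ?w + d (k' n (?bi z)) (\<kappa> (?bi z)))" for n
    proof -
      have "d (l0 n z) z = d (m n (l0 n z)) (m n z)"
        by (rule Isom_d[OF m Isom_in[OF l0 z] z, symmetric])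
      also have "\<dots> = d (h0 (h n z)) (k n (?v n))" by (simp add: l0x[OF z] mx[OF z])
      also have "\<dots> \<le> d (h0 (h n z)) ?w + d ?w (k n (?v n))" by (rule triangle[OF hz(2) w kw(2)])
      also have "d (h0 (h n z)) ?w = d (h n z) z" by (rule Isom_d[OF h0 hz(1) z])
      also have "d ?w (k n (?v n)) \<le> d ?w (k n ?w) + d (k n ?w) (k n (?v n))"
        by (rule triangle[OF w kw])
      also have "d (k n ?w) (k n (?v n)) = d ?w (?v n)" by (rule Isom_d[OF k(1) w v])
      also have "d ?w (?v n) = d (\<kappa> (?bi z)) (k' n (?bi z))"
        unfolding h0x[OF z] by (rule Isom_d[OF b(1) Isom_in[OF \<kappa>(1) biz] Isom_in[OF k'(1) biz]])
      finally show ?thesis by (simp add: commute)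
    qed
    have "(\<lambda>n. d (h n z) z + (d (k n ?w) ?w + d (k' n (?bi z)) (\<kappa> (?bi z)))) \<longlonglongrightarrow> 0 + (0 + 0)"
      using k(3) k'(3) w biz h1[OF z] by (intro tendsto_add) (simp_all add: tends_Isom_def)
    then show "(\<lambda>n. d (h n z) z + (d (k n ?w) ?w + d (k' n (?bi z)) (\<kappa> (?bi z)))) \<longlonglongrightarrow> 0" by simp
  qed
  have l0o: "l0 n o' = o'" if n: "k n (x n) = y n" for n
  proof -
    have "m n o' = y n" using n bi(2) by (simp add: mx[OF o] x_def)
    then have "m n (l0 n o') = m n o'" by (simp add: l0x[OF o] y_def)
    then have "d (l0 n o') o' = 0"
      using Isom_d[OF m Isom_in[OF l0 o] o, of n n] Isom_in[OF m o] by simp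
    then show ?thesis using Isom_in[OF l0 o, of n] o by simp
  qed
  \<comment> \<open>\<open>l0 n\<close> fixes o' only eventually, whereas \<open>stab\<close> asks
    for a sequence lying in the stabilizer; the remaining terms are set to the unit.\<close>
  define l where "l n = (if l0 n o' = o' then l0 n else \<one>\<^bsub>Isom\<^esub>)" for n
  have l: "l n \<in> carrier Isom" for n using l0[of n] G.one_closed
    by (cases "l0 n o' = o'") (simp_all only: l_def if_True if_False simp_thms)
  have lo: "l n o' = o'" for n using o by (simp add: l_def Isom_one)
  have "tends_Isom l (\<lambda>x. x)" unfolding tends_Isom_def
  proof
    fix z assume z: "z \<in> M"
    show "(\<lambda>n. d (l n z) z) \<longlonglongrightarrow> 0"
      by (rule tendsto_d_le[OF _ l0_tends[OF z]]) (use z in \<open>auto simp: l_def Isom_one\<close>)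
  qed
  then have fl: "limitin S (\<lambda>n. f (l n)) \<one>\<^bsub>H\<^esub> sequentially" using l lo by (intro stab) simp_all
  have fk: "limitin S (\<lambda>n. f (k n)) \<one>\<^bsub>H\<^esub> sequentially" using k by (intro stab) simp_all
  have "limitin S (\<lambda>n. f (inv\<^bsub>Isom\<^esub> \<kappa> \<otimes>\<^bsub>Isom\<^esub> k' n)) \<one>\<^bsub>H\<^esub> sequentially"
  proof (rule stab)
    have i\<kappa>: "inv\<^bsub>Isom\<^esub> \<kappa> \<in> carrier Isom" "(inv\<^bsub>Isom\<^esub> \<kappa>) o' = o'"
      using \<kappa> Isom_inv(1)[OF \<kappa>(1) o] by simp_all
    then show "inv\<^bsub>Isom\<^esub> \<kappa> \<otimes>\<^bsub>Isom\<^esub> k' n \<in> carrier Isom \<and> (inv\<^bsub>Isom\<^esub> \<kappa> \<otimes>\<^bsub>Isom\<^esub> k' n) o' = o'" for n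
      using k' o by (simp add: Isom_mult)
    have "d ((inv\<^bsub>Isom\<^esub> \<kappa> \<otimes>\<^bsub>Isom\<^esub> k' n) z) z = d (k' n z) (\<kappa> z)" if z: "z \<in> M" for n z
    proof -
      have "d ((inv\<^bsub>Isom\<^esub> \<kappa>) (k' n z)) ((inv\<^bsub>Isom\<^esub> \<kappa>) (\<kappa> z)) = d (k' n z) (\<kappa> z)"
        by (rule Isom_d[OF i\<kappa>(1) Isom_in[OF k'(1) z] Isom_in[OF \<kappa>(1) z]])
      then show ?thesis using i\<kappa> k' z Isom_inv(1)[OF \<kappa>(1) z] by (simp add: Isom_mult)
    qed
    then show "tends_Isom (\<lambda>n. inv\<^bsub>Isom\<^esub> \<kappa> \<otimes>\<^bsub>Isom\<^esub> k' n) (\<lambda>x. x)"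
      using k'(3) by (simp add: tends_Isom_def)
  qed
  then have "limitin S (\<lambda>n. f \<kappa> \<otimes>\<^bsub>H\<^esub> f (inv\<^bsub>Isom\<^esub> \<kappa> \<otimes>\<^bsub>Isom\<^esub> k' n)) (f \<kappa> \<otimes>\<^bsub>H\<^esub> \<one>\<^bsub>H\<^esub>) sequentially"
    using \<kappa> by (intro H.limitin_mult) (simp_all add: H.topspace_eq)
  moreover have "f \<kappa> \<otimes>\<^bsub>H\<^esub> f (inv\<^bsub>Isom\<^esub> \<kappa> \<otimes>\<^bsub>Isom\<^esub> k' n) = f (k' n)" for n
  proof -
    have "f (\<kappa> \<otimes>\<^bsub>Isom\<^esub> (inv\<^bsub>Isom\<^esub> \<kappa> \<otimes>\<^bsub>Isom\<^esub> k' n)) = f (k' n)"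
      using \<kappa> k' by (simp add: G.m_assoc[symmetric])
    then show ?thesis using \<kappa>(1) k'(1) by (simp del: H.m_assoc)
  qed
  ultimately have fk': "limitin S (\<lambda>n. f (k' n)) (f \<kappa>) sequentially" using \<kappa> by simp
  \<comment> \<open>The image of h n according to h n = h0^-1 k n (b k' n b^-1) l n, in which every
    factor has a known limit under f.\<close>
  let ?F = "\<lambda>n. inv\<^bsub>H\<^esub> (f h0) \<otimes>\<^bsub>H\<^esub> (f (k n) \<otimes>\<^bsub>H\<^esub> (f b \<otimes>\<^bsub>H\<^esub> f (k' n) \<otimes>\<^bsub>H\<^esub> inv\<^bsub>H\<^esub> (f b)) \<otimes>\<^bsub>H\<^esub> f (l n))"
  have "limitin S ?F (inv\<^bsub>H\<^esub> (f h0) \<otimes>\<^bsub>H\<^esub> (\<one>\<^bsub>H\<^esub> \<otimes>\<^bsub>H\<^esub> (f b \<otimes>\<^bsub>H\<^esub> f \<kappa> \<otimes>\<^bsub>H\<^esub> inv\<^bsub>H\<^esub> (f b)) \<otimes>\<^bsub>H\<^esub> \<one>\<^bsub>H\<^esub>)) sequentially"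
    using h0 b by (intro H.limitin_mult fl fk fk') (simp_all add: H.topspace_eq)
  moreover have "f h0 = f b \<otimes>\<^bsub>H\<^esub> f \<kappa> \<otimes>\<^bsub>H\<^esub> inv\<^bsub>H\<^esub> (f b)"
    using b \<kappa> by (simp add: h0_def f_inv)
  then have "inv\<^bsub>H\<^esub> (f h0) \<otimes>\<^bsub>H\<^esub> (\<one>\<^bsub>H\<^esub> \<otimes>\<^bsub>H\<^esub> (f b \<otimes>\<^bsub>H\<^esub> f \<kappa> \<otimes>\<^bsub>H\<^esub> inv\<^bsub>H\<^esub> (f b)) \<otimes>\<^bsub>H\<^esub> \<one>\<^bsub>H\<^esub>) = \<one>\<^bsub>H\<^esub>"
    using fH[OF h0] by (metis H.inv_closed H.l_inv H.l_one H.r_one)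
  ultimately have "limitin S ?F \<one>\<^bsub>H\<^esub> sequentially" by (simp only:)
  moreover have "\<forall>\<^sub>F n in sequentially. ?F n = f (h n)"
    using k(4)
  proof (rule eventually_mono)
    fix n assume "k n (x n) = y n"
    then have "l n = l0 n" using l0o by (simp add: l_def)
    then have "m n \<otimes>\<^bsub>Isom\<^esub> l n = h0 \<otimes>\<^bsub>Isom\<^esub> h n"
      using m[of n] h0 h[of n] by (simp add: l0_def G.m_assoc[symmetric])
    then have "f (inv\<^bsub>Isom\<^esub> h0 \<otimes>\<^bsub>Isom\<^esub> (m n \<otimes>\<^bsub>Isom\<^esub> l n)) = f (h n)"
      using h0 h[of n] by (simp add: G.m_assoc[symmetric])
    moreover have "f (inv\<^bsub>Isom\<^esub> h0 \<otimes>\<^bsub>Isom\<^esub> (m n \<otimes>\<^bsub>Isom\<^esub> l n)) = ?F n"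
      using h0 m[of n] l[of n] k(1)[of n] k'(1)[of n] b by (simp add: f_inv m_def)
    ultimately show "?F n = f (h n)" by simp
  qed
  ultimately show "limitin S (\<lambda>n. f (h n)) \<one>\<^bsub>H\<^esub> sequentially"
    by (rule limitin_transform_eventually[rotated])
qed

end

section \<open>Rotations depending continuously on their end points, and the argument common to both
  models\<close>

lemma tendsto_refl_along:
  assumes "(a \<longlongrightarrow> \<alpha>) F" "(z \<longlongrightarrow> \<zeta>) F" "\<alpha> \<noteq> 0"
  shows "((\<lambda>n. refl_along (a n) (z n)) \<longlongrightarrow> refl_along \<alpha> \<zeta>) F"
  unfolding refl_along_def using assms by (intro tendsto_intros) simp_all

text \<open>A single reflection taking x to y has normal x - y, which degenerates when x and y
  approach the same vector. Reflecting x to -x and then -x to y uses the normals x and x + y; these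
  stay away from 0 if the common limit is nonzero, so the product tends to the identity.\<close>

definition turn :: "'a::real_inner \<Rightarrow> 'a \<Rightarrow> 'a \<Rightarrow> 'a" where
  "turn x y = refl_along (x + y) \<circ> refl_along x"

lemma turn_apply:
  assumes "norm x = norm y" shows "turn x y x = y"
proof -
  have 1: "refl_along x x = - x"
    by (cases "x = 0") (simp_all add: refl_along_def scaleR_2)
  have "refl_along (- x - y) (- x) = y"
    by (rule refl_along_swap) (use assms in \<open>simp add: dot_square_norm\<close>)
  moreover have "refl_along (- x - y) = refl_along (x + y)"
  proof -
    have "- x - y = - (x + y)" by simp
    moreover have "refl_along (- a) = refl_along a" for a :: 'a
      by (simp add: fun_eq_iff refl_along_def)
    ultimately show ?thesis by (simp only:)
  qed
  ultimately show ?thesis by (simp add: turn_def 1)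
qed

lemma turn_self: "turn x x = id"
proof -
  have "refl_along (x + x) = refl_along x"
    by (simp add: fun_eq_iff refl_along_def flip: scaleR_2)
  then show ?thesis by (simp add: turn_def fun_eq_iff refl_along_idem)
qed

lemma tendsto_turn:
  assumes "(x \<longlongrightarrow> \<xi>) F" "(y \<longlongrightarrow> \<eta>) F" "\<xi> \<noteq> 0" "\<xi> + \<eta> \<noteq> 0"
  shows "((\<lambda>n. turn (x n) (y n) z) \<longlongrightarrow> turn \<xi> \<eta> z) F"
  unfolding turn_def comp_apply
  by (intro tendsto_refl_along tendsto_add assms tendsto_const)

context hilbert begin

lemma turn_orth: "x \<in> sub A \<Longrightarrow> y \<in> sub A \<Longrightarrow> turn x y \<in> orth A"
  unfolding turn_def by (intro orth_comp refl_along_orth sub_add)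

definition proj_off :: "nat set \<Rightarrow> 'a \<Rightarrow> 'a" where
  "proj_off J x = x - (\<Sum>j\<in>J. (x \<bullet> e j) *\<^sub>R e j)"

lemma proj_off:
  assumes "finite J"
  shows "proj_off J x \<in> sub (- J)" "x - proj_off J x \<in> sub J"
proof -
  have *: "(\<Sum>j\<in>J. (x \<bullet> e j) *\<^sub>R e j) \<bullet> e i = (if i \<in> J then x \<bullet> e i else 0)" for i
    using assms by (simp add: inner_sum_left e_inner if_distrib cong: if_cong)
  show "proj_off J x \<in> sub (- J)" by (simp add: sub_def proj_off_def inner_diff *)
  show "x - proj_off J x \<in> sub J" by (simp add: sub_def proj_off_def *)
qed

lemma sub_Int_disjoint: "x \<in> sub A \<Longrightarrow> x \<in> sub B \<Longrightarrow> A \<inter> B = {} \<Longrightarrow> x = 0"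
  using inner_sub_disjoint[of x A x B] by simp

text \<open>
  In both models the stabilizer of the base point \<open>o'\<close> consists of the restrictions of the
  orthogonal operators fixing \<open>e j\<close> for \<open>j \<in> J\<close>: \<open>J\<close> is empty for the Hilbert space
  itself, and \<open>{0}\<close> for the hyperboloid.
\<close>

theorem model_automatic_continuity:
  fixes M :: "'a set" and d :: "'a \<Rightarrow> 'a \<Rightarrow> real" and H :: "'h monoid" and S :: "'h topology"
  assumes MS: "Metric_space M d" and J: "finite J"
    and met: "metrizable_space (pointwise_topology M d)"
    and H: "topological_group H S" and sep: "separable_space S" and f: "f \<in> hom (isom_group M d) H"
    and restr: "\<And>T. T \<in> orth (- J) \<Longrightarrow> restrict T M \<in> carrier (isom_group M d)"
    and stab: "\<And>g. g \<in> carrier (isom_group M d) \<Longrightarrow> g o' = o' \<Longrightarrow> \<exists>T\<in>orth (- J). g = restrict T M"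
    and o': "o' \<in> M" "o' \<in> sub J" "\<And>x. x \<in> M \<Longrightarrow> x \<in> sub J \<Longrightarrow> x = o'"
    and conv: "\<And>x p. (\<And>n::nat. x n \<in> M) \<Longrightarrow> p \<in> M \<Longrightarrow> (\<lambda>n. d (x n) p) \<longlonglongrightarrow> 0 \<longleftrightarrow> x \<longlonglongrightarrow> p"
    and sphere: "\<And>x y. x \<in> M \<Longrightarrow> y \<in> M \<Longrightarrow> d x o' = d y o' \<Longrightarrow> x - y \<in> sub (- J) \<and> norm x = norm y"
    and spans: "\<And>i. i \<notin> J \<Longrightarrow> \<exists>x\<in>M. x - e i \<in> sub J"
    and b: "b \<in> carrier (isom_group M d)" "c \<in> M" "b c = o'"
    and c: "c - \<sigma> *\<^sub>R e i \<in> sub J" "\<sigma> \<noteq> 0" "i \<notin> J" "j \<notin> J" "i \<noteq> j"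
    and adjust: "\<And>r. r \<longlonglongrightarrow> d (c - \<sigma> *\<^sub>R e i + \<sigma> *\<^sub>R e j) c \<Longrightarrow>
      \<exists>t. t \<longlonglongrightarrow> 0 \<and> (\<forall>\<^sub>F n in sequentially.
        d (c - \<sigma> *\<^sub>R e i + \<sigma> *\<^sub>R (t n *\<^sub>R e i + sqrt (1 - (t n)\<^sup>2) *\<^sub>R e j)) c = r n)"
  shows "continuous_map (pointwise_topology M d) S f"
proof -
  interpret Metric_space M d by (rule MS)
  interpret G: group Isom by (rule Isom_group)
  let ?A = "- J"
  have tends_iff: "tends_Isom (\<lambda>n. restrict (T n) M) g \<longleftrightarrow> (\<forall>x\<in>M. (\<lambda>n. T n x) \<longlonglongrightarrow> g x)"
    if T: "\<And>n. T n \<in> orth ?A" and g: "\<And>x. x \<in> M \<Longrightarrow> g x \<in> M" for T g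
  proof -
    have TM: "T n x \<in> M" if x: "x \<in> M" for n x using Isom_in[OF restr[OF T] x] x by simp
    have "(\<lambda>n. d (T n x) (g x)) \<longlonglongrightarrow> 0 \<longleftrightarrow> (\<lambda>n. T n x) \<longlonglongrightarrow> g x" if "x \<in> M" for x
      by (rule conv[OF TM[OF that] g[OF that]])
    then show ?thesis by (simp add: tends_Isom_def)
  qed
  have T_o: "T o' = o'" if "T \<in> orth ?A" for T by (rule orth_fix[OF that o'(2)]) simp
  have restr_mult: "restrict (T1 \<circ> T2) M = restrict T1 M \<otimes>\<^bsub>Isom\<^esub> restrict T2 M"
    if T: "T1 \<in> orth ?A" "T2 \<in> orth ?A" for T1 T2
  proof (rule Isom_eqI)
    show "restrict (T1 \<circ> T2) M \<in> carrier Isom" by (rule restr[OF orth_comp[OF T]])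
    show "restrict T1 M \<otimes>\<^bsub>Isom\<^esub> restrict T2 M \<in> carrier Isom" using restr T by simp
    fix x assume x: "x \<in> M"
    have "T2 x \<in> M" using Isom_in[OF restr[OF T(2)] x] x by simp
    then show "restrict (T1 \<circ> T2) M x = (restrict T1 M \<otimes>\<^bsub>Isom\<^esub> restrict T2 M) x"
      using x Isom_mult[OF restr[OF T(1)] restr[OF T(2)] x] by simp
  qed
  \<comment> \<open>Unit vectors, for |t| \<le> 1, turning from \<open>e j\<close> at t = 0 towards
    \<open>e i\<close>. The point ?v t is c with the direction \<open>e i\<close> of its part
    \<sigma> \<open>e i\<close> replaced by ?w t, so ?v 0 is the image of c under \<kappa>.\<close>
  let ?w = "\<lambda>t. t *\<^sub>R e i + sqrt (1 - t\<^sup>2) *\<^sub>R e j"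
  let ?v = "\<lambda>t. c - \<sigma> *\<^sub>R e i + \<sigma> *\<^sub>R ?w t"
  have ij: "e i \<in> sub ?A" "e j \<in> sub ?A" using c by (auto intro: e_in_sub)
  have w: "?w t \<in> sub ?A" for t by (intro sub_add sub_scale ij)
  have w_norm: "norm (e i) = norm (?w t)" if "\<bar>t\<bar> \<le> 1" for t
  proof -
    have "t\<^sup>2 \<le> 1" using that by (simp add: abs_square_le_1)
    then have "?w t \<bullet> ?w t = 1" using c(5)
      by (simp add: inner_add e_inner power2_eq_square[symmetric])
    then show ?thesis by (simp add: norm_eq_sqrt_inner e_inner)
  qed
  define \<kappa> where "\<kappa> = turn (e i) (e j)"
  have \<kappa>: "\<kappa> \<in> orth ?A" unfolding \<kappa>_def by (rule turn_orth[OF ij])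
  have turn_c: "turn (e i) (?w t) c = ?v t" if t: "\<bar>t\<bar> \<le> 1" for t
  proof -
    have "turn (e i) (?w t) \<in> orth ?A" by (rule turn_orth[OF ij(1) w])
    note this and lin = isometric_linear[OF orth_isometric[OF this]]
    moreover have "turn (e i) (?w t) (c - \<sigma> *\<^sub>R e i) = c - \<sigma> *\<^sub>R e i"
      by (rule orth_fix[OF \<open>turn (e i) (?w t) \<in> orth ?A\<close> c(1)]) simp
    moreover have "c = (c - \<sigma> *\<^sub>R e i) + \<sigma> *\<^sub>R e i" by simp
    ultimately show ?thesis
      using linear_add[OF lin, of "c - \<sigma> *\<^sub>R e i" "\<sigma> *\<^sub>R e i"] linear_scale[OF lin, of \<sigma> "e i"]
        turn_apply[OF w_norm[OF t]] by simp
  qed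
  have \<kappa>c: "\<kappa> c = c - \<sigma> *\<^sub>R e i + \<sigma> *\<^sub>R e j" using turn_c[of 0] by (simp add: \<kappa>_def)
  let ?\<kappa> = "restrict \<kappa> M"
  have \<kappa>cM: "\<kappa> c \<in> M" using Isom_in[OF restr[OF \<kappa>] b(2)] b(2) by simp
  let ?p = "b (?\<kappa> c)"
  have pM: "?p \<in> M" by (rule Isom_in[OF b(1) Isom_in[OF restr[OF \<kappa>] b(2)]])
  have "e i \<noteq> e j" using c(5) e_inner[of i j] e_inner[of i i] by auto
  then have "\<kappa> c \<noteq> c" using c(2) by (simp add: \<kappa>c algebra_simps)
  then have "?p \<noteq> o'" using Isom_d[OF b(1) \<kappa>cM b(2)] b \<kappa>cM o'(1) by force
  \<comment> \<open>The rotations that turn x n to y n converge because the projections have a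
    nonzero limit; otherwise ?p would lie in \<open>sub J\<close> and equal o'.\<close>
  then have Pp: "proj_off J ?p \<noteq> 0"
    using o'(3)[OF pM] proj_off(2)[OF J, of ?p] by auto
  show ?thesis
  proof (rule Isom_hom_continuous[OF met H f o'(1) _ b restr[OF \<kappa>]])
    show "?\<kappa> o' = o'" using o'(1) T_o[OF \<kappa>] by simp
  next
    fix k :: "nat \<Rightarrow> 'a \<Rightarrow> 'a"
    assume k: "\<And>n. k n \<in> carrier Isom \<and> k n o' = o'" and tk: "tends_Isom k (\<lambda>x. x)"
    have "\<forall>n. \<exists>T. T \<in> orth ?A \<and> k n = restrict T M" using stab k by blast
    from choice[OF this] obtain T where T': "\<forall>n. T n \<in> orth ?A \<and> k n = restrict (T n) M" ..
    then have T: "T n \<in> orth ?A" and kT: "k n = restrict (T n) M" for n by blast+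
    have TM: "(\<lambda>n. T n x) \<longlonglongrightarrow> x" if "x \<in> M" for x
      using tk tends_iff[OF T, of "\<lambda>x. x"] that by (simp add: kT[abs_def])
    \<comment> \<open>Points of M reach the basis vectors modulo \<open>sub J\<close>, which every T
      n fixes.\<close>
    have Te: "(\<lambda>n. T n (e l)) \<longlonglongrightarrow> e l" for l
    proof (cases "l \<in> J")
      case True
      then have "T n (e l) = e l" for n by (intro orth_fixes_e[OF T]) simp
      then show ?thesis by simp
    next
      case False
      then obtain x where x: "x \<in> M" "x - e l \<in> sub J" using spans by blast
      have "T n (e l) = T n x - (x - e l)" for n
      proof -
        have "T n (x - e l) = x - e l" by (rule orth_fix[OF T x(2)]) simp
        then show ?thesis using isometric_diff[OF orth_isometric[OF T], of n x "e l"]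
          by (simp add: algebra_simps)
      qed
      moreover have "(\<lambda>n. T n x - (x - e l)) \<longlonglongrightarrow> x - (x - e l)"
        by (intro tendsto_diff TM x(1) tendsto_const)
      ultimately show ?thesis by simp
    qed
    have "limitin S (\<lambda>n. f (restrict (T n) M)) \<one>\<^bsub>H\<^esub> sequentially"
    proof (rule orth_hom_seq_continuous[where A = ?A and f = "\<lambda>T. f (restrict T M)"])
      show "infinite ?A" using J by (simp add: finite_compl)
      show "f (restrict T M) \<in> carrier H" if "T \<in> orth ?A" for T
        using hom_in_carrier[OF f restr[OF that]] .
      show "f (restrict (T1 \<circ> T2) M) = f (restrict T1 M) \<otimes>\<^bsub>H\<^esub> f (restrict T2 M)"
        if "T1 \<in> orth ?A" "T2 \<in> orth ?A" for T1 T2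
        unfolding restr_mult[OF that] by (rule hom_mult[OF f restr[OF that(1)] restr[OF that(2)]])
    qed (fact H sep T Te)+
    then show "limitin S (\<lambda>n. f (k n)) \<one>\<^bsub>H\<^esub> sequentially" by (simp add: kT)
  next
    fix r assume r: "r \<longlonglongrightarrow> d ?p o'"
    have d_b: "d (b x) o' = d x c" if "x \<in> M" for x using Isom_d[OF b(1) that b(2)] b(3) by simp
    have "d ?p o' = d (c - \<sigma> *\<^sub>R e i + \<sigma> *\<^sub>R e j) c" using d_b[OF \<kappa>cM] b(2) by (simp add: \<kappa>c)
    then obtain t where t: "t \<longlonglongrightarrow> 0" "\<forall>\<^sub>F n in sequentially. d (?v (t n)) c = r n"
      using adjust[of r] r by auto
    \<comment> \<open>Clamping makes the bound |s n| \<le> 1 hold for every n; as t tends to 0, s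
      and t eventually agree.\<close>
    define s where "s n = max (- (1/2)) (min (1/2) (t n))" for n
    have s_le: "\<bar>s n\<bar> \<le> 1" for n by (simp add: s_def)
    have "s \<longlonglongrightarrow> max (- (1/2)) (min (1/2) 0)" unfolding s_def[abs_def]
      by (intro tendsto_max tendsto_min tendsto_const t(1))
    then have s0: "s \<longlonglongrightarrow> 0" by simp
    have "\<forall>\<^sub>F n in sequentially. \<bar>t n\<bar> < 1/2"
      using order_tendstoD(2)[OF tendsto_rabs_zero[OF t(1)], of "1/2"] by simp
    then have st: "\<forall>\<^sub>F n in sequentially. s n = t n" by (rule eventually_mono) (simp add: s_def)
    define T where "T n = turn (e i) (?w (s n))" for n
    have T: "T n \<in> orth ?A" for n unfolding T_def by (rule turn_orth[OF ij(1) w])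
    have "(\<lambda>n. T n x) \<longlonglongrightarrow> \<kappa> x" for x
    proof -
      have "(\<lambda>n. ?w (s n)) \<longlonglongrightarrow> ?w 0" by (intro tendsto_intros s0)
      then have "(\<lambda>n. ?w (s n)) \<longlonglongrightarrow> e j" by simp
      moreover have "e i \<noteq> 0" "e i + e j \<noteq> 0"
        using e_inner[of i i] inner_add_left[of "e i" "e j" "e i"] c(5) by (auto simp: e_inner)
      ultimately show ?thesis unfolding T_def \<kappa>_def by (intro tendsto_turn tendsto_const)
    qed
    then have "tends_Isom (\<lambda>n. restrict (T n) M) ?\<kappa>"
      using tends_iff[OF T, of ?\<kappa>] Isom_in[OF restr[OF \<kappa>]] by simp
    moreover have "\<forall>\<^sub>F n in sequentially. d (b (restrict (T n) M c)) o' = r n"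
      using t(2) st
    proof eventually_elim
      case (elim n)
      have "restrict (T n) M c = ?v (s n)" using b(2) turn_c[OF s_le] by (simp add: T_def)
      moreover have "restrict (T n) M c \<in> M" by (rule Isom_in[OF restr[OF T] b(2)])
      ultimately show ?case using d_b[of "restrict (T n) M c"] elim by simp
    qed
    moreover have "restrict (T n) M \<in> carrier Isom \<and> restrict (T n) M o' = o'" for n
      using restr[OF T] o'(1) T_o[OF T] by simp
    ultimately show "\<exists>k. (\<forall>n. k n \<in> carrier Isom \<and> k n o' = o') \<and> tends_Isom k ?\<kappa> \<and>
        (\<forall>\<^sub>F n in sequentially. d (b (k n c)) o' = r n)"
      by (intro exI[of _ "\<lambda>n. restrict (T n) M"]) simp
  next
    fix x y :: "nat \<Rightarrow> 'a"
    assume xy: "\<And>n. x n \<in> M \<and> y n \<in> M" and x: "(\<lambda>n. d (x n) ?p) \<longlonglongrightarrow> 0"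
      and y: "(\<lambda>n. d (y n) ?p) \<longlonglongrightarrow> 0" and eq: "\<forall>\<^sub>F n in sequentially. d (x n) o' = d (y n) o'"
    let ?P = "proj_off J"
    have lim: "x \<longlonglongrightarrow> ?p" "y \<longlonglongrightarrow> ?p" using conv[OF _ pM] xy x y by blast+
    have P_lim: "(\<lambda>n. ?P (z n)) \<longlonglongrightarrow> ?P ?p" if "z \<longlonglongrightarrow> ?p" for z
      unfolding proj_off_def by (intro tendsto_intros that)
    define T where "T n = turn (?P (x n)) (?P (y n))" for n
    have T: "T n \<in> orth ?A" for n unfolding T_def by (intro turn_orth proj_off J)
    have "(\<lambda>n. T n z) \<longlonglongrightarrow> turn (?P ?p) (?P ?p) z" for z
      unfolding T_def using Pp
      by (intro tendsto_turn P_lim lim) (simp_all flip: scaleR_2)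
    then have "tends_Isom (\<lambda>n. restrict (T n) M) (\<lambda>x. x)"
      using tends_iff[OF T, of "\<lambda>x. x"] by (simp add: turn_self)
    moreover have "\<forall>\<^sub>F n in sequentially. restrict (T n) M (x n) = y n"
      using eq
    proof eventually_elim
      case (elim n)
      \<comment> \<open>The components along J agree, so by Pythagoras the projections have equal
        norms and \<open>turn_apply\<close> is available.\<close>
      have D: "x n - y n \<in> sub ?A" "norm (x n) = norm (y n)" using sphere xy elim by blast+
      let ?q = "x n - ?P (x n)" and ?q' = "y n - ?P (y n)"
      have "?q - ?q' = (x n - y n) - (?P (x n) - ?P (y n))" by simp
      moreover have "(x n - y n) - (?P (x n) - ?P (y n)) \<in> sub ?A"
        by (intro sub_diff D(1) proj_off(1) J)
      ultimately have "?q - ?q' \<in> sub ?A" by (simp only:)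
      moreover have "?q - ?q' \<in> sub J" by (intro sub_diff proj_off(2) J)
      ultimately have "?q - ?q' = 0" by (rule sub_Int_disjoint) simp
      then have q: "?q = ?q'" by simp
      have pyth: "(norm z)\<^sup>2 = (norm (?P z))\<^sup>2 + (norm (z - ?P z))\<^sup>2" for z
      proof -
        have "?P z \<bullet> (z - ?P z) = 0"
          by (rule inner_sub_disjoint[OF proj_off(1)[OF J] proj_off(2)[OF J]]) simp
        then have "(norm (?P z + (z - ?P z)))\<^sup>2 = (norm (?P z))\<^sup>2 + (norm (z - ?P z))\<^sup>2"
          unfolding power2_norm_eq_inner inner_add_left inner_add_right by (simp add: inner_commute)
        then show ?thesis by simp
      qed
      have "(norm (?P (x n)))\<^sup>2 = (norm (?P (y n)))\<^sup>2"
        using pyth[of "x n"] pyth[of "y n"] D(2) q by simp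
      then have "norm (?P (x n)) = norm (?P (y n))" by simp
      then have "T n (?P (x n)) = ?P (y n)" unfolding T_def by (rule turn_apply)
      moreover have "T n ?q = ?q" by (rule orth_fix[OF T proj_off(2)[OF J]]) simp
      moreover have "T n (x n) = T n (?P (x n)) + T n ?q"
        using isometric_diff[OF orth_isometric[OF T], of n "x n" "?P (x n)"] by simp
      ultimately have "T n (x n) = y n" using q by simp
      then show ?case using xy by simp
    qed
    moreover have "restrict (T n) M \<in> carrier Isom \<and> restrict (T n) M o' = o'" for n
      using restr[OF T] o'(1) T_o[OF T] by simp
    ultimately show "\<exists>k. (\<forall>n. k n \<in> carrier Isom \<and> k n o' = o') \<and> tends_Isom k (\<lambda>x. x) \<and>
        (\<forall>\<^sub>F n in sequentially. k n (x n) = y n)"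
      by (intro exI[of _ "\<lambda>n. restrict (T n) M"]) simp
  qed
qed

section \<open>The Hilbert space\<close>

lemma expansion_sums: "(\<lambda>i. (x \<bullet> e i) *\<^sub>R e i) sums x"
proof -
  have "summable (\<lambda>i. (x \<bullet> e i) *\<^sub>R e i)"
    by (intro summable_orthonormal orthonormal_e Bessel)
  then obtain y where y: "(\<lambda>i. (x \<bullet> e i) *\<^sub>R e i) sums y" unfolding summable_def by blast
  have "y = x"
  proof (rule eqI)
    fix j
    have "(\<lambda>i. (x \<bullet> e i) * (e i \<bullet> e j)) sums (y \<bullet> e j)"
      using bounded_linear.sums[OF bounded_linear_inner_left[of "e j"] y] by simp
    moreover have "(\<lambda>i. (x \<bullet> e i) * (e i \<bullet> e j)) sums (x \<bullet> e j)"
      using sums_single[of j "\<lambda>i. x \<bullet> e i"] by (simp add: e_inner if_distrib cong: if_cong)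
    ultimately show "y \<bullet> e j = x \<bullet> e j" using sums_unique2 by blast
  qed
  then show ?thesis using y by simp
qed

lemma countable_dense:
  "\<exists>D :: 'a set. countable D \<and> (\<forall>x. \<forall>r>0. \<exists>q\<in>D. dist x q < r)"
proof -
  define F where "F l = (\<Sum>i<length l. real_of_rat (l ! i) *\<^sub>R e i)" for l
  have "\<exists>q\<in>range F. dist x q < r" if r: "r > 0" for x r
  proof -
    have "(\<lambda>n. \<Sum>i<n. (x \<bullet> e i) *\<^sub>R e i) \<longlonglongrightarrow> x" using expansion_sums by (simp add: sums_def)
    then obtain n where n: "dist (\<Sum>i<n. (x \<bullet> e i) *\<^sub>R e i) x < r / 2"
      using r LIMSEQ_iff_nz metric_LIMSEQ_D[of _ x "r / 2"] by (meson half_gt_zero le_refl)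
    define \<delta> where "\<delta> = r / (2 * (real n + 1))"
    have \<delta>: "\<delta> > 0" using r by (simp add: \<delta>_def)
    have "\<exists>q. \<bar>x \<bullet> e i - real_of_rat q\<bar> < \<delta>" for i
    proof -
      obtain q where "x \<bullet> e i < real_of_rat q" "real_of_rat q < x \<bullet> e i + \<delta>"
        using of_rat_dense[of "x \<bullet> e i" "x \<bullet> e i + \<delta>"] \<delta> by auto
      then show ?thesis by (intro exI[of _ q]) (simp add: abs_less_iff)
    qed
    then obtain q where q: "\<And>i. \<bar>x \<bullet> e i - real_of_rat (q i)\<bar> < \<delta>" by metis
    let ?l = "map q [0..<n]"
    have Fl: "F ?l = (\<Sum>i<n. real_of_rat (q i) *\<^sub>R e i)" by (simp add: F_def)
    have "norm ((\<Sum>i<n. (x \<bullet> e i) *\<^sub>R e i) - F ?l) =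
        norm (\<Sum>i<n. (x \<bullet> e i - real_of_rat (q i)) *\<^sub>R e i)"
      by (simp add: Fl sum_subtractf[symmetric] scaleR_diff_left)
    also have "\<dots> \<le> (\<Sum>i<n. norm ((x \<bullet> e i - real_of_rat (q i)) *\<^sub>R e i))" by (rule norm_sum)
    also have "\<dots> = (\<Sum>i<n. \<bar>x \<bullet> e i - real_of_rat (q i)\<bar>)"
      by (simp add: norm_eq_sqrt_inner[of "e _"] e_inner)
    also have "\<dots> \<le> (\<Sum>i<n. \<delta>)" using q by (intro sum_mono) (simp add: less_imp_le)
    also have "\<dots> \<le> r / 2" using r by (simp add: \<delta>_def field_simps)
    finally have "dist (\<Sum>i<n. (x \<bullet> e i) *\<^sub>R e i) (F ?l) \<le> r / 2" by (simp add: dist_norm)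
    then have "dist x (F ?l) < r"
      using n dist_triangle[of x "F ?l" "\<Sum>i<n. (x \<bullet> e i) *\<^sub>R e i"] by (simp add: dist_commute)
    then show ?thesis by blast
  qed
  moreover have "countable (range F)" by simp
  ultimately show ?thesis by blast
qed

lemma Isom_Hilbert_polish:
  "polish_group (isom_group (UNIV :: 'a set) dist) (pointwise_topology UNIV dist)"
proof -
  obtain D :: "'a set" where D: "countable D" "\<And>x r. r > 0 \<Longrightarrow> \<exists>q\<in>D. dist x q < r"
    using countable_dense by blast
  show ?thesis
  proof (rule Met_TC.Isom_polish[OF _ D(1)])
    show "Met_TC.mcomplete TYPE('a)" unfolding Met_TC.mcomplete_def
    proof (intro allI impI)
      fix \<sigma> :: "nat \<Rightarrow> 'a" assume "Met_TC.MCauchy \<sigma>"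
      then have "Cauchy \<sigma>" unfolding Met_TC.MCauchy_def Cauchy_def by auto
      then obtain x where "\<sigma> \<longlonglongrightarrow> x" by (auto simp: Cauchy_convergent_iff convergent_def)
      then have "limitin Met_TC.mtopology \<sigma> x sequentially"
        by simp
      then show "\<exists>x. limitin Met_TC.mtopology \<sigma> x sequentially" ..
    qed
  qed (use D(2) in auto)
qed

text \<open>Polarization expresses an inner product through the distance of the two vectors and
  their distances to 0.\<close>

lemma Isom_Hilbert_stabilizer:
  assumes g: "g \<in> carrier (isom_group (UNIV :: 'a set) dist)" and g0: "g 0 = 0"
  shows "g \<in> orth UNIV"
proof -
  have gd: "dist (g x) (g y) = dist x y" and bij: "bij g" for x y
    using g by (auto simp: isom_group_def Bij_def)
  have n: "norm (g x) = norm x" for x using gd[of x 0] g0 by simp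
  have pol: "x \<bullet> y = ((norm x)\<^sup>2 + (norm y)\<^sup>2 - (dist x y)\<^sup>2) / 2" for x y :: 'a
    by (simp add: power2_norm_eq_inner dist_norm inner_diff inner_commute)
  have "isometric g" unfolding isometric_def by (simp add: pol gd n)
  then show ?thesis using bij by (simp add: orth_def bij_is_surj)
qed

lemma orth_in_Isom_Hilbert:
  assumes "T \<in> orth UNIV" shows "T \<in> carrier (isom_group (UNIV :: 'a set) dist)"
proof -
  have "dist (T x) (T y) = dist x y" for x y
    using isometric_norm[OF orth_isometric[OF assms], of "x - y"]
      isometric_diff[OF orth_isometric[OF assms], of x y] by (simp add: dist_norm)
  then show ?thesis using orth_bij[OF assms] by (auto simp: isom_group_def Bij_def)
qed

text \<open>J is empty, and the translation by - \<open>e 0\<close> takes c = \<open>e 0\<close> to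
  the base point 0. The point on the unit circle with coordinate t along \<open>e 0\<close> has
  distance sqrt (2 - 2 t) from \<open>e 0\<close>, so distance r is reached at t = 1 - r^2 /
  2.\<close>

theorem Isom_Hilbert_automatic_continuity:
  "automatic_continuity TYPE('h) (isom_group (UNIV :: 'a set) dist) (pointwise_topology UNIV dist)"
  unfolding automatic_continuity_def
proof (intro allI impI, elim conjE)
  fix H :: "'h monoid" and S f
  assume H: "topological_group H S" and sep: "separable_space S"
    and f: "f \<in> hom (isom_group (UNIV :: 'a set) dist) H"
  have ee: "e 0 \<bullet> e (Suc 0) = 0" "e (Suc 0) \<bullet> e 0 = 0" "e 0 \<bullet> e 0 = 1" "e (Suc 0) \<bullet> e (Suc 0) = 1"
    by (simp_all add: e_inner)
  have dw: "dist (t *\<^sub>R e 0 + sqrt (1 - t\<^sup>2) *\<^sub>R e (Suc 0)) (e 0) = sqrt (2 - 2 * t)" if "\<bar>t\<bar> \<le> 1" for t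
  proof -
    have "t\<^sup>2 \<le> 1" using that by (simp add: abs_square_le_1)
    then have "(dist (t *\<^sub>R e 0 + sqrt (1 - t\<^sup>2) *\<^sub>R e (Suc 0)) (e 0))\<^sup>2 = 2 - 2 * t"
      by (simp add: dist_norm power2_norm_eq_inner inner_diff inner_add ee power2_eq_square[symmetric])
        (simp add: power2_eq_square algebra_simps)
    then show ?thesis by (metis real_sqrt_unique zero_le_dist)
  qed
  show "continuous_map (pointwise_topology UNIV dist) S f"
  proof (rule model_automatic_continuity[where J = "{}" and o' = 0 and b = "\<lambda>x. x - e 0"
        and c = "e 0" and \<sigma> = 1 and i = 0 and j = "Suc 0"])
    show "Metric_space (UNIV :: 'a set) dist" by unfold_locales (auto simp: dist_commute dist_triangle)
    show "metrizable_space (pointwise_topology (UNIV :: 'a set) dist)"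
      using Isom_Hilbert_polish completely_metrizable_imp_metrizable_space
      by (auto simp: polish_group_def)
    show "restrict T UNIV \<in> carrier (isom_group UNIV dist)" if "T \<in> orth (- {})" for T
      using orth_in_Isom_Hilbert[of T] that by (simp add: restrict_def)
    show "\<exists>T\<in>orth (- {}). g = restrict T UNIV" if "g \<in> carrier (isom_group UNIV dist)" "g 0 = 0" for g
      by (rule bexI[of _ g]) (use Isom_Hilbert_stabilizer[OF that] in \<open>simp_all add: restrict_def\<close>)
    show "x = 0" if "x \<in> sub {}" for x by (rule eqI) (use that in \<open>simp add: sub_def\<close>)
    show "(\<lambda>n. dist (x n) p) \<longlonglongrightarrow> 0 \<longleftrightarrow> x \<longlonglongrightarrow> p" for x :: "nat \<Rightarrow> 'a" and p
      by (rule tendsto_dist_iff[symmetric])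
    show "x - y \<in> sub (- {}) \<and> norm x = norm y" if "dist x 0 = dist y 0" for x y
      using that by (simp add: sub_def)
    show "\<exists>x\<in>UNIV. x - e i \<in> sub {}" for i by (intro bexI[of _ "e i"]) (simp_all add: sub_def)
    have "bij (\<lambda>x. x - e 0)" by (rule o_bij[of "\<lambda>x. x + e 0"]) (auto simp: fun_eq_iff)
    then show "(\<lambda>x. x - e 0) \<in> carrier (isom_group UNIV dist)"
      by (auto simp: isom_group_def Bij_def dist_norm)
    fix r :: "nat \<Rightarrow> real"
    assume r: "r \<longlonglongrightarrow> dist (e 0 - 1 *\<^sub>R e 0 + 1 *\<^sub>R e (Suc 0)) (e 0)"
    have "dist (e (Suc 0)) (e 0) = sqrt 2" using dw[of 0] by simp
    then have r2: "r \<longlonglongrightarrow> sqrt 2" using r by simp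
    define t where "t n = 1 - (r n)\<^sup>2 / 2" for n
    have "t \<longlonglongrightarrow> 1 - (sqrt 2)\<^sup>2 / 2" unfolding t_def[abs_def] by (intro tendsto_intros r2) simp
    then have t0: "t \<longlonglongrightarrow> 0" by simp
    have "\<forall>\<^sub>F n in sequentially. \<bar>t n\<bar> < 1"
      using order_tendstoD(2)[OF tendsto_rabs_zero[OF t0], of 1] by simp
    moreover have "\<forall>\<^sub>F n in sequentially. r n > 0" using order_tendstoD(1)[OF r2, of 0] by simp
    ultimately have "\<forall>\<^sub>F n in sequentially.
        dist (e 0 - 1 *\<^sub>R e 0 + 1 *\<^sub>R (t n *\<^sub>R e 0 + sqrt (1 - (t n)\<^sup>2) *\<^sub>R e (Suc 0))) (e 0) = r n"
    proof eventually_elim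
      case (elim n)
      have "sqrt (2 - 2 * t n) = r n" using elim(2) by (simp add: t_def)
      then show ?case using dw[of "t n"] elim(1) by simp
    qed
    then show "\<exists>t. t \<longlonglongrightarrow> 0 \<and> (\<forall>\<^sub>F n in sequentially.
        dist (e 0 - 1 *\<^sub>R e 0 + 1 *\<^sub>R (t n *\<^sub>R e 0 + sqrt (1 - (t n)\<^sup>2) *\<^sub>R e (Suc 0))) (e 0) = r n)"
      using t0 by blast
  qed (use H sep f in \<open>simp_all add: sub_def\<close>)
qed

section \<open>Hyperbolic space\<close>

abbreviation "hyp \<equiv> hyp_space e"
abbreviation "hdist \<equiv> hyp_dist e"
abbreviation "hform \<equiv> hyp_form e"

lemma hyp_iff: "x \<in> hyp \<longleftrightarrow> 2 * (x \<bullet> e 0)\<^sup>2 - x \<bullet> x = 1 \<and> x \<bullet> e 0 > 0"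
  by (simp add: hyp_space_def hyp_quad_eq[OF basis])

lemma hform_eq: "hform x y = 2 * (x \<bullet> e 0) * (y \<bullet> e 0) - x \<bullet> y"
  by (rule hyp_form_eq[OF basis])

lemma e0_hyp: "e 0 \<in> hyp"
  by (simp add: hyp_iff e_inner)

lemma hdist_nonneg: "hdist x y \<ge> 0"
  using Metric_space.nonneg[OF Metric_space_hyp[OF basis]] .

lemma hdist_eq_iff:
  assumes "x \<in> hyp" "y \<in> hyp" "x' \<in> hyp" "y' \<in> hyp"
  shows "hdist x y = hdist x' y' \<longleftrightarrow> hform x y = hform x' y'"
proof
  assume "hdist x y = hdist x' y'"
  then show "hform x y = hform x' y'"
    using cosh_hyp_dist[OF basis assms(1,2)] cosh_hyp_dist[OF basis assms(3,4)] by simp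
qed (simp add: hyp_dist_def assms)

lemma cosh_hdist_base: "x \<in> hyp \<Longrightarrow> cosh (hdist x (e 0)) = x \<bullet> e 0"
  using cosh_hyp_dist[OF basis _ e0_hyp, of x] by (simp add: hform_eq e_inner)

text \<open>Norm distance is governed by hyperbolic distance and the difference of heights along
  \<open>e 0\<close>; heights are in turn cosh of the distance to \<open>e 0\<close>. Convergence
  and completeness are compared through this identity.\<close>

lemma norm_diff_hyp:
  assumes "x \<in> hyp" "y \<in> hyp"
  shows "(norm (x - y))\<^sup>2 = 2 * (x \<bullet> e 0 - y \<bullet> e 0)\<^sup>2 + 2 * (cosh (hdist x y) - 1)"
proof -
  have "(norm (x - y))\<^sup>2 = x \<bullet> x + y \<bullet> y - 2 * (x \<bullet> y)"
    by (simp add: power2_norm_eq_inner inner_diff inner_commute)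
  then show ?thesis
    using assms unfolding cosh_hyp_dist[OF basis assms]
    by (simp add: hform_eq hyp_iff power2_eq_square algebra_simps)
qed

lemma hyp_tendsto_iff:
  assumes x: "\<And>n::nat. x n \<in> hyp" and p: "p \<in> hyp"
  shows "(\<lambda>n. hdist (x n) p) \<longlonglongrightarrow> 0 \<longleftrightarrow> x \<longlonglongrightarrow> p"
proof
  interpret Hyp: Metric_space hyp hdist by (rule Metric_space_hyp[OF basis])
  assume d: "(\<lambda>n. hdist (x n) p) \<longlonglongrightarrow> 0"
  have "(\<lambda>n. hdist (x n) (e 0) - hdist p (e 0)) \<longlonglongrightarrow> 0"
  proof (rule Lim_null_comparison[OF always_eventually d], rule allI)
    show "norm (hdist (x n) (e 0) - hdist p (e 0)) \<le> hdist (x n) p" for n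
      using Hyp.d_diff_le[OF x[of n] e0_hyp p e0_hyp] e0_hyp by simp
  qed
  then have "(\<lambda>n. hdist (x n) (e 0)) \<longlonglongrightarrow> hdist p (e 0)" by (simp add: LIM_zero_iff)
  then have "(\<lambda>n. cosh (hdist (x n) (e 0))) \<longlonglongrightarrow> cosh (hdist p (e 0))" by (rule tendsto_cosh)
  then have x0: "(\<lambda>n. x n \<bullet> e 0) \<longlonglongrightarrow> p \<bullet> e 0" by (simp add: cosh_hdist_base x p)
  have "(\<lambda>n. 2 * (x n \<bullet> e 0 - p \<bullet> e 0)\<^sup>2 + 2 * (cosh (hdist (x n) p) - 1)) \<longlonglongrightarrow>
      2 * (p \<bullet> e 0 - p \<bullet> e 0)\<^sup>2 + 2 * (cosh 0 - 1)"
    by (intro tendsto_intros x0 tendsto_cosh d)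
  then have "(\<lambda>n. (norm (x n - p))\<^sup>2) \<longlonglongrightarrow> 0" by (simp add: norm_diff_hyp[OF x p])
  then have "(\<lambda>n. sqrt ((norm (x n - p))\<^sup>2)) \<longlonglongrightarrow> sqrt 0" by (rule tendsto_real_sqrt)
  then have "(\<lambda>n. norm (x n - p)) \<longlonglongrightarrow> 0" by simp
  then show "x \<longlonglongrightarrow> p" by (simp add: tendsto_norm_zero_iff LIM_zero_iff)
next
  assume lim: "x \<longlonglongrightarrow> p"
  have "(\<lambda>n. hform (x n) p) \<longlonglongrightarrow> hform p p"
    unfolding hform_eq by (intro tendsto_intros lim)
  moreover have "hform p p = 1" using p by (simp add: hform_eq hyp_iff power2_eq_square)
  ultimately have "(\<lambda>n. hform (x n) p) \<longlonglongrightarrow> 1" by simp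
  \<comment> \<open>This closed formula for arcosh is continuous at 1, the end point of the
    domain.\<close>
  then have "(\<lambda>n. ln (hform (x n) p + sqrt ((hform (x n) p)\<^sup>2 - 1))) \<longlonglongrightarrow> ln (1 + sqrt (1\<^sup>2 - 1))"
    by (intro tendsto_intros) simp_all
  moreover have "hdist (x n) p = ln (hform (x n) p + sqrt ((hform (x n) p)\<^sup>2 - 1))" for n
    using hyp_form_ge_1(1)[OF basis x p, of n] x p by (simp add: hyp_dist_def arcosh_real_def)
  ultimately show "(\<lambda>n. hdist (x n) p) \<longlonglongrightarrow> 0" by simp
qed

text \<open>The global chart: the hyperboloid is the graph of sqrt (1 + v \<bullet> v) over
  \<open>sub (- {0})\<close>.\<close>

definition hlift :: "'a \<Rightarrow> 'a" where
  "hlift v = sqrt (1 + v \<bullet> v) *\<^sub>R e 0 + v"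

lemma hlift_coord: "v \<in> sub (- {0}) \<Longrightarrow> hlift v \<bullet> e 0 = sqrt (1 + v \<bullet> v)"
  using subD[of v "- {0}" 0] by (simp add: hlift_def inner_add e_inner)

lemma hlift_inner:
  assumes "v \<in> sub (- {0})" "w \<in> sub (- {0})"
  shows "hlift v \<bullet> hlift w = sqrt (1 + v \<bullet> v) * sqrt (1 + w \<bullet> w) + v \<bullet> w"
  using subD[OF assms(1), of 0] subD[OF assms(2), of 0]
  by (simp add: hlift_def inner_add e_inner inner_commute)

lemma hlift_hyp: "v \<in> sub (- {0}) \<Longrightarrow> hlift v \<in> hyp"
  by (simp add: hyp_iff hlift_coord hlift_inner add_pos_nonneg flip: power2_eq_square)

lemma hyp_eq_hlift:
  assumes x: "x \<in> hyp" shows "x = hlift (x - (x \<bullet> e 0) *\<^sub>R e 0)"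
proof -
  let ?v = "x - (x \<bullet> e 0) *\<^sub>R e 0"
  have "1 + ?v \<bullet> ?v = (x \<bullet> e 0)\<^sup>2"
    using x by (simp add: hyp_iff inner_diff e_inner inner_commute power2_eq_square algebra_simps)
  then have "sqrt (1 + ?v \<bullet> ?v) = x \<bullet> e 0" using x by (simp add: hyp_iff)
  then show ?thesis by (simp add: hlift_def)
qed

lemma proj_sub: "x - (x \<bullet> e 0) *\<^sub>R e 0 \<in> sub (- {0})"
  by (simp add: sub_def inner_diff e_inner)

lemma tendsto_hlift: "(v \<longlongrightarrow> u) F \<Longrightarrow> ((\<lambda>n. hlift (v n)) \<longlongrightarrow> hlift u) F"
  unfolding hlift_def by (intro tendsto_intros)

text \<open>Along a Cauchy sequence the distances to \<open>e 0\<close> converge, hence so do the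
  heights, and \<open>norm_diff_hyp\<close> gives a Cauchy sequence in norm. The limit stays on the
  upper sheet because its height is again a cosh.\<close>

lemma hyp_complete: "Metric_space.mcomplete hyp hdist"
proof -
  interpret Hyp: Metric_space hyp hdist by (rule Metric_space_hyp[OF basis])
  show ?thesis unfolding Hyp.mcomplete_def
  proof (intro allI impI)
    fix \<sigma> assume C: "Hyp.MCauchy \<sigma>"
    have \<sigma>: "\<sigma> n \<in> hyp" for n using C by (auto simp: Hyp.MCauchy_def)
    have Cd: "\<exists>N. \<forall>m\<ge>N. \<forall>n\<ge>N. hdist (\<sigma> m) (\<sigma> n) < r" if "r > 0" for r
      using C that unfolding Hyp.MCauchy_def by meson
    have "Cauchy (\<lambda>n. hdist (\<sigma> n) (e 0))"
    proof (rule CauchyI)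
      fix r :: real assume "r > 0"
      then obtain N where N: "\<forall>m\<ge>N. \<forall>n\<ge>N. hdist (\<sigma> m) (\<sigma> n) < r" using Cd by blast
      have "norm (hdist (\<sigma> m) (e 0) - hdist (\<sigma> n) (e 0)) < r" if "m \<ge> N" "n \<ge> N" for m n
        using Hyp.d_diff_le[OF \<sigma>[of m] e0_hyp \<sigma>[of n] e0_hyp] e0_hyp N[rule_format, OF that] by simp
      then show "\<exists>M. \<forall>m\<ge>M. \<forall>n\<ge>M. norm (hdist (\<sigma> m) (e 0) - hdist (\<sigma> n) (e 0)) < r" by blast
    qed
    then obtain a where "(\<lambda>n. hdist (\<sigma> n) (e 0)) \<longlonglongrightarrow> a"
      by (auto simp: Cauchy_convergent_iff convergent_def)
    then have "(\<lambda>n. cosh (hdist (\<sigma> n) (e 0))) \<longlonglongrightarrow> cosh a" by (rule tendsto_cosh)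
    then have x0: "(\<lambda>n. \<sigma> n \<bullet> e 0) \<longlonglongrightarrow> cosh a" by (simp add: cosh_hdist_base \<sigma>)
    have "Cauchy \<sigma>"
    proof (rule CauchyI)
      fix r :: real assume r: "r > 0"
      \<comment> \<open>The two terms of \<open>norm_diff_hyp\<close> are then bounded by 2 (r /
        4)^2 + 2 s = 3 r^2 / 8.\<close>
      define s where "s = r\<^sup>2 / 8"
      have s: "s > 0" using r by (simp add: s_def)
      have "isCont cosh (0::real)" by (intro continuous_intros)
      then have "\<exists>\<delta>>0. \<forall>y. dist y (0::real) < \<delta> \<longrightarrow> dist (cosh y) (cosh 0) < s"
        using s unfolding continuous_at_eps_delta by blast
      then obtain \<delta> where \<delta>: "\<delta> > 0" "\<And>y. \<bar>y\<bar> < \<delta> \<Longrightarrow> \<bar>cosh y - 1\<bar> < s"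
        by (auto simp: dist_real_def)
      obtain N1 where N1: "\<forall>m\<ge>N1. \<forall>n\<ge>N1. hdist (\<sigma> m) (\<sigma> n) < \<delta>" using Cd[OF \<delta>(1)] by blast
      have "Cauchy (\<lambda>n. \<sigma> n \<bullet> e 0)" using x0 by (rule LIMSEQ_imp_Cauchy)
      then obtain N2 where N2: "\<forall>m\<ge>N2. \<forall>n\<ge>N2. norm (\<sigma> m \<bullet> e 0 - \<sigma> n \<bullet> e 0) < r / 4"
        using CauchyD[of _ "r / 4"] r
          by (metis (no_types, lifting) zero_less_divide_iff zero_less_numeral)
      have "norm (\<sigma> m - \<sigma> n) < r" if mn: "m \<ge> max N1 N2" "n \<ge> max N1 N2" for m n
      proof -
        have "\<bar>\<sigma> m \<bullet> e 0 - \<sigma> n \<bullet> e 0\<bar> < r / 4" using N2 mn by simp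
        then have "(\<sigma> m \<bullet> e 0 - \<sigma> n \<bullet> e 0)\<^sup>2 < (r / 4)\<^sup>2"
          using r by (metis abs_of_pos abs_less_iff power2_abs power_strict_mono abs_ge_zero zero_less_numeral)
        moreover have "\<bar>hdist (\<sigma> m) (\<sigma> n)\<bar> < \<delta>" using N1 mn hdist_nonneg by simp
        then have "cosh (hdist (\<sigma> m) (\<sigma> n)) - 1 < s" using \<delta>(2) by fastforce
        ultimately have "(norm (\<sigma> m - \<sigma> n))\<^sup>2 < 2 * (r / 4)\<^sup>2 + 2 * s"
          unfolding norm_diff_hyp[OF \<sigma> \<sigma>] by (intro add_strict_mono mult_strict_left_mono) auto
        also have "\<dots> \<le> r\<^sup>2" by (simp add: s_def power2_eq_square)
        finally show ?thesis using r by (simp add: power_less_imp_less_base)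
      qed
      then show "\<exists>M. \<forall>m\<ge>M. \<forall>n\<ge>M. norm (\<sigma> m - \<sigma> n) < r" by blast
    qed
    then obtain x where x: "\<sigma> \<longlonglongrightarrow> x" by (auto simp: Cauchy_convergent_iff convergent_def)
    have "(\<lambda>n. 2 * (\<sigma> n \<bullet> e 0)\<^sup>2 - \<sigma> n \<bullet> \<sigma> n) \<longlonglongrightarrow> 2 * (x \<bullet> e 0)\<^sup>2 - x \<bullet> x"
      by (intro tendsto_intros x)
    moreover have "2 * (\<sigma> n \<bullet> e 0)\<^sup>2 - \<sigma> n \<bullet> \<sigma> n = 1" for n using \<sigma>[of n] by (simp add: hyp_iff)
    ultimately have "2 * (x \<bullet> e 0)\<^sup>2 - x \<bullet> x = 1" by (simp add: LIMSEQ_const_iff)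
    moreover have "(\<lambda>n. \<sigma> n \<bullet> e 0) \<longlonglongrightarrow> x \<bullet> e 0" by (intro tendsto_intros x)
    then have "x \<bullet> e 0 = cosh a" using x0 LIMSEQ_unique by blast
    then have "x \<bullet> e 0 > 0" by simp
    ultimately have xh: "x \<in> hyp" by (simp add: hyp_iff)
    then have "limitin Hyp.mtopology \<sigma> x sequentially"
      using hyp_tendsto_iff[OF \<sigma> xh] x \<sigma> by (simp add: Hyp.limitin_metric_dist_null)
    then show "\<exists>x. limitin Hyp.mtopology \<sigma> x sequentially" ..
  qed
qed

text \<open>The map \<rho> adjusts the height so that the point falls on the hyperboloid. It is
  continuous and restricts to the identity there, so it carries a dense set to a dense set.\<close>

lemma hyp_countable_dense:
  "\<exists>D. countable D \<and> D \<subseteq> hyp \<and> (\<forall>x\<in>hyp. \<forall>r>0. \<exists>q\<in>D. hdist x q < r)"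
proof -
  interpret Hyp: Metric_space hyp hdist by (rule Metric_space_hyp[OF basis])
  obtain D :: "'a set" where D: "countable D" "\<And>x r. r > 0 \<Longrightarrow> \<exists>q\<in>D. dist x q < r"
    using countable_dense by blast
  define \<rho> where "\<rho> x = hlift (x - (x \<bullet> e 0) *\<^sub>R e 0)" for x
  have \<rho>: "\<rho> x \<in> hyp" for x unfolding \<rho>_def by (rule hlift_hyp[OF proj_sub])
  have "\<exists>q\<in>\<rho> ` D. hdist x q < r" if x: "x \<in> hyp" and r: "r > 0" for x r
  proof -
    have "\<forall>n. \<exists>q. q \<in> D \<and> dist x q < inverse (real (Suc n))"
      using D(2) by (meson inverse_positive_iff_positive of_nat_0_less_iff zero_less_Suc)
    from choice[OF this] obtain q where q: "\<forall>n. q n \<in> D \<and> dist x (q n) < inverse (real (Suc n))" ..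
    have "q \<longlonglongrightarrow> x"
    proof (rule tendsto_dist_iff[THEN iffD2], rule tendsto_sandwich[OF _ _ tendsto_const LIMSEQ_inverse_real_of_nat])
      show "\<forall>\<^sub>F n in sequentially. 0 \<le> dist (q n) x" by simp
      show "\<forall>\<^sub>F n in sequentially. dist (q n) x \<le> inverse (real (Suc n))"
        using q by (intro always_eventually allI) (simp add: dist_commute less_imp_le)
    qed
    then have "(\<lambda>n. \<rho> (q n)) \<longlonglongrightarrow> \<rho> x" unfolding \<rho>_def by (intro tendsto_hlift tendsto_intros)
    then have "(\<lambda>n. \<rho> (q n)) \<longlonglongrightarrow> x" using hyp_eq_hlift[OF x] by (simp add: \<rho>_def)
    then have "(\<lambda>n. hdist (\<rho> (q n)) x) \<longlonglongrightarrow> 0" using hyp_tendsto_iff[OF \<rho> x] by simp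
    then have "\<forall>\<^sub>F n in sequentially. hdist (\<rho> (q n)) x < r" using r by (rule order_tendstoD(2))
    then obtain n where "hdist (\<rho> (q n)) x < r"
      using eventually_happens' sequentially_bot by blast
    then show ?thesis using q by (auto simp: Hyp.commute)
  qed
  then show ?thesis using D(1) \<rho> by (intro exI[of _ "\<rho> ` D"]) auto
qed

lemma Isom_hyp_polish: "polish_group (isom_group hyp hdist) (pointwise_topology hyp hdist)"
proof -
  interpret Hyp: Metric_space hyp hdist by (rule Metric_space_hyp[OF basis])
  obtain D where D: "countable D" "D \<subseteq> hyp" "\<forall>x\<in>hyp. \<forall>r>0. \<exists>q\<in>D. hdist x q < r"
    using hyp_countable_dense by blast
  show ?thesis by (rule Hyp.Isom_polish[OF hyp_complete D(1,2)]) (use D(3) in blast)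
qed

section \<open>Isometries of the hyperboloid: the stabilizer of the base point and a boost\<close>

lemma Isom_hypI:
  assumes "\<And>x. x \<in> hyp \<Longrightarrow> g x \<in> hyp" "\<And>x. x \<in> hyp \<Longrightarrow> h x \<in> hyp"
    and "\<And>x. x \<in> hyp \<Longrightarrow> h (g x) = x" "\<And>x. x \<in> hyp \<Longrightarrow> g (h x) = x"
    and "\<And>x y. x \<in> hyp \<Longrightarrow> y \<in> hyp \<Longrightarrow> hform (g x) (g y) = hform x y"
  shows "restrict g hyp \<in> carrier (isom_group hyp hdist)"
proof -
  have "bij_betw (restrict g hyp) hyp hyp"
    by (rule bij_betwI[where g = h]) (use assms(1-4) in auto)
  moreover have "hdist (g x) (g y) = hdist x y" if "x \<in> hyp" "y \<in> hyp" for x y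
    using hdist_eq_iff[OF assms(1)[OF that(1)] assms(1)[OF that(2)] that] assms(5)[OF that] by simp
  ultimately show ?thesis by (simp add: isom_group_def Bij_def)
qed

lemma orth_in_Isom_hyp:
  assumes T: "T \<in> orth (- {0})" shows "restrict T hyp \<in> carrier (isom_group hyp hdist)"
proof (rule Isom_hypI[where h = "adj T"])
  have c: "S x \<bullet> e 0 = x \<bullet> e 0" if "S \<in> orth (- {0})" for S x by (rule orth_coord[OF that]) simp
  note T' = orth_inv[OF T]
  show "T x \<in> hyp" "adj T x \<in> hyp" if "x \<in> hyp" for x
    using that by (simp_all add: hyp_iff c[OF T] c[OF T'] orth_inner[OF T] orth_inner[OF T'])
  show "hform (T x) (T y) = hform x y" for x y by (simp add: hform_eq c[OF T] orth_inner[OF T])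
qed (simp_all add: orth_inv_left[OF T] orth_inv_right[OF T])

text \<open>Heights are values of the form at \<open>e 0\<close>, so g preserves them and therefore
  also the inner products of the parts perpendicular to \<open>e 0\<close>. Read in the chart
  \<open>hlift\<close>, g is an isometric map of \<open>sub (- {0})\<close>, and T adds the identity
  along \<open>e 0\<close>.\<close>

lemma Isom_hyp_stabilizer:
  assumes g: "g \<in> carrier (isom_group hyp hdist)" and g0: "g (e 0) = e 0"
  shows "\<exists>T\<in>orth (- {0}). g = restrict T hyp"
proof -
  interpret Hyp: Metric_space hyp hdist by (rule Metric_space_hyp[OF basis])
  have gh: "g x \<in> hyp" if "x \<in> hyp" for x by (rule Hyp.Isom_in[OF g that])
  have gform: "hform (g x) (g y) = hform x y" if "x \<in> hyp" "y \<in> hyp" for x y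
    using Hyp.Isom_d[OF g that] hdist_eq_iff[OF gh[OF that(1)] gh[OF that(2)] that] by simp
  have gc: "g x \<bullet> e 0 = x \<bullet> e 0" if "x \<in> hyp" for x
    using gform[OF that e0_hyp] by (simp add: g0 hform_eq e_inner)
  define P where "P x = x - (x \<bullet> e 0) *\<^sub>R e 0" for x
  have P: "P x \<in> sub (- {0})" for x unfolding P_def by (rule proj_sub)
  have P_inner: "P x \<bullet> P y = x \<bullet> y - (x \<bullet> e 0) * (y \<bullet> e 0)" for x y
    by (simp add: P_def inner_diff e_inner inner_commute)
  define T where "T x = (x \<bullet> e 0) *\<^sub>R e 0 + P (g (hlift (P x)))" for x
  have T0: "T x \<bullet> e 0 = x \<bullet> e 0" for x
    using subD[OF P, of 0] by (simp add: T_def inner_add e_inner)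
  have TP: "P (T x) = P (g (hlift (P x)))" for x
    by (simp add: P_def[of "T x"] T0) (simp add: T_def)
  have "isometric T" unfolding isometric_def
  proof (intro allI)
    fix x y
    let ?x = "hlift (P x)" and ?y = "hlift (P y)"
    have h: "?x \<in> hyp" "?y \<in> hyp" by (intro hlift_hyp P)+
    have "g ?x \<bullet> g ?y = ?x \<bullet> ?y" using gform[OF h] by (simp add: hform_eq gc h)
    then have "P (g ?x) \<bullet> P (g ?y) = P x \<bullet> P y"
      by (simp add: P_inner[of "g _" "g _"] gc h hlift_coord[OF P] hlift_inner[OF P P])
    then have "P (T x) \<bullet> P (T y) = P x \<bullet> P y" by (simp add: TP)
    then show "T x \<bullet> T y = x \<bullet> y" by (simp add: P_inner T0)
  qed
  moreover have "y \<in> range T" for y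
  proof -
    have "hlift (P y) \<in> hyp" by (intro hlift_hyp P)
    moreover have "g ` hyp = hyp" using g by (simp add: Hyp.Isom_iff bij_betw_def)
    ultimately obtain z where z: "z \<in> hyp" "g z = hlift (P y)" by (metis imageE)
    have zP: "hlift (P z) = z" using hyp_eq_hlift[OF z(1)] by (simp add: P_def)
    let ?x = "(y \<bullet> e 0) *\<^sub>R e 0 + P z"
    have x0: "?x \<bullet> e 0 = y \<bullet> e 0" using subD[OF P, of 0 z] by (simp add: inner_add e_inner)
    then have "P ?x = P z" by (simp add: P_def[of ?x])
    moreover have "P (hlift v) = v" if "v \<in> sub (- {0})" for v
      unfolding P_def[of "hlift v"] hlift_coord[OF that] by (simp add: hlift_def)
    ultimately have "T ?x = (y \<bullet> e 0) *\<^sub>R e 0 + P y"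
      unfolding T_def x0 by (simp add: zP z(2) P)
    then have "T ?x = y" by (simp add: P_def)
    then show ?thesis by (metis rangeI)
  qed
  moreover have "T (e 0) = e 0"
  proof -
    have "P (e 0) = 0" by (simp add: P_def e_inner)
    moreover have "hlift 0 = e 0" by (simp add: hlift_def)
    ultimately show ?thesis by (simp add: T_def g0 e_inner)
  qed
  ultimately have "T \<in> orth (- {0})" by (auto simp: orth_def)
  moreover have "g x = T x" if x: "x \<in> hyp" for x
  proof -
    have "hlift (P x) = x" using hyp_eq_hlift[OF x] by (simp add: P_def)
    then show ?thesis by (simp add: T_def P_def[of "g x"] gc[OF x])
  qed
  then have "g = restrict T hyp"
    using g by (intro extensionalityI[of _ hyp]) (auto simp: Hyp.Isom_iff)
  ultimately show ?thesis by blast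
qed

text \<open>The hyperbolic rotation in the plane of \<open>e 0\<close> and \<open>e 1\<close> with
  cosh = 5/4 and sinh = q, where q is 3/4 or -3/4, written as the identity plus a correction. The
  3-4-5 triple keeps all coefficients rational.\<close>

definition boost :: "real \<Rightarrow> 'a \<Rightarrow> 'a" where
  "boost q x = x + ((1/4) * (x \<bullet> e 0) + q * (x \<bullet> e 1)) *\<^sub>R e 0
     + (q * (x \<bullet> e 0) + (1/4) * (x \<bullet> e 1)) *\<^sub>R e 1"

lemma boost_coord:
  "boost q x \<bullet> e 0 = (5/4) * (x \<bullet> e 0) + q * (x \<bullet> e 1)"
  "boost q x \<bullet> e 1 = q * (x \<bullet> e 0) + (5/4) * (x \<bullet> e 1)"
  by (simp_all add: boost_def inner_add e_inner algebra_simps)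

lemma boost_inner:
  "boost q x \<bullet> y = x \<bullet> y + ((1/4) * (x \<bullet> e 0) + q * (x \<bullet> e 1)) * (y \<bullet> e 0)
     + (q * (x \<bullet> e 0) + (1/4) * (x \<bullet> e 1)) * (y \<bullet> e 1)"
  by (simp add: boost_def inner_add inner_commute)

lemma boost_form:
  assumes q: "q * q = 9/16" shows "hform (boost q x) (boost q y) = hform x y"
proof -
  have "boost q x \<bullet> boost q y = boost q y \<bullet> x + ((1/4) * (x \<bullet> e 0) + q * (x \<bullet> e 1)) * (boost q y \<bullet> e 0)
     + (q * (x \<bullet> e 0) + (1/4) * (x \<bullet> e 1)) * (boost q y \<bullet> e 1)"
    unfolding boost_inner[of q x "boost q y"] by (simp add: inner_commute)
  then have "boost q x \<bullet> boost q y = x \<bullet> y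
      + ((q * q + 9/16) * ((x \<bullet> e 0) * (y \<bullet> e 0)) + (q * q + 9/16) * ((x \<bullet> e 1) * (y \<bullet> e 1)))
      + (5/2) * q * ((x \<bullet> e 0) * (y \<bullet> e 1) + (x \<bullet> e 1) * (y \<bullet> e 0))"
    unfolding boost_inner[of q y x] boost_coord by (simp add: inner_commute[of y x] algebra_simps)
  moreover have "(boost q x \<bullet> e 0) * (boost q y \<bullet> e 0) =
      (25/16) * ((x \<bullet> e 0) * (y \<bullet> e 0)) + (q * q) * ((x \<bullet> e 1) * (y \<bullet> e 1))
      + (5/4) * q * ((x \<bullet> e 0) * (y \<bullet> e 1) + (x \<bullet> e 1) * (y \<bullet> e 0))"
    unfolding boost_coord by (simp add: algebra_simps)
  ultimately show ?thesis
    unfolding hform_eq by (simp add: q algebra_simps)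
qed

lemma boost_inverse:
  assumes q: "q * q = 9/16" shows "boost (- q) (boost q x) = x"
proof -
  have a: "(1/4) * (boost q x \<bullet> e 0) + - q * (boost q x \<bullet> e 1) = - ((1/4) * (x \<bullet> e 0) + q * (x \<bullet> e 1))"
    and b: "- q * (boost q x \<bullet> e 0) + (1/4) * (boost q x \<bullet> e 1) = - (q * (x \<bullet> e 0) + (1/4) * (x \<bullet> e 1))"
  proof -
    define x0 x1 where "x0 = x \<bullet> e 0" and "x1 = x \<bullet> e 1"
    have "(1/4) * ((5/4) * x0 + q * x1) + - q * (q * x0 + (5/4) * x1) = (5/16 - q * q) * x0 - q * x1"
      "- q * ((5/4) * x0 + q * x1) + (1/4) * (q * x0 + (5/4) * x1) = (5/16 - q * q) * x1 - q * x0"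
      by (simp_all only: algebra_simps) simp_all
    then show "(1/4) * (boost q x \<bullet> e 0) + - q * (boost q x \<bullet> e 1) = - ((1/4) * (x \<bullet> e 0) + q * (x \<bullet> e 1))"
      "- q * (boost q x \<bullet> e 0) + (1/4) * (boost q x \<bullet> e 1) = - (q * (x \<bullet> e 0) + (1/4) * (x \<bullet> e 1))"
      unfolding boost_coord x0_def[symmetric] x1_def[symmetric] q by simp_all
  qed
  have cancel: "x + u + w + - u + - w = x" for u w :: 'a by simp
  show ?thesis
    unfolding boost_def[of "- q" "boost q x"] a b scaleR_minus_left
    unfolding boost_def by (rule cancel)
qed

text \<open>The height of the image is the value of the form at x and ?c, a point of the
  hyperboloid, hence at least 1; this excludes the lower sheet.\<close>

lemma boost_hyp:
  assumes q: "q * q = 9/16" and x: "x \<in> hyp" shows "boost q x \<in> hyp"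
proof -
  let ?c = "(5/4) *\<^sub>R e 0 - q *\<^sub>R e 1"
  have "?c \<in> hyp" using q by (simp add: hyp_iff inner_diff e_inner power2_eq_square)
  then have "hform x ?c \<ge> 1" by (rule hyp_form_ge_1(1)[OF basis x])
  moreover have "hform x ?c = boost q x \<bullet> e 0"
    by (simp add: hform_eq boost_coord inner_diff e_inner)
  moreover have "hform (boost q x) (boost q x) = 1"
    using x by (simp add: boost_form[OF q]) (simp add: hform_eq hyp_iff power2_eq_square)
  ultimately show ?thesis by (simp add: hyp_iff hform_eq power2_eq_square)
qed

text \<open>The point c is the image of \<open>e 0\<close> under the inverse boost, so b takes it
  back to \<open>e 0\<close>; its part perpendicular to \<open>e 0\<close> is -3/4 times
  \<open>e 1\<close>, whence \<sigma>. Turning that part towards \<open>e 2\<close> gives the form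
  value 25/16 - 9/16 t, and equating it with cosh r determines t.\<close>

theorem Isom_hyp_automatic_continuity:
  "automatic_continuity TYPE('h) (isom_group hyp hdist) (pointwise_topology hyp hdist)"
  unfolding automatic_continuity_def
proof (intro allI impI, elim conjE)
  fix H :: "'h monoid" and S f
  assume H: "topological_group H S" and sep: "separable_space S"
    and f: "f \<in> hom (isom_group hyp hdist) H"
  interpret Hyp: Metric_space hyp hdist by (rule Metric_space_hyp[OF basis])
  let ?c = "(5/4) *\<^sub>R e 0 - (3/4) *\<^sub>R e 1"
  let ?v = "\<lambda>t. ?c - (- (3/4)) *\<^sub>R e 1 + (- (3/4)) *\<^sub>R (t *\<^sub>R e 1 + sqrt (1 - t\<^sup>2) *\<^sub>R e 2)"
  have q: "(3/4 :: real) * (3/4) = 9/16" "(- (3/4) :: real) * (- (3/4)) = 9/16" by simp_all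
  have c: "?c \<in> hyp" by (simp add: hyp_iff inner_diff e_inner power2_eq_square)
  have v: "?v t \<in> hyp" "hform (?v t) ?c = 25/16 - 9/16 * t" if "\<bar>t\<bar> \<le> 1" for t
  proof -
    have t: "t\<^sup>2 \<le> 1" using that by (simp add: abs_square_le_1)
    define s where "s = sqrt (1 - t\<^sup>2)"
    have v': "?v t = (5/4) *\<^sub>R e 0 - (3/4 * t) *\<^sub>R e 1 - (3/4 * s) *\<^sub>R e 2"
      by (simp add: s_def algebra_simps)
    have ss: "s * s = 1 - t * t" using t by (simp add: s_def power2_eq_square)
    have vv: "?v t \<bullet> ?v t = 25/16 + 9/16 * (t * t) + 9/16 * (s * s)" "?v t \<bullet> e 0 = 5/4"
      unfolding v' by (simp_all add: inner_diff e_inner)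
    show "?v t \<in> hyp" unfolding hyp_iff vv ss by (simp add: power2_eq_square field_simps)
    show "hform (?v t) ?c = 25/16 - 9/16 * t"
      unfolding v' by (simp add: hform_eq inner_diff e_inner algebra_simps)
  qed
  show "continuous_map (pointwise_topology hyp hdist) S f"
  proof (rule model_automatic_continuity[where J = "{0}" and o' = "e 0" and b = "restrict (boost (3/4)) hyp"
        and c = ?c and \<sigma> = "- (3/4)" and i = 1 and j = 2])
    show "Metric_space hyp hdist" by (rule Metric_space_hyp[OF basis])
    show "metrizable_space (pointwise_topology hyp hdist)"
      using Isom_hyp_polish completely_metrizable_imp_metrizable_space
      by (auto simp: polish_group_def)
    show "restrict T hyp \<in> carrier Hyp.Isom" if "T \<in> orth (- {0})" for T
      by (rule orth_in_Isom_hyp[OF that])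
    show "\<exists>T\<in>orth (- {0}). g = restrict T hyp" if "g \<in> carrier Hyp.Isom" "g (e 0) = e 0" for g
      by (rule Isom_hyp_stabilizer[OF that])
    show "e 0 \<in> hyp" by (rule e0_hyp)
    show "e 0 \<in> sub {0}" by (simp add: sub_def e_inner)
    show "x = e 0" if x: "x \<in> hyp" "x \<in> sub {0}" for x
    proof -
      have "x - (x \<bullet> e 0) *\<^sub>R e 0 = 0"
        by (rule eqI) (use subD[OF x(2)] in \<open>auto simp: inner_diff e_inner\<close>)
      then show ?thesis using hyp_eq_hlift[OF x(1)] by (simp add: hlift_def)
    qed
    show "(\<lambda>n. hdist (x n) p) \<longlonglongrightarrow> 0 \<longleftrightarrow> x \<longlonglongrightarrow> p" if "\<And>n. x n \<in> hyp" "p \<in> hyp" for x :: "nat \<Rightarrow> 'a" and p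
      by (rule hyp_tendsto_iff[OF that])
    show "x - y \<in> sub (- {0}) \<and> norm x = norm y"
      if xy: "x \<in> hyp" "y \<in> hyp" "hdist x (e 0) = hdist y (e 0)" for x y
    proof -
      have 0: "x \<bullet> e 0 = y \<bullet> e 0"
        using cosh_hdist_base[OF xy(1)] cosh_hdist_base[OF xy(2)] xy(3) by simp
      then have "x \<bullet> x = y \<bullet> y" using xy(1,2) unfolding hyp_iff by (metis diff_left_imp_eq)
      then show ?thesis using 0 by (simp add: sub_def inner_diff norm_eq_sqrt_inner)
    qed
    show "\<exists>x\<in>hyp. x - e i \<in> sub {0}" if "i \<notin> {0}" for i
    proof (rule bexI)
      have i: "e i \<in> sub (- {0})" using that by (intro e_in_sub) simp
      show "hlift (e i) \<in> hyp" by (rule hlift_hyp[OF i])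
      show "hlift (e i) - e i \<in> sub {0}" by (simp add: hlift_def sub_def e_inner)
    qed
    show "restrict (boost (3/4)) hyp \<in> carrier Hyp.Isom"
    proof (rule Isom_hypI[where h = "boost (- (3/4))"])
      show "boost (- (3/4)) (boost (3/4) x) = x" for x by (rule boost_inverse[OF q(1)])
      show "boost (3/4) (boost (- (3/4)) x) = x" for x using boost_inverse[OF q(2), of x] by simp
    qed (rule boost_hyp[OF q(1)] boost_hyp[OF q(2)] boost_form[OF q(1)]; assumption)+
    have "(5/4) *\<^sub>R e 0 = e 0 + (1/4) *\<^sub>R e 0" using scaleR_add_left[of 1 "1/4" "e 0"] by simp
    then show "restrict (boost (3/4)) hyp ?c = e 0"
      using c by (simp add: boost_def inner_diff e_inner algebra_simps)
    fix r :: "nat \<Rightarrow> real"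
    assume r: "r \<longlonglongrightarrow> hdist (?c - (- (3/4)) *\<^sub>R e 1 + (- (3/4)) *\<^sub>R e 2) ?c"
    have v0: "cosh (hdist (?v 0) ?c) = 25/16"
      using cosh_hyp_dist[OF basis v(1)[of 0] c] v(2)[of 0] by simp
    have r0: "r \<longlonglongrightarrow> hdist (?v 0) ?c" using r by simp
    have "(\<lambda>n. cosh (r n)) \<longlonglongrightarrow> 25/16" using tendsto_cosh[OF r0] unfolding v0 .
    then have "(\<lambda>n. (25/16 - cosh (r n)) * (16/9)) \<longlonglongrightarrow> (25/16 - 25/16) * (16/9)"
      by (intro tendsto_mult tendsto_diff tendsto_const)
    moreover define t where "t n = (25/16 - cosh (r n)) * (16/9)" for n
    ultimately have t0: "t \<longlonglongrightarrow> 0" by (simp add: t_def[abs_def])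
    have "hdist (?v 0) ?c \<noteq> 0" using v0 by auto
    then have "hdist (?v 0) ?c > 0" using hdist_nonneg[of "?v 0" ?c] by (simp only: less_le) simp
    then have "\<forall>\<^sub>F n in sequentially. r n > 0" by (rule order_tendstoD(1)[OF r0])
    moreover have "\<forall>\<^sub>F n in sequentially. \<bar>t n\<bar> < 1"
      using order_tendstoD(2)[OF tendsto_rabs_zero[OF t0], of 1] by simp
    ultimately have "\<forall>\<^sub>F n in sequentially. hdist (?v (t n)) ?c = r n"
    proof eventually_elim
      case (elim n)
      then have t: "\<bar>t n\<bar> \<le> 1" by simp
      have "cosh (hdist (?v (t n)) ?c) = cosh (r n)"
        unfolding cosh_hyp_dist[OF basis v(1)[OF t] c] v(2)[OF t] by (simp add: t_def field_simps)
      then show ?case using elim hdist_nonneg by (simp add: cosh_real_nonneg_le_iff antisym)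
    qed
    then show "\<exists>t. t \<longlonglongrightarrow> 0 \<and> (\<forall>\<^sub>F n in sequentially. hdist (?v (t n)) ?c = r n)"
      using t0 by blast
  qed (use H sep f c in \<open>simp_all add: sub_def inner_diff e_inner\<close>)
qed

end

theorem theorem1p4:
  fixes e :: "nat \<Rightarrow> 'a::{real_inner, complete_space}"
  assumes "hilbert_basis e"
  shows "polish_group (isom_group (hyp_space e) (hyp_dist e))
           (pointwise_topology (hyp_space e) (hyp_dist e))
       \<and> automatic_continuity TYPE('h) (isom_group (hyp_space e) (hyp_dist e))
           (pointwise_topology (hyp_space e) (hyp_dist e))
       \<and> polish_group (isom_group (UNIV :: 'a set) dist)
           (pointwise_topology (UNIV :: 'a set) dist)
       \<and> automatic_continuity TYPE('h) (isom_group (UNIV :: 'a set) dist)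
           (pointwise_topology (UNIV :: 'a set) dist)"
proof -
  interpret hilbert e by unfold_locales (rule assms)
  show ?thesis
    by (intro conjI Isom_hyp_polish Isom_hyp_automatic_continuity Isom_Hilbert_polish
        Isom_Hilbert_automatic_continuity)
qed

end
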